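(* Let $\alpha>0$, $M>0$, $\eta>1$, $\rho>0$, and suppose $\lceil n^{\frac1{2\alpha+1}}\rceil\le p$. Let the data be $n$ i.i.d. copies of a mean-zero $p$-variate sub-Gaussian random vector with constant $\rho$ and precision matrix $\Omega$. Then the local cropping estimator $\tilde\Omega_k^{\rm op}$ with bandwidth $k$ satisfies $$\sup_{\Omega\in\mathcal Q_\alpha(\eta,M)}\mathbb E\|\tilde\Omega_k^{\rm op}-\Omega\|_{\rm op}^2\ \le\ Ck^{-2\alpha}+C\,\frac{\log p+k}{n}.$$ When $k=\lceil n^{\frac1{2\alpha+1}}\rceil$, $$\sup_{\Omega\in\mathcal Q_\alpha(\eta,M)}\mathbb E\|\tilde\Omega_k^{\rm op}-\Omega\|_{\rm op}^2\ \le\ Cn^{-\frac{2\alpha}{2\alpha+1}}+C\,\frac{\log p}{n}.$$ Here $C>0$ is a constant depending only on $\alpha,\eta,M,\rho$.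
   Context: Parameter space: a positive definite $p\times p$ matrix $\Omega$ has a unique decomposition $\Omega=(I-A)^TD^{-1}(I-A)$ with $A=[a_{ij}]$ strictly lower triangular and $D$ diagonal positive. $\mathcal Q_\alpha(\eta,M)$ is the set of symmetric $\Omega$ with $\eta^{-1}\le\lambda_{\min}(\Omega)\le\lambda_{\max}(\Omega)<\eta$ and $|a_{ij}|<M(i-j)^{-\alpha-1}$ for all $i\in[p]=\{1,\dots,p\}$, $j\in[i-1]$. Sub-Gaussian with constant $\rho$: $\mathbb P\{|v^T(X-\mathbb EX)|>t\}\le 2\exp(-t^2/(2\rho))$ for all $t>0$ and all unit vectors $v$. $\|\cdot\|_{\rm op}$ is the operator (spectral) norm. For a symmetric matrix $S=U\Lambda U^T$ (eigendecomposition, $\Lambda={\rm diag}(\lambda_i)$), $\mathbf P_\eta(S)=U\,{\rm diag}(\lambda_i^* )\,U^T$ with $\lambda_i^*=\min\{\max\{\lambda_i,\eta^{-1}\},\eta\}$. Local cropping estimator. Let $\mathbf Z\in\mathbb R^{n\times p}$ be the data matrix with the $n$ observations as rows, and let $k$ be a positive integer bandwidth. For a block size $b\in\{k,2k\}$ and an integer $m$ with $2-b\le m\le p$, let $J=\{m-b,\dots,m+2b-1\}\cap[p]$ and $I=\{m,\dots,m+b-1\}\cap[p]$ (indices outside $[p]$ are discarded). Let $\tilde\Sigma$ be $\mathbf P_\eta$ applied to the principal submatrix of $\frac1n\mathbf Z^T\mathbf Z$ with index set $J$, and let $\tilde\Omega_m^{(b)}$ be the principal submatrix of $\tilde\Sigma^{-1}$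 corresponding to the index set $I$. Let $\mathbf E_m(\tilde\Omega_m^{(b)})$ be the $p\times p$ matrix equal to $\tilde\Omega_m^{(b)}$ on $I\times I$ and zero elsewhere. Then $$\tilde\Omega_k^{\rm op}=\mathbf P_\eta\Big(\frac1k\Big(\sum_{m=2-2k}^{p}\mathbf E_m(\tilde\Omega_m^{(2k)})-\sum_{m=2-k}^{p}\mathbf E_m(\tilde\Omega_m^{(k)})\Big)\Big).$$ *)

theory Defs
  imports
    "HOL-Probability.Probability"
    "Jordan_Normal_Form.Spectral_Radius"
    "Jordan_Normal_Form.DL_Submatrix"
begin

definition vec_norm2 :: "real Matrix.vec \<Rightarrow> real" where
  "vec_norm2 v = sqrt (scalar_prod v v)"

definition op_norm :: "real Matrix.mat \<Rightarrow> real" where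
  "op_norm A = Sup ((\<lambda>v. vec_norm2 (mult_mat_vec A v)) `
     {v \<in> carrier_vec (dim_col A). vec_norm2 v \<le> 1})"

text \<open>Only meaningful for invertible arguments.\<close>

definition mat_inv :: "real Matrix.mat \<Rightarrow> real Matrix.mat" where
  "mat_inv A = the (mat_inverse A)"

definition symmetric_mat :: "real Matrix.mat \<Rightarrow> bool" where
  "symmetric_mat A \<longleftrightarrow> transpose_mat A = A"

definition lambda_min :: "real Matrix.mat \<Rightarrow> real" where
  "lambda_min A = Min (spectrum A)"

definition lambda_max :: "real Matrix.mat \<Rightarrow> real" where
  "lambda_max A = Max (spectrum A)"

text \<open>
  The operator \<open>P\<^sub>\<eta>\<close> on symmetric matrices. The matrix \<open>T\<close> below does not depend on the
  eigendecomposition \<open>S = U diag(l) U\<^sup>T\<close>, so for symmetric \<open>S\<close> the choice is unique.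
\<close>

definition spectral_clip :: "real \<Rightarrow> real Matrix.mat \<Rightarrow> real Matrix.mat" where
  "spectral_clip \<eta> S = (SOME T. \<exists>U l.
     U \<in> carrier_mat (dim_row S) (dim_row S) \<and>
     transpose_mat U * U = 1\<^sub>m (dim_row S) \<and>
     S = U * mat_diag (dim_row S) l * transpose_mat U \<and>
     T = U * mat_diag (dim_row S) (\<lambda>i. min (max (l i) (1 / \<eta>)) \<eta>) * transpose_mat U)"

text \<open>
  The decomposition of a positive definite matrix is unique, so it does not matter that \<open>A\<close> and
  \<open>D\<close> are existentially quantified.
\<close>

definition precision_class :: "nat \<Rightarrow> real \<Rightarrow> real \<Rightarrow> real \<Rightarrow> real Matrix.mat set" where
  "precision_class p \<alpha> \<eta> M = {\<Omega> \<in> carrier_mat p p.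
     symmetric_mat \<Omega> \<and>
     1 / \<eta> \<le> lambda_min \<Omega> \<and> lambda_min \<Omega> \<le> lambda_max \<Omega> \<and> lambda_max \<Omega> < \<eta> \<and>
     (\<exists>A \<in> carrier_mat p p. \<exists>D \<in> carrier_mat p p.
        (\<forall>i<p. \<forall>j<p. i \<le> j \<longrightarrow> A $$ (i, j) = 0) \<and>
        diagonal_mat D \<and> (\<forall>i<p. D $$ (i, i) > 0) \<and>
        \<Omega> = transpose_mat (1\<^sub>m p - A) * mat_inv D * (1\<^sub>m p - A) \<and>
        (\<forall>i<p. \<forall>j<i. \<bar>A $$ (i, j)\<bar> < M * (real i - real j) powr (- \<alpha> - 1)))}"

text \<open>
  The law of a \<open>p\<close>-variate random vector is a probability measure on the product of \<open>p\<close> copies of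
  the Borel space of the reals. Sub-Gaussian laws have moments of all orders, so for them the
  integrals below are genuine expectations.
\<close>

definition real_space :: "nat \<Rightarrow> (nat \<Rightarrow> real) measure" where
  "real_space p = PiM {..<p} (\<lambda>_. borel)"

definition mean_vec :: "nat \<Rightarrow> (nat \<Rightarrow> real) measure \<Rightarrow> real Matrix.vec" where
  "mean_vec p \<mu> = Matrix.vec p (\<lambda>i. \<integral>x. x i \<partial>\<mu>)"

definition cov_mat :: "nat \<Rightarrow> (nat \<Rightarrow> real) measure \<Rightarrow> real Matrix.mat" where
  "cov_mat p \<mu> = Matrix.mat p p (\<lambda>(i, j).
     \<integral>x. (x i - vec_index (mean_vec p \<mu>) i) * (x j - vec_index (mean_vec p \<mu>) j) \<partial>\<mu>)"

definition sub_gaussian :: "nat \<Rightarrow> real \<Rightarrow> (nat \<Rightarrow> real) measure \<Rightarrow> bool" where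
  "sub_gaussian p \<rho> \<mu> \<longleftrightarrow> (\<forall>t>0. \<forall>v \<in> carrier_vec p. vec_norm2 v = 1 \<longrightarrow>
     \<P>(x in \<mu>. \<bar>scalar_prod v (Matrix.vec p x - mean_vec p \<mu>)\<bar> > t) \<le> 2 * exp (- t\<^sup>2 / (2 * \<rho>)))"

definition precision_mat :: "nat \<Rightarrow> (nat \<Rightarrow> real) measure \<Rightarrow> real Matrix.mat \<Rightarrow> bool" where
  "precision_mat p \<mu> \<Omega> \<longleftrightarrow> \<Omega> \<in> carrier_mat p p \<and>
     inverts_mat (cov_mat p \<mu>) \<Omega> \<and> inverts_mat \<Omega> (cov_mat p \<mu>)"

definition sub_gaussian_laws :: "nat \<Rightarrow> real \<Rightarrow> real Matrix.mat \<Rightarrow> (nat \<Rightarrow> real) measure set" where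
  "sub_gaussian_laws p \<rho> \<Omega> = {\<mu>. prob_space \<mu> \<and> sets \<mu> = sets (real_space p) \<and>
     mean_vec p \<mu> = 0\<^sub>v p \<and> sub_gaussian p \<rho> \<mu> \<and> precision_mat p \<mu> \<Omega>}"

text \<open>
  Matrix indices start at 0, whereas \<open>m\<close> and the window bounds refer to indices in \<open>{1..p}\<close>: row \<open>i\<close>
  of a matrix is the row with index \<open>i + 1\<close>. The following is \<open>{lo..hi} \<inter> {1..p}\<close>.
\<close>

definition window :: "nat \<Rightarrow> int \<Rightarrow> int \<Rightarrow> nat set" where
  "window p lo hi = {i. i < p \<and> lo \<le> int i + 1 \<and> int i + 1 \<le> hi}"

text \<open>Position of the index \<open>i\<close> in the increasing enumeration of \<open>J\<close>, counted from 0.\<close>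

definition rank_in :: "nat set \<Rightarrow> nat \<Rightarrow> nat" where
  "rank_in J i = card {l \<in> J. l < i}"

definition sample_cov :: "real Matrix.mat \<Rightarrow> real Matrix.mat" where
  "sample_cov Z = (1 / real (dim_row Z)) \<cdot>\<^sub>m (transpose_mat Z * Z)"

definition outer_window :: "nat \<Rightarrow> nat \<Rightarrow> int \<Rightarrow> nat set" where
  "outer_window p b m = window p (m - int b) (m + 2 * int b - 1)"

definition inner_window :: "nat \<Rightarrow> nat \<Rightarrow> int \<Rightarrow> nat set" where
  "inner_window p b m = window p m (m + int b - 1)"

definition local_cov :: "real \<Rightarrow> nat \<Rightarrow> int \<Rightarrow> real Matrix.mat \<Rightarrow> real Matrix.mat" where
  "local_cov \<eta> b m Z =
     (let J = outer_window (dim_col Z) b m in spectral_clip \<eta> (submatrix (sample_cov Z) J J))"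

text \<open>
  The rows and columns of \<open>local_cov\<close> are numbered by position in \<open>J\<close>, so the index set \<open>I \<subseteq> J\<close>
  has to be translated accordingly before taking the principal submatrix.
\<close>

definition local_block :: "real \<Rightarrow> nat \<Rightarrow> int \<Rightarrow> real Matrix.mat \<Rightarrow> real Matrix.mat" where
  "local_block \<eta> b m Z =
     (let J = outer_window (dim_col Z) b m;
          I' = rank_in J ` inner_window (dim_col Z) b m
      in submatrix (mat_inv (local_cov \<eta> b m Z)) I' I')"

definition embed_block :: "nat \<Rightarrow> nat set \<Rightarrow> real Matrix.mat \<Rightarrow> real Matrix.mat" where
  "embed_block p I B = Matrix.mat p p (\<lambda>(i, j).
     if i \<in> I \<and> j \<in> I then B $$ (rank_in I i, rank_in I j) else 0)"

definition block_sum :: "real \<Rightarrow> nat \<Rightarrow> real Matrix.mat \<Rightarrow> real Matrix.mat" where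
  "block_sum \<eta> b Z = Matrix.mat (dim_col Z) (dim_col Z) (\<lambda>(i, j).
     \<Sum>m \<in> {2 - int b..int (dim_col Z)}.
       embed_block (dim_col Z) (inner_window (dim_col Z) b m) (local_block \<eta> b m Z) $$ (i, j))"

definition cropping_estimator :: "real \<Rightarrow> nat \<Rightarrow> real Matrix.mat \<Rightarrow> real Matrix.mat" where
  "cropping_estimator \<eta> k Z =
     spectral_clip \<eta> ((1 / real k) \<cdot>\<^sub>m (block_sum \<eta> (2 * k) Z - block_sum \<eta> k Z))"

text \<open>
  The expectation is over \<open>n\<close> independent observations with law \<open>\<mu>\<close>, which form the rows of the
  data matrix. The loss is a continuous function of the data, so the nonnegative integral is its
  expectation.
\<close>

definition op_risk ::
  "nat \<Rightarrow> nat \<Rightarrow> real \<Rightarrow> nat \<Rightarrow> real Matrix.mat \<Rightarrow> (nat \<Rightarrow> real) measure \<Rightarrow> ennreal" where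
  "op_risk n p \<eta> k \<Omega> \<mu> =
     (\<integral>\<^sup>+ x. ennreal ((op_norm (cropping_estimator \<eta> k (Matrix.mat n p (\<lambda>(i, j). x i j)) - \<Omega>))\<^sup>2)
        \<partial>PiM {..<n} (\<lambda>_. \<mu>))"

text \<open>
  A precision matrix does not determine the distribution, so the supremum is over all
  \<open>\<Omega>\<close> in the class and all admissible distributions with precision matrix \<open>\<Omega>\<close>.
\<close>

definition max_risk ::
  "real \<Rightarrow> real \<Rightarrow> real \<Rightarrow> real \<Rightarrow> nat \<Rightarrow> nat \<Rightarrow> nat \<Rightarrow> ennreal" where
  "max_risk \<alpha> M \<eta> \<rho> n p k =
     (SUP \<Omega> \<in> precision_class p \<alpha> \<eta> M. SUP \<mu> \<in> sub_gaussian_laws p \<rho> \<Omega>. op_risk n p \<eta> k \<Omega> \<mu>)"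

end

theory Submission
  imports Defs
begin

unbundle no vec_syntax

text \<open>
  Clipping at most doubles the distance to \<open>\<Omega>\<close>, because \<open>\<Omega>\<close> has its spectrum in \<open>[1/\<eta>, \<eta>]\<close>; so it
  suffices to bound the quadratic form of the unclipped estimator minus \<open>\<Omega>\<close>. Replacing every local
  block by the corresponding block of \<open>\<Omega>\<close> turns the double sum over windows into \<open>\<Omega>\<close> with tapered
  entries, which are exact up to distance \<open>k\<close> from the diagonal; as the Cholesky decay gives
  \<open>|\<Omega>\<^sub>i\<^sub>j| \<le> K |i - j|\<close> to the power \<open>-\<alpha>-1\<close>, the tapering error is of order \<open>k\<close> to the power \<open>-\<alpha>\<close>.
  A local block differs from the block of \<open>\<Omega>\<close> by a truncation error of the same order and by the
  deviation of the local sample covariance. Every index lies in exactly \<open>b\<close> windows of size \<open>b\<close>, so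
  the local errors do not accumulate.

  For the deviations let \<open>q = log p + k\<close>. If \<open>q > n\<close>, the loss is at most \<open>2 \<eta>\<close> and nothing is to be
  shown. Otherwise a grid in each window reduces the operator norms to at most \<open>exp (111 q)\<close> averages
  of centred sub-exponential variables, and one exponential moment with parameter proportional to
  \<open>(n q)\<close> to the power \<open>1/2\<close> bounds the second moment of their maximum by a multiple of \<open>q / n\<close>.
\<close>

section \<open>Spectral decomposition and clipping\<close>

text \<open>Blocks, inverses and sums of blocks do not share eigenvectors, so matrices are compared
  through their quadratic forms: these restrict to blocks by zero padding, add up over windows, and
  give back the operator norm because all matrices involved are symmetric. The interval
  [1/\<eta>, \<eta>] is invariant under t -> 1/t, so one predicate serves for \<Omega>, its inverse,
  their blocks and the clipped estimates.

  The outer windows exceed the inner ones by \<open>b\<close> indices on both sides, so only entries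
  of \<Omega> at distance more than \<open>b\<close> from the diagonal couple an inner window to the
  complement of its outer window. Two block sizes are subtracted because a single size would give
  the weights (b - |i-j|)/b, which are wrong already next to the diagonal.

  Squares of sub-Gaussian variables have exponential moments only near 0, so the moment parameter
  must stay below a multiple of 1/\<rho>; this forces the distinction between q > n and q <= n. The
  loss enters the integral only through a pointwise bound by a finite maximum of measurable
  deviations.\<close>

lemma symmetric_real_eigenvector:
  fixes A :: "real Matrix.mat"
  assumes A: "A \<in> carrier_mat n n" and "n > 0" and sym: "symmetric_mat A"
  obtains v l where "v \<in> carrier_vec n" "scalar_prod v v = 1" "A *\<^sub>v v = l \<cdot>\<^sub>v v"
proof -
  define C where "C = map_mat complex_of_real A"
  have C: "C \<in> carrier_mat n n" using A by (simp add: C_def)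
  obtain z where "z \<in> spectrum C" using spectrum_non_empty[OF C] \<open>n > 0\<close> by auto
  then obtain w where "eigenvector C w z" by (auto simp: spectrum_def eigenvalue_def)
  then have w: "w \<in> carrier_vec n" "w \<noteq> 0\<^sub>v n" "C *\<^sub>v w = z \<cdot>\<^sub>v w"
    using C by (auto simp: eigenvector_def)
  have As: "A $$ (i,j) = A $$ (j,i)" if "i < n" "j < n" for i j
    using sym that A unfolding symmetric_mat_def by (metis index_transpose_mat(1) carrier_matD)
  have eq: "(\<Sum>j<n. of_real (A $$ (i,j)) * w $ j) = z * w $ i" if "i < n" for i
  proof -
    have "(C *\<^sub>v w) $ i = z * w $ i" using w that by simp
    then show ?thesis using that C w A
      by (simp add: C_def mult_mat_vec_def scalar_prod_def row_def lessThan_atLeast0)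
  qed
  define a where "a = (\<lambda>i. Re (w $ i))"
  define b where "b = (\<lambda>i. Im (w $ i))"
  have ea: "(\<Sum>j<n. A $$ (i,j) * a j) = Re z * a i - Im z * b i" if "i < n" for i
    using arg_cong[OF eq[OF that], of Re] by (simp add: a_def b_def)
  have eb: "(\<Sum>j<n. A $$ (i,j) * b j) = Re z * b i + Im z * a i" if "i < n" for i
    using arg_cong[OF eq[OF that], of Im] by (simp add: a_def b_def)
  \<comment> \<open>Pairing the real part \<open>a\<close> and the imaginary part \<open>b\<close>
    of the eigenvector through the symmetric \<open>A\<close> in both orders gives Im z * (|a|^2 +
    |b|^2) = 0, so the eigenvalue is real.\<close>
  have "(\<Sum>i<n. b i * (\<Sum>j<n. A $$ (i,j) * a j)) = (\<Sum>i<n. a i * (\<Sum>j<n. A $$ (i,j) * b j))"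
  proof -
    have "(\<Sum>i<n. b i * (\<Sum>j<n. A $$ (i,j) * a j)) = (\<Sum>i<n. \<Sum>j<n. b i * (A $$ (i,j) * a j))"
      by (simp add: sum_distrib_left)
    also have "\<dots> = (\<Sum>j<n. \<Sum>i<n. b i * (A $$ (i,j) * a j))" by (rule sum.swap)
    also have "\<dots> = (\<Sum>j<n. \<Sum>i<n. a j * (A $$ (j,i) * b i))"
      by (intro sum.cong refl) (use As in auto)
    finally show ?thesis by (simp add: sum_distrib_left)
  qed
  then have "(\<Sum>i<n. b i * (Re z * a i - Im z * b i)) = (\<Sum>i<n. a i * (Re z * b i + Im z * a i))"
    by (simp add: ea eb)
  then have "Im z * (\<Sum>i<n. (a i)\<^sup>2 + (b i)\<^sup>2) = 0"
    by (simp add: algebra_simps sum.distrib sum_subtractf sum_distrib_left power2_eq_square)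
  moreover have "(\<Sum>i<n. (a i)\<^sup>2 + (b i)\<^sup>2) \<noteq> 0"
  proof
    assume "(\<Sum>i<n. (a i)\<^sup>2 + (b i)\<^sup>2) = 0"
    then have "\<forall>i<n. (a i)\<^sup>2 + (b i)\<^sup>2 = 0" by (subst (asm) sum_nonneg_eq_0_iff) auto
    then have "w = 0\<^sub>v n" using w by (intro eq_vecI) (auto simp: a_def b_def complex_eq_iff)
    with w show False by simp
  qed
  ultimately have z: "Im z = 0" by auto
  \<comment> \<open>With a real eigenvalue, \<open>a\<close> and \<open>b\<close> each satisfy the
    eigenvector equation; one that is nonzero is selected.\<close>
  define u where "u = Matrix.vec n (if \<exists>i<n. a i \<noteq> 0 then a else b)"
  have u: "u \<in> carrier_vec n" by (simp add: u_def)
  have eu: "(\<Sum>j<n. A $$ (i,j) * u $ j) = Re z * u $ i" if "i < n" for i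
    using ea[OF that] eb[OF that] z that by (auto simp: u_def)
  have "\<exists>i<n. u $ i \<noteq> 0"
  proof (rule ccontr)
    assume "\<not> ?thesis"
    then have "\<forall>i<n. a i = 0 \<and> b i = 0" by (auto simp: u_def split: if_splits)
    then have "w = 0\<^sub>v n" using w by (intro eq_vecI) (auto simp: a_def b_def complex_eq_iff)
    with w show False by simp
  qed
  then obtain i0 where i0: "i0 < n" "u $ i0 \<noteq> 0" by auto
  have "scalar_prod u u = (\<Sum>i<n. (u $ i)\<^sup>2)"
    using u by (simp add: scalar_prod_def lessThan_atLeast0 power2_eq_square)
  moreover have "\<dots> > 0" using i0 by (intro sum_pos2[of _ i0]) auto
  ultimately have pos: "scalar_prod u u > 0" by simp
  define v where "v = (1 / sqrt (scalar_prod u u)) \<cdot>\<^sub>v u"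
  have v: "v \<in> carrier_vec n" using u by (simp add: v_def)
  have "A *\<^sub>v u = Re z \<cdot>\<^sub>v u"
    using eu u A by (intro eq_vecI) (auto simp: mult_mat_vec_def scalar_prod_def row_def lessThan_atLeast0)
  then have Av: "A *\<^sub>v v = Re z \<cdot>\<^sub>v v"
    using u A by (simp add: v_def mult_mat_vec smult_smult_assoc mult.commute)
  have "scalar_prod v v = 1"
    using u pos by (simp add: v_def)
  from that[OF v this Av] show thesis .
qed

text \<open>Reflection along \<open>u - unit_vec n 0\<close>: it exchanges \<open>u\<close> and the
  first basis vector, and so supplies the orthogonal change of basis that splits off one eigenvector
  in the spectral theorem.\<close>

lemma householder_exists:
  fixes u :: "real Matrix.vec"
  assumes u: "u \<in> carrier_vec n" "scalar_prod u u = 1"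
  obtains H where "H \<in> carrier_mat n n" "transpose_mat H = H" "H * H = 1\<^sub>m n"
    "H *\<^sub>v unit_vec n 0 = u"
proof -
  have n: "n > 0" using u by (cases n) (auto simp: scalar_prod_def)
  define w where "w = u - unit_vec n 0"
  have w: "w \<in> carrier_vec n" using u by (simp add: w_def)
  \<comment> \<open>If \<open>u\<close> is already the first basis vector, then \<open>w\<close> = 0
    and division by zero yields \<open>c\<close> = 0; the reflection degenerates to the identity, as
    it should.\<close>
  define c where "c = 2 / scalar_prod w w"
  define H where "H = Matrix.mat n n (\<lambda>(i,j). (if i = j then 1 else 0) - c * (w $ i * w $ j))"
  have H: "H \<in> carrier_mat n n" by (simp add: H_def)
  have e0: "unit_vec n 0 \<in> carrier_vec n" by simp
  have ww: "scalar_prod w w = - 2 * w $ 0"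
  proof -
    have "scalar_prod w w = scalar_prod u u - 2 * u $ 0 + 1"
      using u n by (simp add: w_def minus_scalar_prod_distrib[OF u(1) e0] scalar_prod_minus_distrib[of _ n])
    then show ?thesis using u n by (simp add: w_def)
  qed
  have cw: "c * (c * scalar_prod w w) = 2 * c"
    by (simp add: c_def power2_eq_square)
  have "transpose_mat H = H" by (intro eq_matI) (auto simp: H_def)
  moreover have "H * H = 1\<^sub>m n"
  proof (rule eq_matI)
    fix i j assume "i < dim_row (1\<^sub>m n)" "j < dim_col (1\<^sub>m n)"
    then have ij: "i < n" "j < n" by auto
    have "(H * H) $$ (i,j) = (\<Sum>l<n. ((if i = l then 1 else 0) - c * (w $ i * w $ l)) *
        ((if l = j then 1 else 0) - c * (w $ l * w $ j)))"
      using ij by (simp add: H_def times_mat_def scalar_prod_def row_def col_def lessThan_atLeast0)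
    also have "\<dots> = (\<Sum>l<n. (if i = l then (if l = j then 1 else 0) else 0)
        - (if i = l then c * (w $ l * w $ j) else 0) - (if l = j then c * (w $ i * w $ l) else 0)
        + c * c * (w $ i * w $ j) * (w $ l * w $ l))"
      by (intro sum.cong refl) (auto simp: algebra_simps)
    also have "\<dots> = (if i = j then 1 else 0) - 2 * (c * (w $ i * w $ j))
        + c * c * (w $ i * w $ j) * scalar_prod w w"
      using ij w by (simp add: sum.distrib sum_subtractf sum_distrib_left[symmetric] scalar_prod_def lessThan_atLeast0)
    also have "c * c * (w $ i * w $ j) * scalar_prod w w = c * (c * scalar_prod w w) * (w $ i * w $ j)"
      by (simp add: ac_simps)
    also have "(if i = j then 1 else 0) - 2 * (c * (w $ i * w $ j)) + c * (c * scalar_prod w w) * (w $ i * w $ j)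
       = (if i = j then 1 else 0)" unfolding cw by simp
    finally show "(H * H) $$ (i,j) = 1\<^sub>m n $$ (i,j)" using ij by simp
  qed (auto simp: H_def)
  moreover have "H *\<^sub>v unit_vec n 0 = u"
  proof (rule eq_vecI)
    fix i assume "i < dim_vec u"
    then have i: "i < n" using u by simp
    have "(H *\<^sub>v unit_vec n 0) $ i = H $$ (i,0)" using i n H by simp
    also have "\<dots> = (if i = 0 then 1 else 0) - c * w $ 0 * w $ i" using i n by (simp add: H_def)
    also have "\<dots> = u $ i"
    proof (cases "w $ 0 = 0")
      case True
      then have "scalar_prod w w = 0" using ww by simp
      then have "(\<Sum>l<n. (w $ l)\<^sup>2) = 0"
        using w by (simp add: scalar_prod_def lessThan_atLeast0 power2_eq_square)
      then have "w $ i = 0" using i by (subst (asm) sum_nonneg_eq_0_iff) auto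
      then show ?thesis using True i n u by (auto simp: w_def)
    next
      case False
      then have "c * w $ 0 = -1" by (simp add: c_def ww)
      then show ?thesis using i u by (simp add: w_def)
    qed
    finally show "(H *\<^sub>v unit_vec n 0) $ i = u $ i" .
  qed (use u H in auto)
  ultimately show thesis using that H by blast
qed

section \<open>Orthogonal diagonalisation\<close>

definition orth_mat :: "nat \<Rightarrow> real Matrix.mat \<Rightarrow> bool" where
  "orth_mat n U \<longleftrightarrow> U \<in> carrier_mat n n \<and> transpose_mat U * U = 1\<^sub>m n \<and> U * transpose_mat U = 1\<^sub>m n"

definition spectral_mat :: "nat \<Rightarrow> real Matrix.mat \<Rightarrow> (nat \<Rightarrow> real) \<Rightarrow> real Matrix.mat" where
  "spectral_mat n U l = U * mat_diag n l * transpose_mat U"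

lemma orth_matI:
  assumes "U \<in> carrier_mat n n" "transpose_mat U * U = 1\<^sub>m n"
  shows "orth_mat n U"
  using assms mat_mult_left_right_inverse[of "transpose_mat U" n U] by (simp add: orth_mat_def)

text \<open>Deflation by induction on the dimension: conjugating with the reflection
  \<open>H\<close> makes the first basis vector an eigenvector, symmetry clears row 0 as well as
  column 0, and the remaining block of size \<open>n\<close> is diagonalised by the induction
  hypothesis.\<close>

lemma spectral_decomposition:
  assumes "S \<in> carrier_mat n n" "symmetric_mat S"
  shows "\<exists>U l. orth_mat n U \<and> S = spectral_mat n U l"
  using assms
proof (induction n arbitrary: S)
  case 0
  have "orth_mat 0 (1\<^sub>m 0)" by (auto simp: orth_mat_def)
  moreover have "S = spectral_mat 0 (1\<^sub>m 0) (\<lambda>_. 0)"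
    using 0 by (intro eq_matI) (auto simp: spectral_mat_def)
  ultimately show ?case by blast
next
  case (Suc n)
  note S = Suc.prems(1)
  obtain v l0 where v: "v \<in> carrier_vec (Suc n)" "scalar_prod v v = 1" "S *\<^sub>v v = l0 \<cdot>\<^sub>v v"
    using symmetric_real_eigenvector[OF S _ Suc.prems(2)] by auto
  obtain H where H: "H \<in> carrier_mat (Suc n) (Suc n)" "transpose_mat H = H" "H * H = 1\<^sub>m (Suc n)"
    "H *\<^sub>v unit_vec (Suc n) 0 = v"
    using householder_exists[OF v(1,2)] .
  define B where "B = H * S * H"
  have B: "B \<in> carrier_mat (Suc n) (Suc n)" using H S by (simp add: B_def)
  have Bs: "transpose_mat B = B"
  proof -
    have "transpose_mat B = H * (transpose_mat S * H)"
      using H S by (simp add: B_def transpose_mult[of _ "Suc n" "Suc n" _ "Suc n"])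
    also have "\<dots> = B" using Suc.prems(2) H S by (simp add: B_def symmetric_mat_def assoc_mult_mat[of _ "Suc n" "Suc n" _ "Suc n" _ "Suc n"])
    finally show ?thesis .
  qed
  have Hv: "H *\<^sub>v v = unit_vec (Suc n) 0"
    using assoc_mult_mat_vec[OF H(1) H(1), of "unit_vec (Suc n) 0"] H by simp
  have "B *\<^sub>v unit_vec (Suc n) 0 = l0 \<cdot>\<^sub>v unit_vec (Suc n) 0"
    using H S v Hv by (simp add: B_def assoc_mult_mat_vec[of _ "Suc n" "Suc n" _ "Suc n"] mult_mat_vec[of _ "Suc n" "Suc n"])
  then have "(B *\<^sub>v unit_vec (Suc n) 0) $ i = (l0 \<cdot>\<^sub>v unit_vec (Suc n) 0) $ i" for i by simp
  then have B0: "B $$ (i, 0) = (if i = 0 then l0 else 0)" if "i < Suc n" for i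
    using that B by (auto dest!: meta_spec[of _ i] split: if_splits)
  have B0': "B $$ (0, i) = (if i = 0 then l0 else 0)" if "i < Suc n" for i
    using B0[OF that] Bs B that by (metis carrier_matD index_transpose_mat(1) zero_less_Suc)
  define B' where "B' = Matrix.mat n n (\<lambda>(i,j). B $$ (Suc i, Suc j))"
  have B': "B' \<in> carrier_mat n n" by (simp add: B'_def)
  have "symmetric_mat B'" unfolding symmetric_mat_def
  proof (rule eq_matI)
    fix i j assume "i < dim_row B'" "j < dim_col B'"
    then have ij: "i < n" "j < n" by (auto simp: B'_def)
    have "B $$ (Suc j, Suc i) = transpose_mat B $$ (Suc i, Suc j)" using ij B by simp
    then show "transpose_mat B' $$ (i, j) = B' $$ (i, j)" using ij Bs by (simp add: B'_def)
  qed (auto simp: B'_def)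
  from Suc.IH[OF B' this] obtain V l where V: "orth_mat n V" "B' = spectral_mat n V l" by blast
  have Vc: "V \<in> carrier_mat n n" and VV: "transpose_mat V * V = 1\<^sub>m n"
    using V by (auto simp: orth_mat_def)
  \<comment> \<open>The eigenbasis of the smaller block is padded with a leading 1;
    \<open>H * F\<close> is then an eigenbasis of \<open>S\<close>.\<close>
  define F where "F = four_block_mat (1\<^sub>m 1) (0\<^sub>m 1 n) (0\<^sub>m n 1) V"
  define D where "D = mat_diag (Suc n) (\<lambda>i. if i = 0 then l0 else l (i - 1))"
  have F: "F \<in> carrier_mat (Suc n) (Suc n)" using Vc by (auto simp: F_def)
  have tF: "transpose_mat F = four_block_mat (1\<^sub>m 1) (0\<^sub>m 1 n) (0\<^sub>m n 1) (transpose_mat V)"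
    unfolding F_def by (subst transpose_four_block_mat[of _ 1 1 _ n _ n]) (use Vc in auto)
  have Db: "D = four_block_mat (l0 \<cdot>\<^sub>m 1\<^sub>m 1) (0\<^sub>m 1 n) (0\<^sub>m n 1) (mat_diag n l)"
    by (rule eq_matI) (auto simp: D_def mat_diag_def)
  have Bb: "B = four_block_mat (l0 \<cdot>\<^sub>m 1\<^sub>m 1) (0\<^sub>m 1 n) (0\<^sub>m n 1) B'"
    using B B0 B0' by (intro eq_matI) (auto simp: B'_def)
  have FF: "transpose_mat F * F = 1\<^sub>m (Suc n)"
    unfolding tF unfolding F_def
    by (subst mult_four_block_mat[of _ 1 1 _ n _ n _ _ 1 _ n]) (use Vc VV in \<open>auto simp: four_block_one_mat[of 1 n, simplified]\<close>)
  have FDF: "F * D * transpose_mat F = B"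
    unfolding tF Db Bb V(2) spectral_mat_def unfolding F_def
    using Vc by (simp add: mult_four_block_mat[of _ 1 1 _ n _ n _ _ 1 _ n] left_mult_zero_mat[of _ n n] left_add_zero_mat[of _ 1 n] left_add_zero_mat[of _ n n] mult_carrier_mat[of _ n n _ n] right_mult_zero_mat[of _ n n])
  define U where "U = H * F"
  have U: "U \<in> carrier_mat (Suc n) (Suc n)" using H F by (simp add: U_def)
  have tU: "transpose_mat U = transpose_mat F * H"
    using H F by (simp add: U_def transpose_mult[of _ "Suc n" "Suc n" _ "Suc n"])
  note assoc = assoc_mult_mat[of _ "Suc n" "Suc n" _ "Suc n" _ "Suc n"]
  have D: "D \<in> carrier_mat (Suc n) (Suc n)" by (simp add: D_def)
  have tFc: "transpose_mat F \<in> carrier_mat (Suc n) (Suc n)" using F by simp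
  have HX: "H * (H * X) = X" if "X \<in> carrier_mat (Suc n) (Suc n)" for X
    using that H(1,3) assoc[OF H(1) H(1) that] by simp
  have "transpose_mat U * U = transpose_mat F * (H * (H * F))"
    unfolding tU unfolding U_def using H(1) F tFc by (simp add: assoc)
  then have "transpose_mat U * U = 1\<^sub>m (Suc n)" using HX[OF F] FF by simp
  then have "orth_mat (Suc n) U" using U by (rule orth_matI[rotated])
  moreover have "S = spectral_mat (Suc n) U (\<lambda>i. if i = 0 then l0 else l (i - 1))"
  proof -
    have "spectral_mat (Suc n) U (\<lambda>i. if i = 0 then l0 else l (i - 1)) = H * (F * D * transpose_mat F) * H"
      unfolding spectral_mat_def tU D_def[symmetric] unfolding U_def using H(1) F D tFc by (simp add: assoc)
    also have "\<dots> = H * (H * (S * (H * H)))" unfolding FDF B_def using H(1) S by (simp add: assoc)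
    also have "\<dots> = S" using H S HX by simp
    finally show ?thesis by simp
  qed
  ultimately show ?case by blast
qed

lemma orth_matD:
  assumes "orth_mat n U"
  shows "U \<in> carrier_mat n n" "transpose_mat U * U = 1\<^sub>m n" "U * transpose_mat U = 1\<^sub>m n"
  using assms by (auto simp: orth_mat_def)

lemma spectral_mat_carrier [simp]: "orth_mat n U \<Longrightarrow> spectral_mat n U l \<in> carrier_mat n n"
  by (auto simp: spectral_mat_def orth_mat_def)

lemma spectral_mat_one: "orth_mat n U \<Longrightarrow> spectral_mat n U (\<lambda>_. 1) = 1\<^sub>m n"
  by (auto simp: spectral_mat_def orth_mat_def right_mult_one_mat[of _ n n])

lemma spectral_mat_mult:
  assumes U: "orth_mat n U"
  shows "spectral_mat n U l * spectral_mat n U l' = spectral_mat n U (\<lambda>i. l i * l' i)"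
proof -
  note [simp] = orth_matD[OF U] assoc_mult_mat[of _ n n _ n _ n] mult_carrier_mat[of _ n n _ n]
  have "spectral_mat n U l * spectral_mat n U l' =
      U * (mat_diag n l * ((transpose_mat U * U) * (mat_diag n l' * transpose_mat U)))"
    unfolding spectral_mat_def by (simp del: orth_matD(2,3)[OF U])
  also have "\<dots> = U * ((mat_diag n l * mat_diag n l') * transpose_mat U)"
    by (simp del: mat_diag_diag add: left_mult_one_mat[of _ n n])
  also have "\<dots> = spectral_mat n U (\<lambda>i. l i * l' i)"
    unfolding mat_diag_diag[symmetric] spectral_mat_def by (simp del: mat_diag_diag)
  finally show ?thesis .
qed

lemma symmetric_spectral_mat:
  assumes U: "orth_mat n U"
  shows "symmetric_mat (spectral_mat n U l)"
proof -
  note [simp] = orth_matD[OF U] mult_carrier_mat[of _ n n _ n]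
  have "transpose_mat (mat_diag n l) = mat_diag n l" by (auto simp: mat_diag_def)
  then show ?thesis
    by (simp add: symmetric_mat_def spectral_mat_def transpose_mult[of _ n n _ n] assoc_mult_mat[of _ n n _ n _ n])
qed

text \<open>In the coordinates y = U^T x each form is a sum of the y_i^2 with weights 1, l_i or
  l_i^2, so bounds on matrices become termwise bounds on weights.\<close>

lemma spectral_mat_forms:
  assumes U: "orth_mat n U" and x: "x \<in> carrier_vec n"
  defines "y \<equiv> transpose_mat U *\<^sub>v x"
  shows "scalar_prod x x = (\<Sum>i<n. (y $ i)\<^sup>2)"
    "scalar_prod x (spectral_mat n U l *\<^sub>v x) = (\<Sum>i<n. l i * (y $ i)\<^sup>2)"
    "scalar_prod (spectral_mat n U l *\<^sub>v x) (spectral_mat n U l *\<^sub>v x) = (\<Sum>i<n. (l i)\<^sup>2 * (y $ i)\<^sup>2)"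
proof -
  note Uc = orth_matD[OF U]
  have y: "y \<in> carrier_vec n" using Uc x by (simp add: y_def)
  have form: "scalar_prod x (spectral_mat n U l *\<^sub>v x) = (\<Sum>i<n. l i * (y $ i)\<^sup>2)" for l
  proof -
    have "spectral_mat n U l *\<^sub>v x = U *\<^sub>v (mat_diag n l *\<^sub>v y)"
      unfolding spectral_mat_def y_def using Uc x
      by (simp add: assoc_mult_mat_vec[of _ n n _ n] mult_carrier_mat[of _ n n _ n])
    then have "scalar_prod x (spectral_mat n U l *\<^sub>v x) = scalar_prod y (mat_diag n l *\<^sub>v y)"
      using transpose_vec_mult_scalar[OF Uc(1), of "mat_diag n l *\<^sub>v y" x] x y
      by (simp add: y_def[symmetric] mult_mat_vec_carrier[of _ n n])
    also have "\<dots> = (\<Sum>i<n. y $ i * (\<Sum>j<n. (if i = j then l j else 0) * y $ j))"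
      using y by (simp add: mat_diag_def scalar_prod_def mult_mat_vec_def row_def lessThan_atLeast0)
    also have "\<dots> = (\<Sum>i<n. l i * (y $ i)\<^sup>2)"
      by (intro sum.cong refl) (simp add: if_distrib[of "\<lambda>c. c * _"] power2_eq_square cong: if_cong)
    finally show ?thesis .
  qed
  show "scalar_prod x (spectral_mat n U l *\<^sub>v x) = (\<Sum>i<n. l i * (y $ i)\<^sup>2)" by (rule form)
  show "scalar_prod x x = (\<Sum>i<n. (y $ i)\<^sup>2)"
    using form[of "\<lambda>_. 1"] x by (simp add: spectral_mat_one[OF U])
  let ?M = "spectral_mat n U l"
  have M: "?M \<in> carrier_mat n n" "transpose_mat ?M = ?M"
    using U symmetric_spectral_mat[OF U, of l] by (auto simp: symmetric_mat_def)
  have "scalar_prod (?M *\<^sub>v x) (?M *\<^sub>v x) = scalar_prod x ((?M * ?M) *\<^sub>v x)"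
    using transpose_vec_mult_scalar[OF M(1), of "?M *\<^sub>v x" x] x M by simp
  then show "scalar_prod (?M *\<^sub>v x) (?M *\<^sub>v x) = (\<Sum>i<n. (l i)\<^sup>2 * (y $ i)\<^sup>2)"
    using form by (simp add: spectral_mat_mult[OF U] power2_eq_square)
qed

lemma spectral_mat_eigenvector:
  assumes U: "orth_mat n U" and i: "i < n"
  obtains x where "x \<in> carrier_vec n" "scalar_prod x x = 1" "spectral_mat n U l *\<^sub>v x = l i \<cdot>\<^sub>v x"
    "scalar_prod x (spectral_mat n U l *\<^sub>v x) = l i"
proof
  note Uc = orth_matD[OF U]
  let ?x = "U *\<^sub>v unit_vec n i"
  show x: "?x \<in> carrier_vec n" using Uc by simp
  have y: "transpose_mat U *\<^sub>v ?x = unit_vec n i"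
    using Uc by (simp flip: assoc_mult_mat_vec[of _ n n _ n])
  have sum1: "(\<Sum>j<n. f j * (unit_vec n i $ j)\<^sup>2) = (f i :: real)" for f
  proof -
    have "(\<Sum>j<n. f j * (unit_vec n i $ j)\<^sup>2) = (\<Sum>j<n. if j = i then f j else 0)"
      using i by (intro sum.cong refl) auto
    then show ?thesis using i by simp
  qed
  show "scalar_prod ?x ?x = 1" using spectral_mat_forms(1)[OF U x] sum1[of "\<lambda>_. 1"] unfolding y by simp
  show "scalar_prod ?x (spectral_mat n U l *\<^sub>v ?x) = l i"
    using spectral_mat_forms(2)[OF U x, of l] sum1 unfolding y by simp
  have "spectral_mat n U l *\<^sub>v ?x = U *\<^sub>v (mat_diag n l *\<^sub>v (transpose_mat U *\<^sub>v ?x))"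
    unfolding spectral_mat_def using Uc by (simp add: assoc_mult_mat_vec[of _ n n _ n] mult_carrier_mat[of _ n n _ n])
  also have "mat_diag n l *\<^sub>v (transpose_mat U *\<^sub>v ?x) = l i \<cdot>\<^sub>v unit_vec n i"
    unfolding y using i by (intro eq_vecI) (auto simp: mat_diag_def)
  finally show "spectral_mat n U l *\<^sub>v ?x = l i \<cdot>\<^sub>v ?x" using Uc by (simp add: mult_mat_vec[of _ n n])
qed

text \<open>Two-sided spectral bound in terms of Rayleigh quotients instead of
  \<open>spectrum\<close>: in this form it passes to principal submatrices by padding vectors with
  zeros. The upper end is not strict, since clipping can produce the eigenvalue \<eta>.\<close>

definition spectrum_within :: "nat \<Rightarrow> real \<Rightarrow> real Matrix.mat \<Rightarrow> bool" where
  "spectrum_within n \<eta> B \<longleftrightarrow> B \<in> carrier_mat n n \<and> symmetric_mat B \<and>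
     (\<forall>x \<in> carrier_vec n. scalar_prod x x / \<eta> \<le> scalar_prod x (B *\<^sub>v x) \<and>
        scalar_prod x (B *\<^sub>v x) \<le> \<eta> * scalar_prod x x)"

lemma spectrum_withinD:
  assumes "spectrum_within n \<eta> B"
  shows "B \<in> carrier_mat n n" "symmetric_mat B"
    "x \<in> carrier_vec n \<Longrightarrow> scalar_prod x x / \<eta> \<le> scalar_prod x (B *\<^sub>v x)"
    "x \<in> carrier_vec n \<Longrightarrow> scalar_prod x (B *\<^sub>v x) \<le> \<eta> * scalar_prod x x"
  using assms by (auto simp: spectrum_within_def)

lemma spectrum_within_spectral_mat_iff:
  assumes U: "orth_mat n U"
  shows "spectrum_within n \<eta> (spectral_mat n U l) \<longleftrightarrow> (\<forall>i<n. 1 / \<eta> \<le> l i \<and> l i \<le> \<eta>)"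
proof
  assume W: "spectrum_within n \<eta> (spectral_mat n U l)"
  show "\<forall>i<n. 1 / \<eta> \<le> l i \<and> l i \<le> \<eta>"
  proof (intro allI impI)
    fix i assume "i < n"
    obtain x where x: "x \<in> carrier_vec n" "scalar_prod x x = 1" "scalar_prod x (spectral_mat n U l *\<^sub>v x) = l i"
      by (rule spectral_mat_eigenvector[OF U \<open>i < n\<close>, of l])
    show "1 / \<eta> \<le> l i \<and> l i \<le> \<eta>"
      using spectrum_withinD(3,4)[OF W x(1)] x by simp
  qed
next
  assume l: "\<forall>i<n. 1 / \<eta> \<le> l i \<and> l i \<le> \<eta>"
  show "spectrum_within n \<eta> (spectral_mat n U l)"
    unfolding spectrum_within_def
  proof (intro conjI ballI)
    fix x :: "real Matrix.vec" assume x: "x \<in> carrier_vec n"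
    show "scalar_prod x x / \<eta> \<le> scalar_prod x (spectral_mat n U l *\<^sub>v x)"
      unfolding spectral_mat_forms[OF U x] sum_divide_distrib
    proof (rule sum_mono)
      fix i assume "i \<in> {..<n}"
      then have "1 / \<eta> * ((transpose_mat U *\<^sub>v x) $ i)\<^sup>2 \<le> l i * ((transpose_mat U *\<^sub>v x) $ i)\<^sup>2"
        using l by (intro mult_right_mono) auto
      then show "((transpose_mat U *\<^sub>v x) $ i)\<^sup>2 / \<eta> \<le> l i * ((transpose_mat U *\<^sub>v x) $ i)\<^sup>2" by simp
    qed
    show "scalar_prod x (spectral_mat n U l *\<^sub>v x) \<le> \<eta> * scalar_prod x x"
      unfolding spectral_mat_forms[OF U x] sum_distrib_left
      using l by (intro sum_mono mult_right_mono) auto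
  qed (use U symmetric_spectral_mat[OF U] in auto)
qed

lemma spectrum_within_decomposition:
  assumes "spectrum_within n \<eta> B"
  obtains U l where "orth_mat n U" "B = spectral_mat n U l" "\<And>i. i < n \<Longrightarrow> 1 / \<eta> \<le> l i \<and> l i \<le> \<eta>"
  using spectral_decomposition[OF spectrum_withinD(1,2)[OF assms]] spectrum_within_spectral_mat_iff assms
  by metis

lemma spectrum_within_norm_le:
  assumes W: "spectrum_within n \<eta> B" and "\<eta> > 0" and x: "x \<in> carrier_vec n"
  shows "scalar_prod (B *\<^sub>v x) (B *\<^sub>v x) \<le> \<eta>\<^sup>2 * scalar_prod x x"
proof -
  obtain U l where U: "orth_mat n U" "B = spectral_mat n U l" and l: "\<And>i. i < n \<Longrightarrow> 1 / \<eta> \<le> l i \<and> l i \<le> \<eta>"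
    using spectrum_within_decomposition[OF W] by blast
  have "0 \<le> l i" if "i < n" for i
    using l[OF that] \<open>\<eta> > 0\<close> order_trans[of 0 "1 / \<eta>" "l i"] by simp
  then have "(l i)\<^sup>2 \<le> \<eta>\<^sup>2" if "i < n" for i
    using l[OF that] that by (intro power_mono) auto
  then show ?thesis unfolding U(2) spectral_mat_forms[OF U(1) x] sum_distrib_left
    by (intro sum_mono mult_right_mono) auto
qed

text \<open>The map t -> 1/t preserves [1/\<eta>, \<eta>], and \<open>N\<close> is identified with
  the spectral inverse \<open>R\<close>. This is applied to \<Sigma> as the inverse of \<Omega> and
  to the inverse of a clipped local covariance.\<close>

lemma spectrum_within_inverse:
  assumes W: "spectrum_within n \<eta> B" and "\<eta> > 0" and N: "N \<in> carrier_mat n n" "N * B = 1\<^sub>m n"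
  shows "spectrum_within n \<eta> N"
proof -
  obtain U l where U: "orth_mat n U" "B = spectral_mat n U l" and l: "\<And>i. i < n \<Longrightarrow> 1 / \<eta> \<le> l i \<and> l i \<le> \<eta>"
    using spectrum_within_decomposition[OF W] by blast
  have pos: "0 < l i" if "i < n" for i
    using l[OF that] \<open>\<eta> > 0\<close> less_le_trans[of 0 "1 / \<eta>" "l i"] by simp
  define R where "R = spectral_mat n U (\<lambda>i. 1 / l i)"
  have R: "R \<in> carrier_mat n n" using U by (simp add: R_def)
  have "mat_diag n (\<lambda>i. l i * (1 / l i)) = mat_diag n (\<lambda>i. 1)"
    using pos by (intro eq_matI) (auto simp: mat_diag_def less_imp_neq[THEN not_sym])
  then have "B * R = 1\<^sub>m n"
    unfolding R_def U(2) spectral_mat_mult[OF U(1)] spectral_mat_one[OF U(1), symmetric]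
    by (simp add: spectral_mat_def)
  then have "N = R"
    using assoc_mult_mat[OF N(1) spectrum_withinD(1)[OF W] R] N R by simp
  moreover have "1 / \<eta> \<le> 1 / l i \<and> 1 / l i \<le> \<eta>" if "i < n" for i
    using l[OF that] pos[OF that] \<open>\<eta> > 0\<close> by (auto simp: field_simps)
  ultimately show ?thesis using spectrum_within_spectral_mat_iff[OF U(1)] R_def by simp
qed

text \<open>\<open>mat_inv\<close> extracts the result of Gauss-Jordan elimination by
  \<open>the\<close>; an explicit two-sided inverse shows that \<open>B\<close> is a unit of the
  matrix ring, so the elimination succeeds, and uniqueness of inverses identifies its
  result.\<close>

lemma mat_inv_eqI:
  assumes B: "B \<in> carrier_mat n n" and R: "R \<in> carrier_mat n n" and BR: "B * R = 1\<^sub>m n" "R * B = 1\<^sub>m n"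
  shows "mat_inv B = R"
proof -
  have "B \<in> Units (ring_mat TYPE(real) n ())"
    using B R BR by (auto simp: Units_def ring_mat_def)
  then obtain C where C: "mat_inverse B = Some C"
    using mat_inverse(1)[OF B, of "()"] by (cases "mat_inverse B") auto
  with mat_inverse(2)[OF B C] have "C * B = 1\<^sub>m n" "C \<in> carrier_mat n n" by auto
  then have "C = R" using assoc_mult_mat[of C n n B n R n] B R BR by simp
  then show ?thesis using C by (simp add: mat_inv_def)
qed

lemma mat_inv_inverse:
  assumes W: "spectrum_within n \<eta> B" and "\<eta> > 0"
  shows "mat_inv B \<in> carrier_mat n n" "B * mat_inv B = 1\<^sub>m n" "mat_inv B * B = 1\<^sub>m n"
proof -
  obtain U l where U: "orth_mat n U" "B = spectral_mat n U l" and l: "\<And>i. i < n \<Longrightarrow> 1 / \<eta> \<le> l i \<and> l i \<le> \<eta>"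
    using spectrum_within_decomposition[OF W] by blast
  have pos: "0 < l i" if "i < n" for i
    using l[OF that] \<open>\<eta> > 0\<close> less_le_trans[of 0 "1 / \<eta>" "l i"] by simp
  define R where "R = spectral_mat n U (\<lambda>i. 1 / l i)"
  have R: "R \<in> carrier_mat n n" using U by (simp add: R_def)
  have "mat_diag n (\<lambda>i. l i * (1 / l i)) = mat_diag n (\<lambda>i. 1)" "mat_diag n (\<lambda>i. (1 / l i) * l i) = mat_diag n (\<lambda>i. 1)"
    using pos by (intro eq_matI; auto simp: mat_diag_def less_imp_neq[THEN not_sym])+
  then have BR: "B * R = 1\<^sub>m n" "R * B = 1\<^sub>m n"
    unfolding R_def U(2) spectral_mat_mult[OF U(1)] spectral_mat_one[OF U(1), symmetric]
    by (simp_all add: spectral_mat_def)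
  then show "mat_inv B \<in> carrier_mat n n" "B * mat_inv B = 1\<^sub>m n" "mat_inv B * B = 1\<^sub>m n"
    using mat_inv_eqI[OF spectrum_withinD(1)[OF W] R] R by auto
qed

section \<open>Clipping of eigenvalues\<close>

lemma spectral_clip_decomposition:
  assumes S: "S \<in> carrier_mat n n" "symmetric_mat S"
  obtains U l where "orth_mat n U" "S = spectral_mat n U l"
    "spectral_clip \<eta> S = spectral_mat n U (\<lambda>i. min (max (l i) (1 / \<eta>)) \<eta>)"
proof -
  have d: "dim_row S = n" using S by simp
  let ?P = "\<lambda>T. \<exists>U l. U \<in> carrier_mat n n \<and> transpose_mat U * U = 1\<^sub>m n \<and>
     S = U * mat_diag n l * transpose_mat U \<and>
     T = U * mat_diag n (\<lambda>i. min (max (l i) (1 / \<eta>)) \<eta>) * transpose_mat U"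
  have "\<exists>T. ?P T"
    using spectral_decomposition[OF S] by (auto simp: orth_mat_def spectral_mat_def) 
  \<comment> \<open>The spectral theorem supplies a candidate, so the choice returns a matrix built
    from some decomposition of \<open>S\<close>; the arguments below work with whichever one that
    is.\<close>
  then have "?P (spectral_clip \<eta> S)" unfolding spectral_clip_def d by (rule someI_ex)
  then show thesis using that orth_matI unfolding spectral_mat_def by blast
qed

lemma spectrum_within_spectral_clip:
  assumes S: "S \<in> carrier_mat n n" "symmetric_mat S" and "\<eta> > 1"
  shows "spectrum_within n \<eta> (spectral_clip \<eta> S)"
proof -
  obtain U l where U: "orth_mat n U" "S = spectral_mat n U l"
    "spectral_clip \<eta> S = spectral_mat n U (\<lambda>i. min (max (l i) (1 / \<eta>)) \<eta>)"
    by (rule spectral_clip_decomposition[OF S])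
  have "1 / \<eta> \<le> \<eta>" using \<open>\<eta> > 1\<close> order_trans[of "1 / \<eta>" 1 \<eta>] by simp
  then show ?thesis unfolding U(3) spectrum_within_spectral_mat_iff[OF U(1)] by auto
qed

text \<open>If \<open>S\<close> is \<open>e\<close>-close to a matrix with spectrum in \<open>[1/\<eta>, \<eta>]\<close>, then clipping moves each
  eigenvalue of \<open>S\<close> by at most \<open>e\<close>.\<close>

lemma spectral_clip_close:
  assumes S: "S \<in> carrier_mat n n" "symmetric_mat S" and W: "spectrum_within n \<eta> B" and "\<eta> > 1"
    and close: "\<And>x. x \<in> carrier_vec n \<Longrightarrow>
      \<bar>scalar_prod x (S *\<^sub>v x) - scalar_prod x (B *\<^sub>v x)\<bar> \<le> e * scalar_prod x x"
    and x: "x \<in> carrier_vec n"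
  shows "\<bar>scalar_prod x (spectral_clip \<eta> S *\<^sub>v x) - scalar_prod x (B *\<^sub>v x)\<bar> \<le> 2 * e * scalar_prod x x"
proof -
  obtain U l where U: "orth_mat n U" "S = spectral_mat n U l"
    "spectral_clip \<eta> S = spectral_mat n U (\<lambda>i. min (max (l i) (1 / \<eta>)) \<eta>)"
    by (rule spectral_clip_decomposition[OF S])
  have le: "\<bar>min (max (l i) (1 / \<eta>)) \<eta> - l i\<bar> \<le> e" if i: "i < n" for i
  proof -
    obtain y where y: "y \<in> carrier_vec n" "scalar_prod y y = 1" "scalar_prod y (spectral_mat n U l *\<^sub>v y) = l i"
      using spectral_mat_eigenvector[OF U(1) i, of l] by blast
    have "\<bar>l i - scalar_prod y (B *\<^sub>v y)\<bar> \<le> e" "1 / \<eta> \<le> scalar_prod y (B *\<^sub>v y)" "scalar_prod y (B *\<^sub>v y) \<le> \<eta>"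
      using close[OF y(1)] spectrum_withinD(3,4)[OF W y(1)] y U(2) by auto
    \<comment> \<open>The Rayleigh quotient of \<open>B\<close> at \<open>y\<close> is a point of
      [1/\<eta>, \<eta>] within \<open>e\<close> of \<open>l i\<close>, and clipping is the
      nearest-point projection onto that interval.\<close>
    then show ?thesis by (auto simp: min_def max_def abs_if split: if_splits)
  qed
  have "\<bar>scalar_prod x (spectral_clip \<eta> S *\<^sub>v x) - scalar_prod x (S *\<^sub>v x)\<bar> \<le> e * scalar_prod x x"
  proof -
    let ?y = "\<lambda>i. (transpose_mat U *\<^sub>v x) $ i"
    have "scalar_prod x (spectral_clip \<eta> S *\<^sub>v x) - scalar_prod x (S *\<^sub>v x)
      = (\<Sum>i<n. (min (max (l i) (1 / \<eta>)) \<eta> - l i) * (?y i)\<^sup>2)"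
      unfolding U(3) unfolding U(2) spectral_mat_forms[OF U(1) x] by (simp add: sum_subtractf algebra_simps)
    also have "\<bar>\<dots>\<bar> \<le> (\<Sum>i<n. \<bar>(min (max (l i) (1 / \<eta>)) \<eta> - l i) * (?y i)\<^sup>2\<bar>)" by (rule sum_abs)
    also have "\<dots> \<le> (\<Sum>i<n. e * (?y i)\<^sup>2)"
      using le by (intro sum_mono) (auto simp: abs_mult intro!: mult_right_mono)
    also have "\<dots> = e * scalar_prod x x" unfolding spectral_mat_forms(1)[OF U(1) x] sum_distrib_left ..
    finally show ?thesis .
  qed
  then show ?thesis using close[OF x] by (simp add: abs_le_iff)
qed

text \<open>\<open>lambda_min\<close> and \<open>lambda_max\<close> are a \<open>Min\<close> and a
  \<open>Max\<close>, informative because the spectrum of a matrix is finite; every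
  \<open>l i\<close> belongs to it through its eigenvector.\<close>

lemma precision_class_spectrum_within:
  assumes "\<Omega> \<in> precision_class p \<alpha> \<eta> M"
  shows "spectrum_within p \<eta> \<Omega>"
proof -
  have O: "\<Omega> \<in> carrier_mat p p" "symmetric_mat \<Omega>" "1 / \<eta> \<le> lambda_min \<Omega>" "lambda_max \<Omega> < \<eta>"
    using assms by (auto simp: precision_class_def)
  obtain U l where U: "orth_mat p U" "\<Omega> = spectral_mat p U l"
    using spectral_decomposition[OF O(1,2)] by blast
  have "1 / \<eta> \<le> l i \<and> l i \<le> \<eta>" if i: "i < p" for i
  proof -
    obtain x where x: "x \<in> carrier_vec p" "scalar_prod x x = 1" "spectral_mat p U l *\<^sub>v x = l i \<cdot>\<^sub>v x"
      using spectral_mat_eigenvector[OF U(1) i, of l] by blast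
    then have "x \<noteq> 0\<^sub>v p" by auto
    then have "l i \<in> spectrum \<Omega>"
      using x U(2) O(1) by (auto simp: spectrum_def eigenvalue_def eigenvector_def)
    then have "lambda_min \<Omega> \<le> l i" "l i \<le> lambda_max \<Omega>"
      using card_finite_spectrum(1)[OF O(1)] by (auto simp: lambda_min_def lambda_max_def)
    then show ?thesis using O by linarith
  qed
  then show ?thesis using spectrum_within_spectral_mat_iff[OF U(1)] U(2) by simp
qed

section \<open>Bilinear forms and the operator norm\<close>

lemma symmetric_bilinear_le:
  assumes A: "A \<in> carrier_mat n n" "symmetric_mat A"
    and quad: "\<And>x. x \<in> carrier_vec n \<Longrightarrow> \<bar>scalar_prod x (A *\<^sub>v x)\<bar> \<le> e * scalar_prod x x"
    and xy: "x \<in> carrier_vec n" "y \<in> carrier_vec n"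
  shows "\<bar>scalar_prod x (A *\<^sub>v y)\<bar> \<le> e * (scalar_prod x x + scalar_prod y y) / 2"
proof -
  have A': "transpose_mat A = A" using A by (simp add: symmetric_mat_def)
  have c: "A *\<^sub>v x \<in> carrier_vec n" "A *\<^sub>v y \<in> carrier_vec n" using A xy by auto
  have s: "scalar_prod y (A *\<^sub>v x) = scalar_prod x (A *\<^sub>v y)"
    using transpose_vec_mult_scalar[OF A(1) xy] comm_scalar_prod[OF c(2) xy(1)] A' by simp
  have sx: "scalar_prod y x = scalar_prod x y" by (rule comm_scalar_prod[OF xy(2,1)])
  have p: "scalar_prod (x + y) (A *\<^sub>v (x + y)) = scalar_prod x (A *\<^sub>v x) + 2 * scalar_prod x (A *\<^sub>v y) + scalar_prod y (A *\<^sub>v y)"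
    using A xy c s by (simp add: mult_add_distrib_mat_vec[of _ n n] add_scalar_prod_distrib[of _ n] scalar_prod_add_distrib[of _ n])
  have m: "scalar_prod (x - y) (A *\<^sub>v (x - y)) = scalar_prod x (A *\<^sub>v x) - 2 * scalar_prod x (A *\<^sub>v y) + scalar_prod y (A *\<^sub>v y)"
    using A xy c s by (simp add: mult_minus_distrib_mat_vec[of _ n n] minus_scalar_prod_distrib[of _ n] scalar_prod_minus_distrib[of _ n])
  have p': "scalar_prod (x + y) (x + y) = scalar_prod x x + 2 * scalar_prod x y + scalar_prod y y"
    using xy sx by (simp add: add_scalar_prod_distrib[of _ n] scalar_prod_add_distrib[of _ n])
  have m': "scalar_prod (x - y) (x - y) = scalar_prod x x - 2 * scalar_prod x y + scalar_prod y y"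
    using xy sx by (simp add: minus_scalar_prod_distrib[of _ n] scalar_prod_minus_distrib[of _ n])
  \<comment> \<open>Polarisation: q(x+y) - q(x-y) = 4 <x, A y>, while the parallelogram law removes
    the cross terms when the two norm bounds are added.\<close>
  have "\<bar>scalar_prod (x + y) (A *\<^sub>v (x + y))\<bar> \<le> e * scalar_prod (x + y) (x + y)"
    "\<bar>scalar_prod (x - y) (A *\<^sub>v (x - y))\<bar> \<le> e * scalar_prod (x - y) (x - y)"
    using xy by (auto intro!: quad)
  then have "4 * scalar_prod x (A *\<^sub>v y) \<le> 2 * (e * (scalar_prod x x + scalar_prod y y))"
    "- 4 * scalar_prod x (A *\<^sub>v y) \<le> 2 * (e * (scalar_prod x x + scalar_prod y y))"
    unfolding p m p' m' abs_le_iff distrib_left right_diff_distrib by linarith+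
  then show ?thesis by (simp add: abs_le_iff)
qed

text \<open>The bilinear bound is tested with \<open>v\<close> and the normalised image A v / |A v|,
  for which the form equals |A v|. Nonnegativity is derived alongside the upper bound because a real
  \<open>Sup\<close> is informative only for a bounded set.\<close>

lemma op_norm_symmetric_le:
  assumes A: "A \<in> carrier_mat n n" "symmetric_mat A"
    and quad: "\<And>x. x \<in> carrier_vec n \<Longrightarrow> \<bar>scalar_prod x (A *\<^sub>v x)\<bar> \<le> e * scalar_prod x x" and "e \<ge> 0"
  shows "0 \<le> op_norm A" "op_norm A \<le> e"
proof -
  let ?B = "{v \<in> carrier_vec (dim_col A). vec_norm2 v \<le> 1}"
  have B0: "0\<^sub>v n \<in> ?B" using A by (simp add: vec_norm2_def)
  have le: "vec_norm2 (A *\<^sub>v v) \<le> e" if "v \<in> ?B" for v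
  proof -
    have v: "v \<in> carrier_vec n" "scalar_prod v v \<le> 1" using that A by (auto simp: vec_norm2_def)
    define w where "w = A *\<^sub>v v"
    have w: "w \<in> carrier_vec n" using A v by (simp add: w_def)
    define r where "r = sqrt (scalar_prod w w)"
    have ww0: "scalar_prod w w \<ge> 0" by (simp add: scalar_prod_def sum_nonneg)
    show ?thesis
    proof (cases "r = 0")
      case True
      then show ?thesis using \<open>e \<ge> 0\<close> by (simp add: vec_norm2_def r_def w_def)
    next
      case False
      then have r: "r > 0" "r * r = scalar_prod w w" using ww0 by (auto simp: r_def less_le)
      let ?u = "(1 / r) \<cdot>\<^sub>v w"
      have u: "?u \<in> carrier_vec n" using w by simp
      have "scalar_prod w w \<noteq> 0" using r by (metis less_irrefl mult_pos_pos)
      then have uu: "scalar_prod ?u ?u = 1" using r w by (simp add: field_simps)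
      have "scalar_prod ?u w = r" using r w by (simp add: field_simps)
      then have "r \<le> e * (scalar_prod ?u ?u + scalar_prod v v) / 2"
        using symmetric_bilinear_le[OF A quad u v(1)] by (simp add: w_def[symmetric])
      also have "\<dots> \<le> e * (1 + 1) / 2" using v \<open>e \<ge> 0\<close> unfolding uu by (intro divide_right_mono mult_left_mono) auto
      finally show ?thesis by (simp add: vec_norm2_def r_def w_def)
    qed
  qed
  show "op_norm A \<le> e" unfolding op_norm_def using B0 le by (intro cSup_least) auto
  have "vec_norm2 (A *\<^sub>v 0\<^sub>v n) \<le> op_norm A"
    unfolding op_norm_def using B0 le by (intro cSup_upper bdd_aboveI2[of _ _ e]) auto
  moreover have "vec_norm2 (A *\<^sub>v 0\<^sub>v n) \<ge> 0" by (simp add: vec_norm2_def scalar_prod_def sum_nonneg)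
  ultimately show "0 \<le> op_norm A" by linarith
qed

section \<open>Decay of the precision matrix\<close>

text \<open>Comparison with the integral of t^(-\<alpha>-1): the summand at \<open>b\<close> is at
  most b^(-\<alpha>), and the later ones together are at most b^(-\<alpha>)/\<alpha>.\<close>

lemma powr_tail_sum_le:
  fixes b N :: nat
  assumes "\<alpha> > 0" "b \<ge> 1"
  shows "(\<Sum>s\<in>{b..N}. real s powr (- \<alpha> - 1)) \<le> (1 + 1 / \<alpha>) * real b powr (- \<alpha>)"
proof (cases "b \<le> N")
  case True
  \<comment> \<open>The subtracted term, the integral beyond \<open>N\<close>, makes the induction
    close: by the mean value theorem the increment of the right-hand side is a value of the
    integrand at some z < N + 1.\<close>
  have "(\<Sum>s\<in>{b..N}. real s powr (- \<alpha> - 1)) \<le> (1 + 1 / \<alpha>) * real b powr (- \<alpha>) - 1 / \<alpha> * real N powr (- \<alpha>)"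
    using True
  proof (induction N rule: dec_induct)
    case base
    have "real b powr (- \<alpha> - 1) \<le> real b powr (- \<alpha>)" using assms by (intro powr_mono) auto
    then show ?case by (simp add: algebra_simps)
  next
    case (step N)
    have N: "real N > 0" using step assms by simp
    have "\<exists>z. real N < z \<and> z < real N + 1 \<and>
      (- 1 / \<alpha> * (real N + 1) powr (- \<alpha>)) - (- 1 / \<alpha> * real N powr (- \<alpha>)) = (real N + 1 - real N) * (z powr (- \<alpha> - 1))"
    proof (rule MVT2)
      fix x assume "real N \<le> x" "x \<le> real N + 1"
      then show "((\<lambda>x. - 1 / \<alpha> * x powr (- \<alpha>)) has_real_derivative x powr (- \<alpha> - 1)) (at x)"
        using N assms by (auto intro!: derivative_eq_intros simp: powr_diff field_simps)
    qed simp
    then obtain z where z: "real N < z" "z < real N + 1"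
      "- 1 / \<alpha> * (real N + 1) powr (- \<alpha>) + 1 / \<alpha> * real N powr (- \<alpha>) = z powr (- \<alpha> - 1)" by auto
    have "(real N + 1) powr (- \<alpha> - 1) \<le> z powr (- \<alpha> - 1)"
      using z N assms by (intro powr_mono2') auto
    then show ?case using step z(3) by (simp add: add.commute)
  qed
  moreover have "1 / \<alpha> * real N powr (- \<alpha>) \<ge> 0" using assms by simp
  ultimately show ?thesis by linarith
qed (use assms in simp)

lemma powr_row_sum_le:
  fixes b p i :: nat
  assumes "\<alpha> > 0" "b \<ge> 1"
  shows "(\<Sum>j\<in>{j. j < p \<and> real b \<le> \<bar>real i - real j\<bar>}. \<bar>real i - real j\<bar> powr (- \<alpha> - 1))
    \<le> 2 * (1 + 1 / \<alpha>) * real b powr (- \<alpha>)"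
proof -
  let ?f = "\<lambda>s::nat. real s powr (- \<alpha> - 1)"
  let ?A = "{j. j < p \<and> j + b \<le> i}" and ?B = "{j. j < p \<and> i + b \<le> j}"
  have split: "{j. j < p \<and> real b \<le> \<bar>real i - real j\<bar>} = ?A \<union> ?B" by auto
  have "(\<Sum>j\<in>?A. \<bar>real i - real j\<bar> powr (- \<alpha> - 1)) = (\<Sum>j\<in>?A. ?f (i - j))"
    by (intro sum.cong refl) (auto simp: of_nat_diff)
  also have "\<dots> = (\<Sum>s\<in>(\<lambda>j. i - j) ` ?A. ?f s)"
    by (rule sum.reindex[symmetric, unfolded o_def]) (auto simp: inj_on_def)
  also have "\<dots> \<le> (\<Sum>s\<in>{b..i}. ?f s)" by (intro sum_mono2) auto
  also have "\<dots> \<le> (1 + 1 / \<alpha>) * real b powr (- \<alpha>)" by (rule powr_tail_sum_le[OF assms])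
  finally have A: "(\<Sum>j\<in>?A. \<bar>real i - real j\<bar> powr (- \<alpha> - 1)) \<le> (1 + 1 / \<alpha>) * real b powr (- \<alpha>)" .
  have "(\<Sum>j\<in>?B. \<bar>real i - real j\<bar> powr (- \<alpha> - 1)) = (\<Sum>j\<in>?B. ?f (j - i))"
    by (intro sum.cong refl) (use assms in \<open>auto simp: of_nat_diff abs_if\<close>)
  also have "\<dots> = (\<Sum>s\<in>(\<lambda>j. j - i) ` ?B. ?f s)"
    by (rule sum.reindex[symmetric, unfolded o_def]) (auto simp: inj_on_def)
  also have "\<dots> \<le> (\<Sum>s\<in>{b..p}. ?f s)" by (intro sum_mono2) auto
  also have "\<dots> \<le> (1 + 1 / \<alpha>) * real b powr (- \<alpha>)" by (rule powr_tail_sum_le[OF assms])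
  finally have B: "(\<Sum>j\<in>?B. \<bar>real i - real j\<bar> powr (- \<alpha> - 1)) \<le> (1 + 1 / \<alpha>) * real b powr (- \<alpha>)" .
  have "finite ?A" "finite ?B" by auto
  moreover have "?A \<inter> ?B = {}" using assms by auto
  ultimately have "(\<Sum>j\<in>?A \<union> ?B. \<bar>real i - real j\<bar> powr (- \<alpha> - 1))
      = (\<Sum>j\<in>?A. \<bar>real i - real j\<bar> powr (- \<alpha> - 1)) + (\<Sum>j\<in>?B. \<bar>real i - real j\<bar> powr (- \<alpha> - 1))"
    by (intro sum.union_disjoint)
  then show ?thesis unfolding split mult.assoc using A B by linarith
qed

lemma mat_inv_diagonal:
  assumes D: "D \<in> carrier_mat n n" "diagonal_mat D" and pos: "\<And>i. i < n \<Longrightarrow> D $$ (i,i) > 0"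
  shows "mat_inv D = mat_diag n (\<lambda>i. 1 / D $$ (i,i))"
proof (rule mat_inv_eqI[OF D(1)])
  define R where "R = mat_diag n (\<lambda>i. 1 / D $$ (i,i))"
  have eq: "D = mat_diag n (\<lambda>i. D $$ (i,i))"
    using D by (intro eq_matI) (auto simp: mat_diag_def diagonal_mat_def)
  have one: "mat_diag n (\<lambda>i. D $$ (i,i) * (1 / D $$ (i,i))) = 1\<^sub>m n"
    "mat_diag n (\<lambda>i. 1 / D $$ (i,i) * D $$ (i,i)) = 1\<^sub>m n"
    using pos by (intro eq_matI; auto simp: mat_diag_def less_imp_neq[THEN not_sym])+
  have "mat_diag n (\<lambda>i. D $$ (i,i)) * R = 1\<^sub>m n" "R * mat_diag n (\<lambda>i. D $$ (i,i)) = 1\<^sub>m n"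
    unfolding R_def mat_diag_diag one by simp_all
  then show "D * mat_diag n (\<lambda>i. 1 / D $$ (i,i)) = 1\<^sub>m n" "mat_diag n (\<lambda>i. 1 / D $$ (i,i)) * D = 1\<^sub>m n"
    unfolding R_def[symmetric] eq[symmetric] by simp_all
qed simp

text \<open>For an entry (i, j) with i < j, the first summand comes from the term l = j of the
  Cholesky product, the second from all l > j together.\<close>

definition decay_const :: "real \<Rightarrow> real \<Rightarrow> real \<Rightarrow> real" where
  "decay_const \<alpha> \<eta> M = \<eta> * M + \<eta> * M\<^sup>2 * (1 + 1 / \<alpha>)"

text \<open>With L = 1 - A, an entry with i < j is the sum over l >= j of d_l L_li L_lj. Since l is
  at least as far from i as j is, L_li already has the decay in j - i, and the decay of L_lj in l -
  j bounds the sum over l.\<close>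

lemma precision_class_entry_decay:
  assumes O: "\<Omega> \<in> precision_class p \<alpha> \<eta> M" and "\<alpha> > 0" "M > 0" "\<eta> > 0"
    and ij: "i < p" "j < p" "i \<noteq> j"
  shows "\<bar>\<Omega> $$ (i,j)\<bar> \<le> decay_const \<alpha> \<eta> M * \<bar>real i - real j\<bar> powr (- \<alpha> - 1)"
proof -
  have W: "spectrum_within p \<eta> \<Omega>" by (rule precision_class_spectrum_within[OF O])
  obtain A D where A: "A \<in> carrier_mat p p" and D: "D \<in> carrier_mat p p"
    and low: "\<And>i j. i < p \<Longrightarrow> j < p \<Longrightarrow> i \<le> j \<Longrightarrow> A $$ (i,j) = 0"
    and Dd: "diagonal_mat D" "\<And>i. i < p \<Longrightarrow> D $$ (i,i) > 0"
    and fac: "\<Omega> = transpose_mat (1\<^sub>m p - A) * mat_inv D * (1\<^sub>m p - A)"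
    and dec: "\<And>i j. i < p \<Longrightarrow> j < i \<Longrightarrow> \<bar>A $$ (i,j)\<bar> < M * (real i - real j) powr (- \<alpha> - 1)"
  proof -
    from O have "\<exists>A \<in> carrier_mat p p. \<exists>D \<in> carrier_mat p p.
        (\<forall>i<p. \<forall>j<p. i \<le> j \<longrightarrow> A $$ (i, j) = 0) \<and>
        diagonal_mat D \<and> (\<forall>i<p. D $$ (i, i) > 0) \<and>
        \<Omega> = transpose_mat (1\<^sub>m p - A) * mat_inv D * (1\<^sub>m p - A) \<and>
        (\<forall>i<p. \<forall>j<i. \<bar>A $$ (i, j)\<bar> < M * (real i - real j) powr (- \<alpha> - 1))"
      unfolding precision_class_def by simp
    then show thesis by (elim bexE conjE) (rule that; blast)
  qed
  define L where "L = (\<lambda>l i. (if l = i then 1 else 0) - A $$ (l,i))"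
  define d where "d = (\<lambda>l. 1 / D $$ (l,l))"
  have d0: "d l > 0" if "l < p" for l using Dd(2)[OF that] by (simp add: d_def)
  have ent: "\<Omega> $$ (i,j) = (\<Sum>l<p. d l * (L l i * L l j))" if "i < p" "j < p" for i j
  proof -
    have inv: "mat_inv D = mat_diag p d" unfolding d_def by (rule mat_inv_diagonal[OF D Dd])
    have "\<Omega> = transpose_mat (1\<^sub>m p - A) * (mat_diag p d * (1\<^sub>m p - A))"
      unfolding fac inv using A
      by (intro assoc_mult_mat[of _ p p _ p _ p]) auto
    also have "\<dots> $$ (i,j) = (\<Sum>l<p. L l i * (d l * L l j))"
    proof -
      have X: "1\<^sub>m p - A \<in> carrier_mat p p" using A by auto
      show ?thesis unfolding mat_diag_mult_left[OF X]
        using that A by (simp add: scalar_prod_def L_def lessThan_atLeast0)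
    qed
    finally show ?thesis by (simp add: mult_ac)
  qed
  have Lz: "L l i = 0" if "l < i" "i < p" for l i using low[of l i] that by (simp add: L_def)
  have Ld: "L l l = 1" if "l < p" for l using low[of l l] that by (simp add: L_def)
  have Lb: "\<bar>L l i\<bar> \<le> M * (real l - real i) powr (- \<alpha> - 1)" if "i < l" "l < p" for l i
    using dec[of l i] that by (simp add: L_def)
  \<comment> \<open>The diagonal entry of \<Omega> at \<open>l\<close> dominates its own term d_l
    L_ll^2 = d_l, and it is at most \<eta>.\<close>
  have dle: "d l \<le> \<eta>" if l: "l < p" for l
  proof -
    have "d l = (\<Sum>k\<in>{l}. d k * (L k l * L k l))" using Ld[OF l] by simp
    also have "\<dots> \<le> (\<Sum>k<p. d k * (L k l * L k l))"
      using l d0 by (intro sum_mono2) (auto intro!: mult_nonneg_nonneg[OF less_imp_le zero_le_square])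
    also have "\<dots> = \<Omega> $$ (l,l)" using ent l by simp
    also have "\<dots> = scalar_prod (unit_vec p l) (\<Omega> *\<^sub>v unit_vec p l)"
      using l spectrum_withinD(1)[OF W] by simp
    also have "\<dots> \<le> \<eta> * scalar_prod (unit_vec p l) (unit_vec p l)"
      by (rule spectrum_withinD(4)[OF W]) simp
    also have "\<dots> = \<eta>" using l by simp
    finally show ?thesis .
  qed
  have main: "\<bar>\<Omega> $$ (i,j)\<bar> \<le> decay_const \<alpha> \<eta> M * (real j - real i) powr (- \<alpha> - 1)"
    if ij: "i < j" "j < p" for i j
  proof -
    let ?q = "(real j - real i) powr (- \<alpha> - 1)"
    have "\<Omega> $$ (i,j) = (\<Sum>l\<in>{j..<p}. d l * (L l i * L l j))"
      using ij Lz by (subst ent) (auto intro!: sum.mono_neutral_right)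
    also have "{j..<p} = insert j {Suc j..<p}" using ij by auto
    also have "(\<Sum>l\<in>\<dots>. d l * (L l i * L l j)) = d j * L j i + (\<Sum>l\<in>{Suc j..<p}. d l * (L l i * L l j))"
      using ij Ld by simp
    also have "\<bar>\<dots>\<bar> \<le> \<bar>d j * L j i\<bar> + (\<Sum>l\<in>{Suc j..<p}. \<bar>d l * (L l i * L l j)\<bar>)"
      by (intro order_trans[OF abs_triangle_ineq] add_left_mono sum_abs)
    also have "\<bar>d j * L j i\<bar> \<le> \<eta> * (M * ?q)"
      unfolding abs_mult using dle[of j] d0[of j] Lb[of i j] ij \<open>\<eta> > 0\<close> by (intro mult_mono) auto
    also have "(\<Sum>l\<in>{Suc j..<p}. \<bar>d l * (L l i * L l j)\<bar>)
      \<le> (\<Sum>l\<in>{Suc j..<p}. \<eta> * ((M * ?q) * (M * (real l - real j) powr (- \<alpha> - 1))))"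
    proof (rule sum_mono)
      fix l assume l: "l \<in> {Suc j..<p}"
      have "(real l - real i) powr (- \<alpha> - 1) \<le> ?q"
        using l ij \<open>\<alpha> > 0\<close> by (intro powr_mono2') auto
      then have "M * (real l - real i) powr (- \<alpha> - 1) \<le> M * ?q" using \<open>M > 0\<close> by simp
      then have "\<bar>L l i\<bar> \<le> M * ?q" using Lb[of i l] l ij by (intro order_trans[OF Lb[of i l]]) auto
      moreover have "\<bar>L l j\<bar> \<le> M * (real l - real j) powr (- \<alpha> - 1)" using Lb[of j l] l by auto
      moreover have "0 < d l" "d l \<le> \<eta>" using d0 dle l by auto
      ultimately show "\<bar>d l * (L l i * L l j)\<bar> \<le> \<eta> * ((M * ?q) * (M * (real l - real j) powr (- \<alpha> - 1)))"
        unfolding abs_mult using \<open>\<eta> > 0\<close> \<open>M > 0\<close> by (intro mult_mono) auto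
    qed
    also have "\<dots> = \<eta> * M\<^sup>2 * ?q * (\<Sum>l\<in>{Suc j..<p}. (real l - real j) powr (- \<alpha> - 1))"
      by (simp add: sum_distrib_left power2_eq_square mult_ac)
    also have "\<dots> \<le> \<eta> * M\<^sup>2 * ?q * (1 + 1 / \<alpha>)"
    proof (rule mult_left_mono)
      have "(\<Sum>l\<in>{Suc j..<p}. (real l - real j) powr (- \<alpha> - 1)) = (\<Sum>l\<in>{Suc j..<p}. real (l - j) powr (- \<alpha> - 1))"
        by (intro sum.cong refl) (auto simp: of_nat_diff)
      also have "\<dots> = (\<Sum>s\<in>(\<lambda>l. l - j) ` {Suc j..<p}. real s powr (- \<alpha> - 1))"
        by (rule sum.reindex[symmetric, unfolded o_def]) (auto simp: inj_on_def)
      also have "\<dots> \<le> (\<Sum>s\<in>{1..p}. real s powr (- \<alpha> - 1))" by (intro sum_mono2) auto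
      also have "\<dots> \<le> 1 + 1 / \<alpha>" using powr_tail_sum_le[OF \<open>\<alpha> > 0\<close>, of 1 p] by simp
      finally show "(\<Sum>l\<in>{Suc j..<p}. (real l - real j) powr (- \<alpha> - 1)) \<le> 1 + 1 / \<alpha>" .
    qed (use \<open>\<eta> > 0\<close> in simp)
    finally show ?thesis using \<open>\<eta> > 0\<close> by (simp add: decay_const_def algebra_simps)
  qed
  have sym: "\<Omega> $$ (j,i) = \<Omega> $$ (i,j)"
    using ent ij by (simp add: mult_ac)
  show ?thesis
  proof (cases "i < j")
    case True
    then show ?thesis using main[OF True ij(2)] by (simp add: abs_if)
  next
    case False
    then show ?thesis using main[of j i] ij sym by (simp add: abs_if)
  qed
qed

text \<open>Bound on the absolute row sums of \<Omega> at distance at least \<open>k\<close> from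
  the diagonal; it controls both the truncation in the local inverses and the tapering.\<close>

definition bias_bound :: "real \<Rightarrow> real \<Rightarrow> real \<Rightarrow> nat \<Rightarrow> real" where
  "bias_bound \<alpha> \<eta> M k = decay_const \<alpha> \<eta> M * (2 * (1 + 1 / \<alpha>)) * real k powr (- \<alpha>)"

lemma precision_class_row_sum:
  assumes O: "\<Omega> \<in> precision_class p \<alpha> \<eta> M" and "\<alpha> > 0" "M > 0" "\<eta> > 0" and "k \<ge> 1" "i < p"
  shows "(\<Sum>j\<in>{j. j < p \<and> real k \<le> \<bar>real i - real j\<bar>}. \<bar>\<Omega> $$ (i,j)\<bar>) \<le> bias_bound \<alpha> \<eta> M k"
proof -
  have "(\<Sum>j\<in>{j. j < p \<and> real k \<le> \<bar>real i - real j\<bar>}. \<bar>\<Omega> $$ (i,j)\<bar>)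
    \<le> (\<Sum>j\<in>{j. j < p \<and> real k \<le> \<bar>real i - real j\<bar>}. decay_const \<alpha> \<eta> M * \<bar>real i - real j\<bar> powr (- \<alpha> - 1))"
    using \<open>k \<ge> 1\<close> \<open>i < p\<close> by (intro sum_mono precision_class_entry_decay[OF assms(1-4)]) auto
  also have "\<dots> = decay_const \<alpha> \<eta> M * (\<Sum>j\<in>{j. j < p \<and> real k \<le> \<bar>real i - real j\<bar>}. \<bar>real i - real j\<bar> powr (- \<alpha> - 1))"
    by (simp add: sum_distrib_left)
  also have "\<dots> \<le> decay_const \<alpha> \<eta> M * (2 * (1 + 1 / \<alpha>) * real k powr (- \<alpha>))"
    using assms by (intro mult_left_mono powr_row_sum_le) (auto simp: decay_const_def)
  finally show ?thesis by (simp add: bias_bound_def mult_ac)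
qed

section \<open>Exponential moments of empirical second moments\<close>

lemma exp_le_quadratic: "exp x \<le> 1 + x + x\<^sup>2 / 2 * exp \<bar>x\<bar>" for x :: real
proof -
  obtain t where t: "\<bar>t\<bar> \<le> \<bar>x\<bar>" "exp x = (\<Sum>m<2. x ^ m / fact m) + exp t / fact 2 * x ^ 2"
    using Maclaurin_exp_le[of x 2] by auto
  have "exp t * x\<^sup>2 \<le> exp \<bar>x\<bar> * x\<^sup>2" using t(1) by (intro mult_right_mono) auto
  then show ?thesis using t(2) by (simp add: numeral_2_eq_2 algebra_simps)
qed

text \<open>Value of 1 + sum over j of exp((j+1)/2) * 2 exp(-j), the series that arises from slicing
  by the integer levels of \<xi>^2/(2\<rho>).\<close>

definition exp_square_const :: real where
  "exp_square_const = 1 + 2 * exp (1/2) / (1 - exp (-1/2))"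

lemma exp_square_const_ge_1: "exp_square_const \<ge> 1"
  by (simp add: exp_square_const_def)

text \<open>Slicing by integer levels of \<open>y\<close>: on j < y <= j + 1 the integrand is at
  most exp((j+1)/2), while y > j has probability at most 2 exp(-j). The exponent 1/(4\<rho>) is half
  of the one in the tail bound, which leaves a geometric series of ratio exp(-1/2).\<close>

lemma nn_integral_exp_square_le:
  assumes N: "prob_space N" and xi [measurable]: "\<xi> \<in> borel_measurable N" and "\<rho> > 0"
    and tail: "\<And>t. t > 0 \<Longrightarrow> measure N {x \<in> space N. \<bar>\<xi> x\<bar> > t} \<le> 2 * exp (- t\<^sup>2 / (2 * \<rho>))"
  shows "(\<integral>\<^sup>+x. ennreal (exp ((\<xi> x)\<^sup>2 / (4 * \<rho>))) \<partial>N) \<le> ennreal exp_square_const"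
proof -
  interpret prob_space N by fact
  define y where "y = (\<lambda>x. (\<xi> x)\<^sup>2 / (2 * \<rho>))"
  have y0: "y x \<ge> 0" for x using \<open>\<rho> > 0\<close> by (simp add: y_def)
  have [measurable]: "y \<in> borel_measurable N" unfolding y_def by measurable
  define g where "g = (\<lambda>(j::nat) x. ennreal (exp ((real j + 1) / 2)) * indicator {x \<in> space N. y x > real j} x)"
  have pt: "ennreal (exp (y x / 2)) \<le> 1 + (\<Sum>j. g j x)" if x: "x \<in> space N" for x
  proof (cases "y x = 0")
    case False
    \<comment> \<open>Ceiling minus one, so that j < y <= j + 1 holds at integers too, matching the
      strict inequality in the tail events. The value y = 0 lies in no slice and is covered by the
      summand 1.\<close>
    define j where "j = nat (\<lceil>y x\<rceil> - 1)"
    have pos: "y x > 0" using False y0[of x] by simp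
    then have "\<lceil>y x\<rceil> \<ge> 1" by simp
    then have j: "real j = of_int \<lceil>y x\<rceil> - 1" by (simp add: j_def)
    have "y x > real j" "y x \<le> real j + 1" unfolding j by linarith+
    then have "ennreal (exp (y x / 2)) \<le> g j x" using x by (simp add: g_def)
    also have "\<dots> \<le> (\<Sum>j. g j x)" using sum_le_suminf[of "\<lambda>j. g j x" "{j}"] by (simp add: summableI)
    finally show ?thesis by (simp add: add_increasing)
  qed (simp add: add_increasing2)
  have P: "emeasure N {x \<in> space N. y x > real j} \<le> ennreal (2 * exp (- real j))" for j
  proof (cases "j = 0")
    case True
    \<comment> \<open>Level 0 corresponds to t = 0, outside the range of the tail hypothesis; there
      the probability is at most 1 <= 2.\<close>
    have "measure N {x \<in> space N. y x > real j} \<le> 1" by (rule prob_le_1)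
    then have "ennreal (measure N {x \<in> space N. y x > real j}) \<le> ennreal (2 * exp (- real j))"
      using True by (intro ennreal_leI order_trans[OF prob_le_1]) simp
    then show ?thesis by (simp add: emeasure_eq_measure)
  next
    case False
    define t where "t = sqrt (2 * \<rho> * real j)"
    have t: "t > 0" "t\<^sup>2 = 2 * \<rho> * real j" using False \<open>\<rho> > 0\<close> by (auto simp: t_def)
    have "(y x > real j) = (\<bar>\<xi> x\<bar> > t)" for x
    proof -
      have "(y x > real j) = ((\<xi> x)\<^sup>2 > t\<^sup>2)"
        using \<open>\<rho> > 0\<close> by (simp add: y_def t field_simps)
      also have "\<dots> = (\<bar>\<xi> x\<bar> > t)" by (metis abs_le_square_iff abs_of_pos not_le t(1))
      finally show ?thesis .
    qed
    then show ?thesis using tail[OF t(1)] t(2) \<open>\<rho> > 0\<close> by (simp add: emeasure_eq_measure)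
  qed
  have "(\<integral>\<^sup>+x. ennreal (exp ((\<xi> x)\<^sup>2 / (4 * \<rho>))) \<partial>N) = (\<integral>\<^sup>+x. ennreal (exp (y x / 2)) \<partial>N)"
    by (simp add: y_def)
  also have "\<dots> \<le> (\<integral>\<^sup>+x. 1 + (\<Sum>j. g j x) \<partial>N)" by (intro nn_integral_mono pt)
  also have "\<dots> = 1 + (\<Sum>j. \<integral>\<^sup>+x. g j x \<partial>N)"
    by (subst nn_integral_add) (auto simp: g_def nn_integral_suminf emeasure_space_1)
  also have "\<dots> \<le> 1 + (\<Sum>j. ennreal (2 * exp (1/2) * exp (-1/2) ^ j))"
  proof (intro add_left_mono suminf_le)
    fix j
    have "(\<integral>\<^sup>+x. g j x \<partial>N) = ennreal (exp ((real j + 1) / 2)) * emeasure N {x \<in> space N. y x > real j}"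
      unfolding g_def by (subst nn_integral_cmult_indicator) auto
    also have "\<dots> \<le> ennreal (exp ((real j + 1) / 2)) * ennreal (2 * exp (- real j))"
      by (intro mult_left_mono P) auto
    also have "\<dots> = ennreal (2 * exp (1/2) * exp (-1/2) ^ j)"
      by (simp add: exp_of_nat_mult[symmetric] exp_add[symmetric] ennreal_mult[symmetric] field_simps)
    finally show "(\<integral>\<^sup>+x. g j x \<partial>N) \<le> ennreal (2 * exp (1/2) * exp (-1/2) ^ j)" .
  qed auto
  also have "(\<Sum>j. ennreal (2 * exp (1/2) * exp (-1/2) ^ j)) = ennreal (\<Sum>j. 2 * exp (1/2) * exp (-1/2) ^ j)"
    by (intro suminf_ennreal2 summable_mult summable_geometric) auto
  also have "(\<Sum>j. 2 * exp (1/2) * exp (-1/2) ^ j) = 2 * exp (1/2) / (1 - exp (-1/2 :: real))"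
    by (subst suminf_mult) (auto intro!: summable_geometric simp: suminf_geometric)
  also have "1 + ennreal (2 * exp (1/2) / (1 - exp (-1/2))) = ennreal exp_square_const"
    unfolding exp_square_const_def by (subst ennreal_plus) auto
  finally show ?thesis .
qed

text \<open>64 \<rho>^2 is 4/a^2 for a = 1/(4\<rho>); the factor \<open>exp exp_square_const\<close>
  bounds exp(a m), where m is the second moment, and the last factor bounds the mean of exp(a
  \<xi>^2).\<close>

definition mgf_const :: "real \<Rightarrow> real" where
  "mgf_const \<rho> = 64 * \<rho>\<^sup>2 * exp exp_square_const * exp_square_const"

lemma sub_gaussian_square_moments:
  assumes N: "prob_space N" and xi [measurable]: "\<xi> \<in> borel_measurable N" and "\<rho> > 0"
    and tail: "\<And>t. t > 0 \<Longrightarrow> measure N {x \<in> space N. \<bar>\<xi> x\<bar> > t} \<le> 2 * exp (- t\<^sup>2 / (2 * \<rho>))"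
  shows "integrable N (\<lambda>x. exp ((\<xi> x)\<^sup>2 / (4 * \<rho>)))" "(\<integral>x. exp ((\<xi> x)\<^sup>2 / (4 * \<rho>)) \<partial>N) \<le> exp_square_const"
    "integrable N (\<lambda>x. (\<xi> x)\<^sup>2)" "(\<integral>x. (\<xi> x)\<^sup>2 \<partial>N) \<le> 4 * \<rho> * exp_square_const"
proof -
  note le = nn_integral_exp_square_le[OF assms]
  let ?e = "\<lambda>x. exp ((\<xi> x)\<^sup>2 / (4 * \<rho>))"
  have fin: "(\<integral>\<^sup>+x. ennreal (?e x) \<partial>N) < \<infinity>" by (metis le ennreal_less_top infinity_ennreal_def le_less_trans)
  show ie: "integrable N ?e" using fin by (intro integrableI_nonneg) auto
  have "ennreal (\<integral>x. ?e x \<partial>N) = (\<integral>\<^sup>+x. ennreal (?e x) \<partial>N)"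
    using ie by (intro nn_integral_eq_integral[symmetric]) auto
  then show eb: "(\<integral>x. ?e x \<partial>N) \<le> exp_square_const"
    using le exp_square_const_ge_1 ennreal_le_iff[of exp_square_const] by (metis order_trans zero_le_one)
  have pt: "(\<xi> x)\<^sup>2 \<le> 4 * \<rho> * ?e x" for x
  proof -
    have "(\<xi> x)\<^sup>2 / (4 * \<rho>) \<le> ?e x" using exp_ge_add_one_self[of "(\<xi> x)\<^sup>2 / (4 * \<rho>)"] by linarith
    then show ?thesis using \<open>\<rho> > 0\<close> by (simp add: field_simps)
  qed
  show i2: "integrable N (\<lambda>x. (\<xi> x)\<^sup>2)"
    by (rule Bochner_Integration.integrable_bound[of _ "\<lambda>x. 4 * \<rho> * ?e x"]) (use ie pt in \<open>auto intro!: AE_I2 order_trans[OF pt]\<close>)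
  have "(\<integral>x. (\<xi> x)\<^sup>2 \<partial>N) \<le> (\<integral>x. 4 * \<rho> * ?e x \<partial>N)"
    by (intro integral_mono i2) (use ie pt in auto)
  also have "\<dots> \<le> 4 * \<rho> * exp_square_const" using eb \<open>\<rho> > 0\<close> by simp
  finally show "(\<integral>x. (\<xi> x)\<^sup>2 \<partial>N) \<le> 4 * \<rho> * exp_square_const" .
qed

text \<open>In the second-order expansion the linear term integrates to 0 because \<open>m\<close>
  is the mean of \<xi>^2. The remainder is c^2 times a quantity that the mean of
  exp(\<xi>^2/(4\<rho>)) controls, and this is what restricts \<open>c\<close> to a multiple of
  1/\<rho>.\<close>

lemma mgf_centered_square_le:
  assumes N: "prob_space N" and xi [measurable]: "\<xi> \<in> borel_measurable N" and "\<rho> > 0"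
    and tail: "\<And>t. t > 0 \<Longrightarrow> measure N {x \<in> space N. \<bar>\<xi> x\<bar> > t} \<le> 2 * exp (- t\<^sup>2 / (2 * \<rho>))"
    and lam: "\<bar>c\<bar> \<le> 1 / (8 * \<rho>)"
  defines "m \<equiv> \<integral>x. (\<xi> x)\<^sup>2 \<partial>N"
  shows "(\<integral>\<^sup>+x. ennreal (exp (c * ((\<xi> x)\<^sup>2 - m))) \<partial>N) \<le> ennreal (exp (mgf_const \<rho> * c\<^sup>2))"
proof -
  interpret prob_space N by fact
  note mom = sub_gaussian_square_moments[OF assms(1-4)]
  let ?e = "\<lambda>x. exp ((\<xi> x)\<^sup>2 / (4 * \<rho>))"
  define a where "a = 1 / (4 * \<rho>)"
  have a: "a > 0" using \<open>\<rho> > 0\<close> by (simp add: a_def)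
  have m0: "m \<ge> 0" by (simp add: m_def)
  have am: "a * m \<le> exp_square_const" using mom(4) \<open>\<rho> > 0\<close> by (simp add: m_def a_def field_simps)
  define Q where "Q = 4 / a\<^sup>2 * exp exp_square_const"
  have pt: "exp (c * ((\<xi> x)\<^sup>2 - m)) \<le> 1 + c * ((\<xi> x)\<^sup>2 - m) + c\<^sup>2 * (Q * ?e x)" for x
  proof -
    define z where "z = \<bar>(\<xi> x)\<^sup>2 - m\<bar>"
    have z: "z \<ge> 0" "z \<le> (\<xi> x)\<^sup>2 + m" using m0 by (auto simp: z_def abs_le_iff)
    have "(a / 2 * z)\<^sup>2 / 2 \<le> exp (a / 2 * z)"
      using exp_lower_Taylor_quadratic[of "a / 2 * z"] mult_nonneg_nonneg[of "a / 2" z] a z(1) by linarith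
    then have 1: "z\<^sup>2 / 2 \<le> 4 / a\<^sup>2 * exp (a / 2 * z)" using a by (simp add: power_mult_distrib field_simps)
    \<comment> \<open>The available exponent \<open>a\<close> is split in halves: |c| <= a/2 leaves
      the other half to absorb the factor z^2.\<close>
    have "\<bar>c\<bar> * z \<le> a / 2 * z" using lam z(1) by (intro mult_right_mono) (auto simp: a_def)
    then have "z\<^sup>2 / 2 * exp (\<bar>c\<bar> * z) \<le> (4 / a\<^sup>2 * exp (a / 2 * z)) * exp (a / 2 * z)"
      using 1 by (intro mult_mono) auto
    also have "\<dots> = 4 / a\<^sup>2 * exp (a * z)" by (simp add: mult_exp_exp)
    also have "\<dots> \<le> 4 / a\<^sup>2 * exp (exp_square_const + a * (\<xi> x)\<^sup>2)"
    proof -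
      have "a * z \<le> a * ((\<xi> x)\<^sup>2 + m)" using a z by (intro mult_left_mono) auto
      then show ?thesis using am a by (intro mult_left_mono) (auto simp: algebra_simps)
    qed
    also have "\<dots> = Q * ?e x" by (simp add: Q_def a_def exp_add)
    finally have 2: "z\<^sup>2 / 2 * exp (\<bar>c\<bar> * z) \<le> Q * ?e x" .
    have "exp (c * ((\<xi> x)\<^sup>2 - m)) \<le> 1 + c * ((\<xi> x)\<^sup>2 - m) + (c * ((\<xi> x)\<^sup>2 - m))\<^sup>2 / 2 * exp \<bar>c * ((\<xi> x)\<^sup>2 - m)\<bar>"
      by (rule exp_le_quadratic)
    also have "(c * ((\<xi> x)\<^sup>2 - m))\<^sup>2 / 2 * exp \<bar>c * ((\<xi> x)\<^sup>2 - m)\<bar> = c\<^sup>2 * (z\<^sup>2 / 2 * exp (\<bar>c\<bar> * z))"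
      by (simp add: z_def power_mult_distrib abs_mult)
    also have "\<dots> \<le> c\<^sup>2 * (Q * ?e x)" by (intro mult_left_mono 2) auto
    finally show ?thesis by simp
  qed
  define R where "R = (\<lambda>x. 1 + c * ((\<xi> x)\<^sup>2 - m) + c\<^sup>2 * (Q * ?e x))"
  have iR: "integrable N R" unfolding R_def using mom(1,3) by auto
  have R0: "R x \<ge> 0" for x using order_trans[OF exp_ge_zero pt[of x]] by (simp add: R_def)
  have "(\<integral>\<^sup>+x. ennreal (exp (c * ((\<xi> x)\<^sup>2 - m))) \<partial>N) \<le> (\<integral>\<^sup>+x. ennreal (R x) \<partial>N)"
    by (intro nn_integral_mono ennreal_leI) (simp add: R_def pt)
  also have "\<dots> = ennreal (\<integral>x. R x \<partial>N)" by (intro nn_integral_eq_integral iR AE_I2 R0)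
  also have "(\<integral>x. R x \<partial>N) = 1 + c\<^sup>2 * (Q * (\<integral>x. ?e x \<partial>N))"
    unfolding R_def using mom(1,3) by (simp add: m_def prob_space)
  also have "\<dots> \<le> 1 + c\<^sup>2 * (Q * exp_square_const)"
    using mom(2) by (intro add_left_mono mult_left_mono) (auto simp: Q_def)
  also have "Q * exp_square_const = mgf_const \<rho>" using \<open>\<rho> > 0\<close> by (simp add: Q_def mgf_const_def a_def power_mult_distrib power_divide)
  also have "1 + c\<^sup>2 * mgf_const \<rho> \<le> exp (mgf_const \<rho> * c\<^sup>2)"
    using exp_ge_add_one_self[of "mgf_const \<rho> * c\<^sup>2"] by (simp add: mult.commute)
  finally show ?thesis by (simp add: ennreal_leI)
qed

text \<open>exp |w| <= exp w + exp (-w) removes the modulus at the price of the factor 2; for either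
  sign the exponential of the sum factorises over the independent observations.\<close>

lemma nn_integral_exp_empirical_deviation_le:
  assumes N: "prob_space N" and xi [measurable]: "\<xi> \<in> borel_measurable N" and "\<rho> > 0"
    and tail: "\<And>t. t > 0 \<Longrightarrow> measure N {x \<in> space N. \<bar>\<xi> x\<bar> > t} \<le> 2 * exp (- t\<^sup>2 / (2 * \<rho>))"
    and lam: "0 \<le> c" "c \<le> 1 / (8 * \<rho>)" and n: "n \<ge> 1"
  defines "m \<equiv> \<integral>x. (\<xi> x)\<^sup>2 \<partial>N"
  shows "(\<integral>\<^sup>+x. ennreal (exp (real n * c * \<bar>1 / real n * (\<Sum>i<n. (\<xi> (x i))\<^sup>2) - m\<bar>)) \<partial>PiM {..<n} (\<lambda>_. N))
    \<le> ennreal (2 * exp (real n * (mgf_const \<rho> * c\<^sup>2)))"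
proof -
  interpret N: prob_space N by fact
  interpret product_sigma_finite "\<lambda>_. N" by unfold_locales
  let ?P = "PiM {..<n} (\<lambda>_. N)"
  have one: "(\<integral>\<^sup>+x. ennreal (exp (s * (\<Sum>i<n. (\<xi> (x i))\<^sup>2 - m))) \<partial>?P) \<le> ennreal (exp (real n * (mgf_const \<rho> * c\<^sup>2)))"
    if s: "\<bar>s\<bar> = c" for s
  proof -
    have "(\<integral>\<^sup>+x. ennreal (exp (s * (\<Sum>i<n. (\<xi> (x i))\<^sup>2 - m))) \<partial>?P)
      = (\<integral>\<^sup>+x. (\<Prod>i<n. ennreal (exp (s * ((\<xi> (x i))\<^sup>2 - m)))) \<partial>?P)"
      by (simp add: sum_distrib_left exp_sum prod_ennreal)
    also have "\<dots> = (\<Prod>i<n. \<integral>\<^sup>+x. ennreal (exp (s * ((\<xi> x)\<^sup>2 - m))) \<partial>N)"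
      by (rule product_nn_integral_prod) auto
    also have "\<dots> \<le> (\<Prod>i<n. ennreal (exp (mgf_const \<rho> * s\<^sup>2)))"
      unfolding m_def prod_constant
      using mgf_centered_square_le[OF assms(1-4), of s] s lam by (intro power_mono_ennreal) auto
    also have "\<dots> = ennreal (exp (real n * (mgf_const \<rho> * c\<^sup>2)))"
      using s by (simp add: ennreal_power exp_of_nat_mult flip: s)
    finally show ?thesis .
  qed
  have "exp (real n * c * \<bar>1 / real n * (\<Sum>i<n. (\<xi> (x i))\<^sup>2) - m\<bar>)
    \<le> exp (c * (\<Sum>i<n. (\<xi> (x i))\<^sup>2 - m)) + exp (- c * (\<Sum>i<n. (\<xi> (x i))\<^sup>2 - m))" for x
  proof -
    define w where "w = c * (\<Sum>i<n. (\<xi> (x i))\<^sup>2 - m)"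
    have "real n * c * \<bar>1 / real n * (\<Sum>i<n. (\<xi> (x i))\<^sup>2) - m\<bar> = c * \<bar>real n * (1 / real n * (\<Sum>i<n. (\<xi> (x i))\<^sup>2) - m)\<bar>"
      by (simp add: abs_mult)
    also have "real n * (1 / real n * (\<Sum>i<n. (\<xi> (x i))\<^sup>2) - m) = (\<Sum>i<n. (\<xi> (x i))\<^sup>2 - m)"
      using n by (simp add: sum_subtractf field_simps)
    finally have "real n * c * \<bar>1 / real n * (\<Sum>i<n. (\<xi> (x i))\<^sup>2) - m\<bar> = \<bar>w\<bar>" using lam by (simp add: w_def abs_mult)
    moreover have "exp \<bar>w\<bar> \<le> exp w + exp (-w)" by (cases "w \<ge> 0") auto
    ultimately show ?thesis by (simp add: w_def)
  qed
  then have "(\<integral>\<^sup>+x. ennreal (exp (real n * c * \<bar>1 / real n * (\<Sum>i<n. (\<xi> (x i))\<^sup>2) - m\<bar>)) \<partial>?P)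
    \<le> (\<integral>\<^sup>+x. ennreal (exp (c * (\<Sum>i<n. (\<xi> (x i))\<^sup>2 - m))) + ennreal (exp (- c * (\<Sum>i<n. (\<xi> (x i))\<^sup>2 - m))) \<partial>?P)"
    by (intro nn_integral_mono) (simp flip: ennreal_plus add: ennreal_leI)
  also have "\<dots> = (\<integral>\<^sup>+x. ennreal (exp (c * (\<Sum>i<n. (\<xi> (x i))\<^sup>2 - m))) \<partial>?P)
    + (\<integral>\<^sup>+x. ennreal (exp (- c * (\<Sum>i<n. (\<xi> (x i))\<^sup>2 - m))) \<partial>?P)"
    by (intro nn_integral_add) measurable
  also have "\<dots> \<le> ennreal (exp (real n * (mgf_const \<rho> * c\<^sup>2))) + ennreal (exp (real n * (mgf_const \<rho> * c\<^sup>2)))"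
    by (intro add_mono one) (use lam in auto)
  finally show ?thesis by (simp flip: ennreal_plus)
qed

section \<open>Quadratic forms on a finite grid\<close>

text \<open>Integer points whose multiples by 1/(4 sqrt d) lie in the unit ball. The box, wide
  enough because |t| <= t^2 for integers, gives finiteness and the product set over which the
  counting sum factorises.\<close>

definition grid :: "nat \<Rightarrow> (nat \<Rightarrow> int) set" where
  "grid d = {z \<in> {..<d} \<rightarrow>\<^sub>E {- int (16 * d)..int (16 * d)}. (\<Sum>i<d. (z i)\<^sup>2) \<le> 16 * int d}"

definition grid_vec :: "nat \<Rightarrow> (nat \<Rightarrow> int) \<Rightarrow> real Matrix.vec" where
  "grid_vec d z = Matrix.vec d (\<lambda>i. of_int (z i) / (4 * sqrt (real d)))"

lemma finite_grid: "finite (grid d)"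
  unfolding grid_def by (rule finite_subset[of _ "{..<d} \<rightarrow>\<^sub>E {- int (16 * d)..int (16 * d)}"]) (auto intro: finite_PiE)

lemma grid_nonempty: "grid d \<noteq> {}"
proof -
  have "(\<lambda>i\<in>{..<d}. 0) \<in> grid d" by (auto simp: grid_def)
  then show ?thesis by blast
qed

lemma abs_le_square_int: "\<bar>t\<bar> \<le> t\<^sup>2" for t :: int
proof (cases "t = 0")
  case False
  then have "\<bar>t\<bar> * 1 \<le> \<bar>t\<bar> * \<bar>t\<bar>" by (intro mult_left_mono) auto
  then show ?thesis by (simp add: power2_eq_square flip: abs_mult)
qed simp

lemma grid_sum_squares_le:
  assumes "z \<in> grid d"
  shows "(\<Sum>i<d. (real_of_int (z i))\<^sup>2) \<le> 16 * real d"
proof -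
  have "(\<Sum>i<d. (z i)\<^sup>2) \<le> 16 * int d" using assms unfolding grid_def by blast
  then have "real_of_int (\<Sum>i<d. (z i)\<^sup>2) \<le> real_of_int (16 * int d)" by (rule of_int_le_iff[THEN iffD2])
  then show ?thesis by simp
qed

lemma sum_half_powers: "(\<Sum>t\<in>{- int K..int K}. (1/2) ^ nat \<bar>t\<bar>) = 3 - 2 * (1/2 :: real) ^ K"
proof (induction K)
  case (Suc K)
  have "{- int (Suc K)..int (Suc K)} = insert (int (Suc K)) (insert (- int (Suc K)) {- int K..int K})"
    by auto
  then show ?case using Suc by (simp add: nat_add_distrib)
qed simp

text \<open>Since \<open>exp (16 d - |z|\<^sup>2) \<ge> 1\<close> on the grid, counting reduces to a sum that factorises over
  the coordinates.\<close>

lemma card_grid_le: "real (card (grid d)) \<le> exp (18 * real d)"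
proof -
  let ?K = "{- int (16 * d)..int (16 * d)}"
  have "real (card (grid d)) = (\<Sum>z\<in>grid d. 1)" by simp
  also have "\<dots> \<le> (\<Sum>z\<in>grid d. exp (16 * real d) * (\<Prod>i<d. exp (- of_int ((z i)\<^sup>2))))"
  proof (rule sum_mono)
    fix z assume "z \<in> grid d"
    from grid_sum_squares_le[OF this] have "1 \<le> exp (16 * real d + (\<Sum>i<d. - of_int ((z i)\<^sup>2)))" by (simp add: sum_negf)
    then show "1 \<le> exp (16 * real d) * (\<Prod>i<d. exp (- of_int ((z i)\<^sup>2)))" by (simp add: exp_add exp_sum)
  qed
  also have "\<dots> \<le> (\<Sum>z\<in>{..<d} \<rightarrow>\<^sub>E ?K. exp (16 * real d) * (\<Prod>i<d. exp (- of_int ((z i)\<^sup>2))))"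
  proof (rule sum_mono2)
    show "finite ({..<d} \<rightarrow>\<^sub>E ?K)" by (intro finite_PiE) auto
    show "grid d \<subseteq> {..<d} \<rightarrow>\<^sub>E ?K" unfolding grid_def by blast
  qed (intro mult_nonneg_nonneg prod_nonneg ballI exp_ge_zero)
  also have "\<dots> = exp (16 * real d) * (\<Prod>i<d. \<Sum>t\<in>?K. exp (- of_int (t\<^sup>2)))"
    by (subst prod_sum_PiE) (simp_all add: sum_distrib_left)
  also have "\<dots> \<le> exp (16 * real d) * (\<Prod>i<d. 3)"
  proof (intro mult_left_mono prod_mono conjI)
    \<comment> \<open>In each coordinate the Gaussian sum is compared with a geometric one; its
      bound 3 is below exp 2, which explains 18 = 16 + 2.\<close>
    have "exp (- of_int (t\<^sup>2)) \<le> (1/2 :: real) ^ nat \<bar>t\<bar>" for t :: int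
    proof -
      have "exp (-1) \<le> (1/2 :: real)"
        using exp_ge_add_one_self[of "1::real"] by (simp add: exp_minus field_simps)
      then have "exp (-1) ^ nat \<bar>t\<bar> \<le> (1/2 :: real) ^ nat \<bar>t\<bar>" by (intro power_mono) auto
      moreover have "real_of_int \<bar>t\<bar> \<le> real_of_int (t\<^sup>2)" by (rule of_int_le_iff[THEN iffD2, OF abs_le_square_int])
      then have "exp (- of_int (t\<^sup>2)) \<le> exp (-1 :: real) ^ nat \<bar>t\<bar>"
        by (simp add: exp_of_nat_mult[symmetric])
      ultimately show ?thesis by linarith
    qed
    then have "(\<Sum>t\<in>?K. exp (- of_int (t\<^sup>2))) \<le> (\<Sum>t\<in>?K. (1/2 :: real) ^ nat \<bar>t\<bar>)" by (intro sum_mono)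
    also have "\<dots> \<le> 3" unfolding sum_half_powers by simp
    finally show "(\<Sum>t\<in>?K. exp (- of_int (t\<^sup>2))) \<le> (3::real)" .
  qed (auto intro: sum_nonneg)
  also have "(\<Prod>i<d. 3 :: real) \<le> exp 2 ^ d"
    using exp_ge_add_one_self[of "2::real"] by (simp add: power_mono)
  also have "exp (16 * real d) * exp 2 ^ d = exp (18 * real d)"
    by (simp add: exp_of_nat_mult[symmetric] exp_add[symmetric])
  finally show ?thesis by simp
qed

lemma grid_vec_carrier [simp]: "grid_vec d z \<in> carrier_vec d"
  by (simp add: grid_vec_def)

lemma grid_vec_norm_le:
  assumes "z \<in> grid d"
  shows "scalar_prod (grid_vec d z) (grid_vec d z) \<le> 1"
proof (cases "d = 0")
  case False
  have "(\<Sum>i<d. (real_of_int (z i))\<^sup>2) / (16 * real d) \<le> 1"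
    using False grid_sum_squares_le[OF assms] by simp
  moreover have "scalar_prod (grid_vec d z) (grid_vec d z) = (\<Sum>i<d. (real_of_int (z i))\<^sup>2 / (16 * real d))"
    unfolding scalar_prod_def grid_vec_def lessThan_atLeast0
    by (intro sum.cong) (auto simp: power2_eq_square real_sqrt_mult_self)
  ultimately show ?thesis by (simp add: sum_divide_distrib)
qed (simp add: grid_vec_def scalar_prod_def)

text \<open>Rounding towards zero moves each coordinate by at most one mesh width 1/(4 sqrt d), in
  total at most 1/4 in norm. It never increases a modulus, so the rounded point stays in the unit
  ball and hence in the grid.\<close>

lemma grid_approximation:
  assumes x: "x \<in> carrier_vec d" "scalar_prod x x \<le> 1" and "d > 0"
  obtains z where "z \<in> grid d" "scalar_prod (x - grid_vec d z) (x - grid_vec d z) \<le> 1 / 16"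
proof -
  define r where "r = 4 * sqrt (real d)"
  have r: "r > 0" "r\<^sup>2 = 16 * real d" using \<open>d > 0\<close> by (auto simp: r_def power_mult_distrib)
  define z where "z = (\<lambda>i\<in>{..<d}. if x $ i \<ge> 0 then \<lfloor>r * x $ i\<rfloor> else \<lceil>r * x $ i\<rceil>)"
  have xx: "(\<Sum>i<d. (x $ i)\<^sup>2) \<le> 1"
    using x by (simp add: scalar_prod_def power2_eq_square lessThan_atLeast0)
  have zb: "\<bar>real_of_int (z i)\<bar> \<le> \<bar>r * x $ i\<bar> \<and> \<bar>r * x $ i - real_of_int (z i)\<bar> \<le> 1" if "i < d" for i
  proof (cases "x $ i \<ge> 0")
    case True
    then have "0 \<le> r * x $ i" using r by simp
    then have "0 \<le> \<lfloor>r * x $ i\<rfloor>" by simp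
    then have "0 \<le> real_of_int \<lfloor>r * x $ i\<rfloor>" by (rule of_int_0_le_iff[THEN iffD2])
    then have "\<bar>real_of_int \<lfloor>r * x $ i\<rfloor>\<bar> \<le> \<bar>r * x $ i\<bar> \<and> \<bar>r * x $ i - real_of_int \<lfloor>r * x $ i\<rfloor>\<bar> \<le> 1"
      using \<open>0 \<le> r * x $ i\<close> by linarith
    then show ?thesis using True that by (simp add: z_def)
  next
    case False
    then have neg: "r * x $ i \<le> 0" using r by (simp add: mult_nonneg_nonpos)
    then have "\<lceil>r * x $ i\<rceil> \<le> 0" by simp
    then have "real_of_int \<lceil>r * x $ i\<rceil> \<le> 0" by (rule of_int_le_0_iff[THEN iffD2])
    then have "\<bar>real_of_int \<lceil>r * x $ i\<rceil>\<bar> \<le> \<bar>r * x $ i\<bar> \<and> \<bar>r * x $ i - real_of_int \<lceil>r * x $ i\<rceil>\<bar> \<le> 1"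
      using neg by linarith
    then show ?thesis using False that by (simp add: z_def)
  qed
  have "(\<Sum>i<d. (real_of_int (z i))\<^sup>2) \<le> (\<Sum>i<d. (r * x $ i)\<^sup>2)"
    using zb by (intro sum_mono) (auto intro: iffD1[OF abs_le_square_iff])
  also have "\<dots> = 16 * real d * (\<Sum>i<d. (x $ i)\<^sup>2)" by (simp add: power_mult_distrib r sum_distrib_left)
  also have "\<dots> \<le> 16 * real d * 1" using xx by (intro mult_left_mono) auto
  finally have "real_of_int (\<Sum>i<d. (z i)\<^sup>2) \<le> real_of_int (16 * int d)" by simp
  then have zs: "(\<Sum>i<d. (z i)\<^sup>2) \<le> 16 * int d" by (rule of_int_le_iff[THEN iffD1])
  have zi: "\<bar>z i\<bar> \<le> 16 * int d" if "i < d" for i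
  proof -
    have "\<bar>z i\<bar> \<le> (z i)\<^sup>2" by (rule abs_le_square_int)
    also have "\<dots> \<le> (\<Sum>i<d. (z i)\<^sup>2)" using that by (intro member_le_sum) auto
    finally show ?thesis using zs by simp
  qed
  have "z \<in> grid d" unfolding grid_def using zs zi by (auto simp: z_def abs_le_iff minus_le_iff)
  moreover have "scalar_prod (x - grid_vec d z) (x - grid_vec d z) \<le> 1 / 16"
  proof -
    have "scalar_prod (x - grid_vec d z) (x - grid_vec d z) = (\<Sum>i<d. (x $ i - real_of_int (z i) / r)\<^sup>2)"
      using x(1) by (simp add: scalar_prod_def grid_vec_def r_def power2_eq_square lessThan_atLeast0)
    also have "\<dots> \<le> (\<Sum>i<d. 1 / (16 * real d))"
    proof (rule sum_mono)
      fix i assume "i \<in> {..<d}"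
      then have "(r * x $ i - real_of_int (z i))\<^sup>2 \<le> 1"
        using zb[of i] by (simp add: abs_square_le_1)
      moreover have "x $ i - real_of_int (z i) / r = (r * x $ i - real_of_int (z i)) / r" using r by (simp add: field_simps)
      ultimately show "(x $ i - real_of_int (z i) / r)\<^sup>2 \<le> 1 / (16 * real d)"
        using \<open>d > 0\<close> by (simp add: power_divide r divide_right_mono)
    qed
    also have "\<dots> = 1 / 16" using \<open>d > 0\<close> by simp
    finally show ?thesis .
  qed
  ultimately show thesis using that by blast
qed

text \<open>With \<open>a\<close> the largest modulus of an eigenvalue, passing from a unit eigenvector to its grid
  approximation changes the quadratic form by at most \<open>a/2\<close>.\<close>

lemma quadratic_form_le_grid:
  assumes A: "A \<in> carrier_mat d d" "symmetric_mat A"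
    and s: "\<And>z. z \<in> grid d \<Longrightarrow> \<bar>scalar_prod (grid_vec d z) (A *\<^sub>v grid_vec d z)\<bar> \<le> s"
    and x: "x \<in> carrier_vec d"
  shows "\<bar>scalar_prod x (A *\<^sub>v x)\<bar> \<le> 2 * s * scalar_prod x x"
proof (cases "d = 0")
  case True
  then show ?thesis using x A by (simp add: scalar_prod_def)
next
  case False
  obtain U l where U: "orth_mat d U" "A = spectral_mat d U l"
    using spectral_decomposition[OF A] by blast
  define a where "a = Max ((\<lambda>i. \<bar>l i\<bar>) ` {..<d})"
  have la: "\<bar>l i\<bar> \<le> a" if "i < d" for i unfolding a_def using that by (intro Max_ge) auto
  have "a \<in> (\<lambda>i. \<bar>l i\<bar>) ` {..<d}" unfolding a_def using False by (intro Max_in) auto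
  then obtain i where i: "i < d" "a = \<bar>l i\<bar>" by auto
  have quad: "\<bar>scalar_prod x (A *\<^sub>v x)\<bar> \<le> a * scalar_prod x x" if x: "x \<in> carrier_vec d" for x
    unfolding U(2) spectral_mat_forms[OF U(1) x] sum_distrib_left
    using la by (intro order_trans[OF sum_abs] sum_mono) (auto simp: abs_mult intro!: mult_right_mono)
  obtain v where v: "v \<in> carrier_vec d" "scalar_prod v v = 1" "scalar_prod v (A *\<^sub>v v) = l i"
    using spectral_mat_eigenvector[OF U(1) i(1), of l] U(2) by blast
  obtain z where z: "z \<in> grid d" "scalar_prod (v - grid_vec d z) (v - grid_vec d z) \<le> 1 / 16"
    using grid_approximation[of v d] v False by auto
  define y where "y = grid_vec d z"
  have y: "y \<in> carrier_vec d" "scalar_prod y y \<le> 1" using grid_vec_norm_le[OF z(1)] by (auto simp: y_def)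
  \<comment> \<open>Scaled so that |h| <= 1 and |u| <= 1: the difference of the two quadratic forms
    is <v + y, A (v - y)> = <u, A h>/2, so the bilinear bound yields a <= s + a/2.\<close>
  define h where "h = 4 \<cdot>\<^sub>v (v - y)"
  define u where "u = (1/2) \<cdot>\<^sub>v (v + y)"
  have hc: "h \<in> carrier_vec d" "u \<in> carrier_vec d" using v y by (auto simp: h_def u_def)
  have hh: "scalar_prod h h \<le> 1" using z(2) v y by (simp add: h_def y_def)
  have ns: "scalar_prod y v = scalar_prod v y" by (rule comm_scalar_prod[OF y(1) v(1)])
  have "scalar_prod (v - y) (v - y) \<ge> 0" by (simp add: scalar_prod_def sum_nonneg)
  then have "2 * scalar_prod v y \<le> scalar_prod v v + scalar_prod y y"
    using v y ns by (simp add: minus_scalar_prod_distrib[of _ d] scalar_prod_minus_distrib[of _ d])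
  then have uu: "scalar_prod u u \<le> 1"
    using v y ns by (simp add: u_def add_scalar_prod_distrib[of _ d] scalar_prod_add_distrib[of _ d] field_simps)
  have Ac: "A *\<^sub>v v \<in> carrier_vec d" "A *\<^sub>v y \<in> carrier_vec d" using A v y by auto
  have sym: "scalar_prod y (A *\<^sub>v v) = scalar_prod v (A *\<^sub>v y)"
    using transpose_vec_mult_scalar[OF A(1) v(1) y(1)] comm_scalar_prod[OF Ac(2) v(1)] A(2) comm_scalar_prod[OF y(1) Ac(1)]
    by (simp add: symmetric_mat_def)
  have "scalar_prod v (A *\<^sub>v v) - scalar_prod y (A *\<^sub>v y) = 1/2 * scalar_prod u (A *\<^sub>v h)"
  proof -
    have "scalar_prod (v + y) (A *\<^sub>v (v - y)) = scalar_prod v (A *\<^sub>v v) - scalar_prod y (A *\<^sub>v y)"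
      using A v(1) y Ac sym by (simp add: mult_minus_distrib_mat_vec[of _ d d]
        add_scalar_prod_distrib[of _ d] scalar_prod_minus_distrib[of _ d])
    moreover have "v + y \<in> carrier_vec d" "A *\<^sub>v (v - y) \<in> carrier_vec d" "v - y \<in> carrier_vec d"
      using A v y by auto
    ultimately show ?thesis using A by (simp add: u_def h_def mult_mat_vec[of _ d d])
  qed
  moreover have "\<bar>scalar_prod u (A *\<^sub>v h)\<bar> \<le> a"
  proof -
    have "\<bar>scalar_prod u (A *\<^sub>v h)\<bar> \<le> a * (scalar_prod u u + scalar_prod h h) / 2"
      by (rule symmetric_bilinear_le[OF A quad hc(2,1)])
    also have "\<dots> \<le> a * (1 + 1) / 2" using i uu hh by (intro divide_right_mono mult_left_mono) auto
    finally show ?thesis by simp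
  qed
  moreover have "\<bar>scalar_prod y (A *\<^sub>v y)\<bar> \<le> s" using s[OF z(1)] by (simp add: y_def)
  ultimately have "a \<le> 2 * s" using v(3) i(2) by linarith
  then have "a * scalar_prod x x \<le> 2 * s * scalar_prod x x"
    by (intro mult_right_mono) (auto simp: scalar_prod_def sum_nonneg)
  then show ?thesis using quad[OF x] by linarith
qed

section \<open>Principal submatrices and their inverses\<close>

lemma rank_in_less_card:
  assumes "finite J" "i \<in> J"
  shows "rank_in J i < card J"
  unfolding rank_in_def using assms by (intro psubset_card_mono) auto

lemma pick_rank_in: "i \<in> J \<Longrightarrow> pick J (rank_in J i) = i"
  unfolding rank_in_def by (rule pick_card_in_set)

lemma rank_in_pick: "a < card J \<Longrightarrow> rank_in J (pick J a) = a"
  unfolding rank_in_def by (rule card_pick_le)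

lemma sum_pick:
  assumes "finite J"
  shows "(\<Sum>a<card J. f (pick J a)) = (\<Sum>i\<in>J. f i)"
  using assms
  by (intro sum.reindex_bij_witness[of _ "rank_in J" "pick J"])
     (auto simp: rank_in_pick pick_rank_in rank_in_less_card intro: pick_in_set_le)

text \<open>Vectors over the positions of \<open>J\<close> are represented by functions on the
  original indices, so that block computations become sums over \<open>J\<close> and the translation
  between positions and indices is done once.\<close>

definition restr :: "nat set \<Rightarrow> (nat \<Rightarrow> real) \<Rightarrow> real Matrix.vec" where
  "restr J x = Matrix.vec (card J) (\<lambda>a. x (pick J a))"

lemma restr_carrier [simp]: "restr J x \<in> carrier_vec (card J)"
  by (simp add: restr_def)

lemma restr_cong: "(\<And>i. i \<in> J \<Longrightarrow> x i = y i) \<Longrightarrow> restr J x = restr J y"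
  unfolding restr_def by (intro eq_vecI) (auto intro: pick_in_set_le)

lemma restr_add: "restr J x + restr J y = restr J (\<lambda>i. x i + y i)"
  unfolding restr_def by (intro eq_vecI) auto

lemma restr_surj:
  assumes "finite J" "v \<in> carrier_vec (card J)"
  obtains x where "v = restr J x" "\<And>i. i \<notin> J \<Longrightarrow> x i = 0"
proof
  let ?x = "\<lambda>i. if i \<in> J then v $ rank_in J i else 0"
  show "v = restr J ?x"
    unfolding restr_def using assms by (intro eq_vecI) (auto simp: rank_in_pick pick_in_set_le)
qed simp

lemma scalar_prod_restr:
  assumes "finite J"
  shows "scalar_prod (restr J x) (restr J y) = (\<Sum>i\<in>J. x i * y i)"
  using sum_pick[OF assms, of "\<lambda>i. x i * y i"]
  by (simp add: restr_def scalar_prod_def lessThan_atLeast0)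

lemma mult_mat_vec_restr:
  assumes "finite J" "G \<in> carrier_mat (card J) (card J)"
  shows "G *\<^sub>v restr J x = restr J (\<lambda>i. \<Sum>j\<in>J. G $$ (rank_in J i, rank_in J j) * x j)"
proof (rule eq_vecI)
  fix a assume "a < dim_vec (restr J (\<lambda>i. \<Sum>j\<in>J. G $$ (rank_in J i, rank_in J j) * x j))"
  then have a: "a < card J" by (simp add: restr_def)
  then have "(G *\<^sub>v restr J x) $ a = (\<Sum>b<card J. G $$ (rank_in J (pick J a), rank_in J (pick J b)) * x (pick J b))"
    using assms by (simp add: restr_def scalar_prod_def row_def lessThan_atLeast0 rank_in_pick)
  also have "\<dots> = (\<Sum>j\<in>J. G $$ (rank_in J (pick J a), rank_in J j) * x j)"
    by (rule sum_pick[OF assms(1)])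
  finally show "(G *\<^sub>v restr J x) $ a = restr J (\<lambda>i. \<Sum>j\<in>J. G $$ (rank_in J i, rank_in J j) * x j) $ a"
    using a by (simp add: restr_def)
qed (use assms in \<open>simp add: restr_def\<close>)

lemma bilinear_restr:
  assumes "finite J" "G \<in> carrier_mat (card J) (card J)"
  shows "scalar_prod (restr J x) (G *\<^sub>v restr J y)
    = (\<Sum>i\<in>J. \<Sum>j\<in>J. x i * G $$ (rank_in J i, rank_in J j) * y j)"
  unfolding mult_mat_vec_restr[OF assms] scalar_prod_restr[OF assms(1)]
  by (simp add: sum_distrib_left mult.assoc)

lemma submatrix_principal:
  assumes A: "A \<in> carrier_mat p p" and J: "J \<subseteq> {..<p}"
  shows "submatrix A J J \<in> carrier_mat (card J) (card J)"
    "i \<in> J \<Longrightarrow> j \<in> J \<Longrightarrow> submatrix A J J $$ (rank_in J i, rank_in J j) = A $$ (i,j)"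
proof -
  have eq: "{i. i < p \<and> i \<in> J} = J" using J by auto
  show "submatrix A J J \<in> carrier_mat (card J) (card J)"
    using A by (intro carrier_matI) (auto simp: dim_submatrix eq)
  show "submatrix A J J $$ (rank_in J i, rank_in J j) = A $$ (i,j)" if "i \<in> J" "j \<in> J"
    unfolding rank_in_def using A J that by (intro submatrix_index_card) auto
qed

lemma symmetric_submatrix:
  assumes A: "A \<in> carrier_mat p p" "symmetric_mat A" and J: "J \<subseteq> {..<p}"
  shows "symmetric_mat (submatrix A J J)"
proof -
  have eq: "{i. i < p \<and> i \<in> J} = J" using J by auto
  have As: "A $$ (i,j) = A $$ (j,i)" if "i < p" "j < p" for i j
    using A that unfolding symmetric_mat_def by (metis index_transpose_mat(1) carrier_matD)
  have "pick J a < p" if "a < card J" for a using pick_in_set_le[OF that] J by auto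
  then show ?thesis unfolding symmetric_mat_def
    using A As by (intro eq_matI) (auto simp: submatrix_def eq)
qed

lemma mult_mat_vec_fun:
  assumes "A \<in> carrier_mat p p"
  shows "A *\<^sub>v Matrix.vec p x = Matrix.vec p (\<lambda>i. \<Sum>j<p. A $$ (i,j) * x j)"
  using assms by (intro eq_vecI) (auto simp: scalar_prod_def row_def lessThan_atLeast0)

lemma scalar_prod_fun: "scalar_prod (Matrix.vec p x) (Matrix.vec p y) = (\<Sum>i<p. x i * y i)"
  by (simp add: scalar_prod_def lessThan_atLeast0)

lemma bilinear_fun:
  assumes "A \<in> carrier_mat p p"
  shows "scalar_prod (Matrix.vec p x) (A *\<^sub>v Matrix.vec p y) = (\<Sum>i<p. \<Sum>j<p. x i * A $$ (i,j) * y j)"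
  unfolding mult_mat_vec_fun[OF assms] scalar_prod_fun by (simp add: sum_distrib_left mult.assoc)

lemma sum_supported:
  fixes x f :: "nat \<Rightarrow> real"
  assumes "J \<subseteq> {..<p}" "\<And>i. i \<notin> J \<Longrightarrow> x i = 0"
  shows "(\<Sum>i<p. x i * f i) = (\<Sum>i\<in>J. x i * f i)" "(\<Sum>i<p. f i * x i) = (\<Sum>i\<in>J. f i * x i)"
  using assms by (auto intro!: sum.mono_neutral_right)

text \<open>A vector on \<open>J\<close> padded with zeros keeps its norm, and its quadratic form in
  \<open>A\<close> is that of the block.\<close>

lemma spectrum_within_submatrix:
  assumes W: "spectrum_within p \<eta> A" and J: "J \<subseteq> {..<p}"
  shows "spectrum_within (card J) \<eta> (submatrix A J J)"
  unfolding spectrum_within_def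
proof (intro conjI ballI)
  note A = spectrum_withinD(1,2)[OF W]
  note sub = submatrix_principal[OF A(1) J]
  have fJ: "finite J" using J finite_subset by auto
  show "submatrix A J J \<in> carrier_mat (card J) (card J)" by (rule sub(1))
  show "symmetric_mat (submatrix A J J)" by (rule symmetric_submatrix[OF A J])
  fix v :: "real Matrix.vec" assume "v \<in> carrier_vec (card J)"
  then obtain x where x: "v = restr J x" "\<And>i. i \<notin> J \<Longrightarrow> x i = 0"
    using restr_surj[OF fJ] by blast
  have n: "scalar_prod v v = scalar_prod (Matrix.vec p x) (Matrix.vec p x)"
    unfolding x(1) scalar_prod_restr[OF fJ] scalar_prod_fun by (rule sum_supported(1)[OF J x(2), symmetric])
  have "scalar_prod v (submatrix A J J *\<^sub>v v) = (\<Sum>i\<in>J. x i * (\<Sum>j\<in>J. A $$ (i,j) * x j))"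
    unfolding x(1) bilinear_restr[OF fJ sub(1)] by (simp add: sub(2) sum_distrib_left mult.assoc)
  also have "\<dots> = (\<Sum>i<p. x i * (\<Sum>j\<in>J. A $$ (i,j) * x j))"
    by (rule sum_supported(1)[OF J x(2), symmetric])
  also have "\<dots> = (\<Sum>i<p. x i * (\<Sum>j<p. A $$ (i,j) * x j))"
  proof -
    have "(\<Sum>j<p. A $$ (i,j) * x j) = (\<Sum>j\<in>J. A $$ (i,j) * x j)" for i
      by (rule sum_supported(2)[OF J x(2)])
    then show ?thesis by simp
  qed
  also have "\<dots> = scalar_prod (Matrix.vec p x) (A *\<^sub>v Matrix.vec p x)"
    unfolding bilinear_fun[OF A(1)] by (simp add: sum_distrib_left mult.assoc)
  finally have q: "scalar_prod v (submatrix A J J *\<^sub>v v) = scalar_prod (Matrix.vec p x) (A *\<^sub>v Matrix.vec p x)" .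
  show "scalar_prod v v / \<eta> \<le> scalar_prod v (submatrix A J J *\<^sub>v v)"
    "scalar_prod v (submatrix A J J *\<^sub>v v) \<le> \<eta> * scalar_prod v v"
    unfolding n q by (rule spectrum_withinD[OF W]; simp)+
qed

lemma scalar_prod_abs_le:
  assumes "a \<in> carrier_vec n" "b \<in> carrier_vec n" and "\<beta> > (0::real)"
  shows "\<bar>scalar_prod a b\<bar> \<le> (\<beta> * scalar_prod a a + scalar_prod b b / \<beta>) / 2"
proof -
  have "\<bar>s * t\<bar> \<le> (\<beta> * (s * s) + t * t / \<beta>) / 2" for s t :: real
  proof -
    have "0 \<le> (\<beta> * \<bar>s\<bar> - \<bar>t\<bar>)\<^sup>2 / \<beta>" using \<open>\<beta> > 0\<close> by simp
    also have "\<dots> = \<beta> * (s * s) + t * t / \<beta> - 2 * \<bar>s * t\<bar>"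
      using \<open>\<beta> > 0\<close> by (simp add: power2_eq_square abs_mult field_simps)
    finally show ?thesis by simp
  qed
  then have "(\<Sum>i<n. \<bar>a $ i * b $ i\<bar>) \<le> (\<Sum>i<n. (\<beta> * (a $ i * a $ i) + b $ i * b $ i / \<beta>) / 2)"
    by (intro sum_mono)
  also have "\<dots> = (\<beta> * scalar_prod a a + scalar_prod b b / \<beta>) / 2"
    using assms by (simp add: scalar_prod_def lessThan_atLeast0 sum.distrib sum_distrib_left flip: sum_divide_distrib)
  finally have "(\<Sum>i<n. \<bar>a $ i * b $ i\<bar>) \<le> (\<beta> * scalar_prod a a + scalar_prod b b / \<beta>) / 2" .
  moreover have "\<bar>scalar_prod a b\<bar> \<le> (\<Sum>i<n. \<bar>a $ i * b $ i\<bar>)"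
    using assms(1,2) sum_abs[of "\<lambda>i. a $ i * b $ i" "{..<n}"] by (simp add: scalar_prod_def lessThan_atLeast0)
  ultimately show ?thesis by linarith
qed

text \<open>Write \<open>v = \<Omega> w\<close> for \<open>w\<close> supported on \<open>I\<close>, \<open>B\<close> for the \<open>J\<close>-block of \<open>\<Sigma>\<close> and \<open>A\<close> for its clipped
  estimate. Reading \<open>\<Sigma> v = w\<close> on the rows in \<open>J\<close> gives \<open>A (A\<^sup>-\<^sup>1 w - v\<^sub>J) = (B - A) v\<^sub>J + c\<close>, where \<open>c\<close>
  collects the coordinates of \<open>v\<close> outside \<open>J\<close>. No Schur complement is needed.\<close>

lemma local_inverse_error:
  assumes W: "spectrum_within p \<eta> \<Omega>" and "\<eta> > 1"
    and Sg: "Sg \<in> carrier_mat p p" "Sg * \<Omega> = 1\<^sub>m p"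
    and S: "S \<in> carrier_mat p p" "symmetric_mat S"
    and J: "J \<subseteq> {..<p}" and I: "I \<subseteq> J" and "\<beta> > 0" and "e \<ge> 0"
    and close: "\<And>v. v \<in> carrier_vec (card J) \<Longrightarrow>
      \<bar>scalar_prod v (submatrix S J J *\<^sub>v v) - scalar_prod v (submatrix Sg J J *\<^sub>v v)\<bar> \<le> e * scalar_prod v v"
    and off: "(\<Sum>j\<in>{..<p} - J. (\<Sum>i\<in>I. \<Omega> $$ (j,i) * x i)\<^sup>2) \<le> \<beta>\<^sup>2 * (\<Sum>i\<in>I. (x i)\<^sup>2)"
  defines "G \<equiv> mat_inv (spectral_clip \<eta> (submatrix S J J))"
  shows "\<bar>\<Sum>i\<in>I. \<Sum>j\<in>I. x i * (G $$ (rank_in J i, rank_in J j) - \<Omega> $$ (i,j)) * x j\<bar>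
    \<le> (2 * e + \<beta>) * \<eta>\<^sup>2 * (\<Sum>i\<in>I. (x i)\<^sup>2)"
proof -
  have "\<eta> > 0" using \<open>\<eta> > 1\<close> by simp
  have fJ: "finite J" using J finite_subset by auto
  define d where "d = card J"
  define n2 where "n2 = (\<Sum>i\<in>I. (x i)\<^sup>2)"
  define w where "w = (\<lambda>i. if i \<in> I then x i else 0)"
  have sumI: "(\<Sum>i\<in>K. w i * f i) = (\<Sum>i\<in>I. x i * f i)" if "I \<subseteq> K" "finite K" for K f
    using that unfolding w_def by (intro sum.mono_neutral_cong_right) auto
  have sumI': "(\<Sum>i\<in>K. f i * w i) = (\<Sum>i\<in>I. f i * x i)" if "I \<subseteq> K" "finite K" for K f
    using sumI[OF that, of f] by (simp add: mult.commute)
  have Ip: "I \<subseteq> {..<p}" using I J by auto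
  define WW where "WW = restr J w"
  have WWc: "WW \<in> carrier_vec d" by (simp add: WW_def d_def)
  have WW2: "scalar_prod WW WW = n2"
    unfolding WW_def scalar_prod_restr[OF fJ] sumI[OF I fJ] n2_def
    by (intro sum.cong) (auto simp: w_def power2_eq_square)
  note Oc = spectrum_withinD(1,2)[OF W]
  have WSg: "spectrum_within p \<eta> Sg" by (rule spectrum_within_inverse[OF W \<open>\<eta> > 0\<close> Sg])
  define A where "A = spectral_clip \<eta> (submatrix S J J)"
  define B where "B = submatrix Sg J J"
  have WB: "spectrum_within d \<eta> B" unfolding B_def d_def by (rule spectrum_within_submatrix[OF WSg J])
  note subS = submatrix_principal(1)[OF S(1) J] symmetric_submatrix[OF S J]
  have WA: "spectrum_within d \<eta> A" unfolding A_def d_def by (rule spectrum_within_spectral_clip[OF subS \<open>\<eta> > 1\<close>])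
  have AB: "\<bar>scalar_prod v (A *\<^sub>v v) - scalar_prod v (B *\<^sub>v v)\<bar> \<le> 2 * e * scalar_prod v v" if "v \<in> carrier_vec d" for v
    unfolding A_def B_def
    by (rule spectral_clip_close[OF subS WB[unfolded B_def d_def] \<open>\<eta> > 1\<close> close that[unfolded d_def]])
  note Ac = spectrum_withinD(1,2)[OF WA] and Bc = spectrum_withinD(1,2)[OF WB]
  have G: "G \<in> carrier_mat d d" "A * G = 1\<^sub>m d" "G * A = 1\<^sub>m d"
    using mat_inv_inverse[OF WA \<open>\<eta> > 0\<close>] by (auto simp: G_def A_def)
  have WG: "spectrum_within d \<eta> G" by (rule spectrum_within_inverse[OF WA \<open>\<eta> > 0\<close> G(1,3)])
  define u where "u = G *\<^sub>v WW"
  have uc: "u \<in> carrier_vec d" using G WWc by (simp add: u_def)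
  have Au: "A *\<^sub>v u = WW"
    unfolding u_def using assoc_mult_mat_vec[OF Ac(1) G(1) WWc] G(2) WWc by simp
  have uu: "scalar_prod u u \<le> \<eta>\<^sup>2 * n2"
    using spectrum_within_norm_le[OF WG \<open>\<eta> > 0\<close> WWc] by (simp add: u_def WW2)
  define v where "v = (\<lambda>i. \<Sum>j<p. \<Omega> $$ (i,j) * w j)"
  have vI: "v i = (\<Sum>j\<in>I. \<Omega> $$ (i,j) * x j)" for i
    unfolding v_def by (rule sumI'[OF Ip]) simp
  have Ow: "\<Omega> *\<^sub>v Matrix.vec p w = Matrix.vec p v" unfolding mult_mat_vec_fun[OF Oc(1)] v_def ..
  have vv: "(\<Sum>i<p. v i * v i) \<le> \<eta>\<^sup>2 * n2"
  proof -
    have "(\<Sum>i<p. w i * w i) = n2"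
      unfolding sumI[OF Ip finite_lessThan] n2_def by (intro sum.cong) (auto simp: w_def power2_eq_square)
    then show ?thesis
      using spectrum_within_norm_le[OF W \<open>\<eta> > 0\<close>, of "Matrix.vec p w"] unfolding Ow scalar_prod_fun by simp
  qed
  have Sv: "(\<Sum>j<p. Sg $$ (i,j) * v j) = w i" if "i < p" for i
  proof -
    have "Sg *\<^sub>v Matrix.vec p v = Matrix.vec p w"
      using assoc_mult_mat_vec[OF Sg(1) Oc(1), of "Matrix.vec p w"] Sg(2) Ow by simp
    then show ?thesis unfolding mult_mat_vec_fun[OF Sg(1)] using that by (auto dest!: arg_cong[of _ _ "\<lambda>v. v $ i"])
  qed
  define vJ where "vJ = restr J v"
  have vJc: "vJ \<in> carrier_vec d" by (simp add: vJ_def d_def)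
  have vJ2: "scalar_prod vJ vJ \<le> \<eta>\<^sup>2 * n2"
    unfolding vJ_def scalar_prod_restr[OF fJ]
    by (rule order_trans[OF sum_mono2 vv]) (use J in auto)
  define c where "c = (\<lambda>i. \<Sum>j\<in>{..<p} - J. Sg $$ (i,j) * v j)"
  define cJ where "cJ = restr J c"
  have cJc: "cJ \<in> carrier_vec d" by (simp add: cJ_def d_def)
  have cc: "scalar_prod cJ cJ \<le> \<eta>\<^sup>2 * (\<beta>\<^sup>2 * n2)"
  proof -
    \<comment> \<open>\<open>c\<close> is \<Sigma> applied to the part of \<open>v\<close> outside
      \<open>J\<close>; the norm bound of \<Sigma> and the hypothesis \<open>off\<close> control
      it.\<close>
    define z where "z = (\<lambda>j. if j \<in> J then 0 else v j)"
    have z: "(\<Sum>j<p. f j * z j) = (\<Sum>j\<in>{..<p} - J. f j * v j)" for f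
      unfolding z_def by (intro sum.mono_neutral_cong_right) auto
    have "scalar_prod cJ cJ \<le> (\<Sum>i<p. c i * c i)"
      unfolding cJ_def scalar_prod_restr[OF fJ] using J by (intro sum_mono2) auto
    also have "\<dots> = scalar_prod (Sg *\<^sub>v Matrix.vec p z) (Sg *\<^sub>v Matrix.vec p z)"
      unfolding mult_mat_vec_fun[OF Sg(1)] scalar_prod_fun z c_def ..
    also have "\<dots> \<le> \<eta>\<^sup>2 * scalar_prod (Matrix.vec p z) (Matrix.vec p z)"
      by (rule spectrum_within_norm_le[OF WSg \<open>\<eta> > 0\<close>]) simp
    also have "scalar_prod (Matrix.vec p z) (Matrix.vec p z) = (\<Sum>j\<in>{..<p} - J. (v j)\<^sup>2)"
      unfolding scalar_prod_fun z by (intro sum.cong) (auto simp: z_def power2_eq_square)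
    also have "\<dots> \<le> \<beta>\<^sup>2 * n2" using off unfolding vI n2_def .
    finally show ?thesis by (simp add: mult_left_mono)
  qed
  have Bv: "B *\<^sub>v vJ + cJ = WW"
  proof -
    have "B *\<^sub>v vJ = restr J (\<lambda>i. \<Sum>j\<in>J. Sg $$ (i,j) * v j)"
      unfolding B_def vJ_def mult_mat_vec_restr[OF fJ submatrix_principal(1)[OF Sg(1) J]]
      by (intro restr_cong sum.cong refl) (simp add: submatrix_principal(2)[OF Sg(1) J])
    then have "B *\<^sub>v vJ + cJ = restr J (\<lambda>i. (\<Sum>j\<in>J. Sg $$ (i,j) * v j) + c i)"
      by (simp add: cJ_def restr_add)
    also have "\<dots> = WW" unfolding WW_def
    proof (rule restr_cong)
      fix i assume "i \<in> J"
      then have "i < p" using J by auto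
      have "(\<Sum>j\<in>J. Sg $$ (i,j) * v j) + c i = (\<Sum>j<p. Sg $$ (i,j) * v j)"
        unfolding c_def using sum.subset_diff[OF J finite_lessThan, of "\<lambda>j. Sg $$ (i,j) * v j"] by simp
      then show "(\<Sum>j\<in>J. Sg $$ (i,j) * v j) + c i = w i" using Sv[OF \<open>i < p\<close>] by simp
    qed
    finally show ?thesis .
  qed
  have carr: "A *\<^sub>v vJ \<in> carrier_vec d" "B *\<^sub>v vJ \<in> carrier_vec d" using Ac Bc vJc by auto
  \<comment> \<open>Everything is paired with u = A^-1 w: symmetry of \<open>A\<close> gives <w,
    v_J> = <u, A v_J>, and w = B v_J + c_J expands <w, u>.\<close>
  have "scalar_prod WW vJ = scalar_prod u (A *\<^sub>v vJ)"
    using transpose_vec_mult_scalar[OF Ac(1) vJc uc] Ac(2) Au by (simp add: symmetric_mat_def)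
  moreover have "scalar_prod WW u = scalar_prod u (B *\<^sub>v vJ) + scalar_prod u cJ"
    using scalar_prod_add_distrib[OF uc carr(2) cJc] Bv comm_scalar_prod[OF WWc uc] by simp
  moreover have "scalar_prod u ((A - B) *\<^sub>v vJ) = scalar_prod u (A *\<^sub>v vJ) - scalar_prod u (B *\<^sub>v vJ)"
    using Ac Bc vJc uc carr by (simp add: minus_mult_distrib_mat_vec[of _ d d] scalar_prod_minus_distrib[of _ d])
  ultimately have diff: "scalar_prod WW u - scalar_prod WW vJ = scalar_prod u cJ - scalar_prod u ((A - B) *\<^sub>v vJ)"
    by simp
  have sAB: "symmetric_mat (A - B)"
    using Ac Bc by (simp add: symmetric_mat_def transpose_minus[of _ d d])
  have qAB: "\<bar>scalar_prod y ((A - B) *\<^sub>v y)\<bar> \<le> 2 * e * scalar_prod y y" if y: "y \<in> carrier_vec d" for y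
    using AB[OF y] Ac Bc y by (simp add: minus_mult_distrib_mat_vec[of _ d d] scalar_prod_minus_distrib[of _ d])
  have "\<bar>scalar_prod u ((A - B) *\<^sub>v vJ)\<bar> \<le> 2 * e * (scalar_prod u u + scalar_prod vJ vJ) / 2"
    by (rule symmetric_bilinear_le[OF _ sAB qAB uc vJc]) (use Bc in auto)
  also have "\<dots> \<le> 2 * e * (\<eta>\<^sup>2 * n2 + \<eta>\<^sup>2 * n2) / 2"
    using uu vJ2 \<open>e \<ge> 0\<close> by (intro divide_right_mono mult_left_mono add_mono) auto
  finally have 1: "\<bar>scalar_prod u ((A - B) *\<^sub>v vJ)\<bar> \<le> 2 * e * \<eta>\<^sup>2 * n2" by (simp add: mult_ac)
  \<comment> \<open>The weight \<beta> balances the two squares, since |u|^2 is bounded by \<eta>^2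
    n2 and |c_J|^2 by \<beta>^2 \<eta>^2 n2.\<close>
  have "\<bar>scalar_prod u cJ\<bar> \<le> (\<beta> * scalar_prod u u + scalar_prod cJ cJ / \<beta>) / 2"
    by (rule scalar_prod_abs_le[OF uc cJc \<open>\<beta> > 0\<close>])
  also have "\<dots> \<le> (\<beta> * (\<eta>\<^sup>2 * n2) + (\<eta>\<^sup>2 * (\<beta>\<^sup>2 * n2)) / \<beta>) / 2"
    using uu cc \<open>\<beta> > 0\<close> by (intro divide_right_mono add_mono mult_left_mono) auto
  also have "\<dots> = \<beta> * \<eta>\<^sup>2 * n2" using \<open>\<beta> > 0\<close> by (simp add: power2_eq_square field_simps)
  finally have 2: "\<bar>scalar_prod u cJ\<bar> \<le> \<beta> * \<eta>\<^sup>2 * n2" .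
  have "scalar_prod WW u = (\<Sum>i\<in>I. \<Sum>j\<in>I. x i * G $$ (rank_in J i, rank_in J j) * x j)"
  proof -
    have "scalar_prod WW u = (\<Sum>i\<in>J. w i * (\<Sum>j\<in>J. G $$ (rank_in J i, rank_in J j) * w j))"
      unfolding u_def WW_def bilinear_restr[OF fJ G(1)[unfolded d_def]] by (simp add: sum_distrib_left mult.assoc)
    also have "\<dots> = (\<Sum>i\<in>I. x i * (\<Sum>j\<in>I. G $$ (rank_in J i, rank_in J j) * x j))"
      unfolding sumI[OF I fJ] sumI'[OF I fJ] ..
    finally show ?thesis by (simp add: sum_distrib_left mult.assoc)
  qed
  moreover have "scalar_prod WW vJ = (\<Sum>i\<in>I. \<Sum>j\<in>I. x i * \<Omega> $$ (i,j) * x j)"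
    unfolding WW_def vJ_def scalar_prod_restr[OF fJ] sumI[OF I fJ] vI by (simp add: sum_distrib_left mult.assoc)
  ultimately have "(\<Sum>i\<in>I. \<Sum>j\<in>I. x i * (G $$ (rank_in J i, rank_in J j) - \<Omega> $$ (i,j)) * x j)
    = scalar_prod WW u - scalar_prod WW vJ"
    by (simp add: sum_subtractf[symmetric] algebra_simps)
  then show ?thesis using diff 1 2 by (simp add: n2_def[symmetric] algebra_simps)
qed

section \<open>Deterministic error of the cropping estimator\<close>

text \<open>Schur test: the absolute row sums and, by symmetry, the column sums of the off-diagonal
  block are at most \<open>R\<close>, hence so is its operator norm. Cauchy-Schwarz with each
  |\<Omega>_ji| split into two square roots uses the row sums, the exchange of summation the column
  sums.\<close>

lemma off_block_bound:
  fixes \<Omega> :: "real Matrix.mat"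
  assumes sym: "\<And>i j. i < p \<Longrightarrow> j < p \<Longrightarrow> \<Omega> $$ (i,j) = \<Omega> $$ (j,i)"
    and row: "\<And>i. i < p \<Longrightarrow> (\<Sum>j\<in>{j. j < p \<and> real k \<le> \<bar>real i - real j\<bar>}. \<bar>\<Omega> $$ (i,j)\<bar>) \<le> R"
    and I: "I \<subseteq> {..<p}" and far: "\<And>i j. i \<in> I \<Longrightarrow> j \<in> {..<p} - J \<Longrightarrow> real k \<le> \<bar>real i - real j\<bar>"
    and "R \<ge> 0"
  shows "(\<Sum>j\<in>{..<p} - J. (\<Sum>i\<in>I. \<Omega> $$ (j,i) * x i)\<^sup>2) \<le> R\<^sup>2 * (\<Sum>i\<in>I. (x i)\<^sup>2)"
proof -
  have fI: "finite I" using I finite_subset by auto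
  have "(\<Sum>i\<in>I. \<Omega> $$ (j,i) * x i)\<^sup>2 \<le> R * (\<Sum>i\<in>I. \<bar>\<Omega> $$ (j,i)\<bar> * (x i)\<^sup>2)" if j: "j \<in> {..<p} - J" for j
  proof -
    have "(\<Sum>i\<in>I. \<Omega> $$ (j,i) * x i) \<le> (\<Sum>i\<in>I. \<bar>\<Omega> $$ (j,i) * x i\<bar>)" 
      "- (\<Sum>i\<in>I. \<Omega> $$ (j,i) * x i) \<le> (\<Sum>i\<in>I. \<bar>\<Omega> $$ (j,i) * x i\<bar>)"
      using sum_abs[of "\<lambda>i. \<Omega> $$ (j,i) * x i" I] by linarith+
    then have "(\<Sum>i\<in>I. \<Omega> $$ (j,i) * x i)\<^sup>2 \<le> (\<Sum>i\<in>I. \<bar>\<Omega> $$ (j,i) * x i\<bar>)\<^sup>2"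
      by (intro iffD1[OF abs_le_square_iff]) (auto simp: abs_le_iff)
    also have "\<dots> = (\<Sum>i\<in>I. sqrt \<bar>\<Omega> $$ (j,i)\<bar> * (sqrt \<bar>\<Omega> $$ (j,i)\<bar> * \<bar>x i\<bar>))\<^sup>2"
      by (simp add: abs_mult flip: mult.assoc)
    also have "\<dots> \<le> (\<Sum>i\<in>I. (sqrt \<bar>\<Omega> $$ (j,i)\<bar>)\<^sup>2) * (\<Sum>i\<in>I. (sqrt \<bar>\<Omega> $$ (j,i)\<bar> * \<bar>x i\<bar>)\<^sup>2)"
      by (rule Cauchy_Schwarz_ineq_sum)
    also have "\<dots> = (\<Sum>i\<in>I. \<bar>\<Omega> $$ (j,i)\<bar>) * (\<Sum>i\<in>I. \<bar>\<Omega> $$ (j,i)\<bar> * (x i)\<^sup>2)"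
      by (simp add: power_mult_distrib)
    also have "\<dots> \<le> R * (\<Sum>i\<in>I. \<bar>\<Omega> $$ (j,i)\<bar> * (x i)\<^sup>2)"
    proof (rule mult_right_mono)
      have "(\<Sum>i\<in>I. \<bar>\<Omega> $$ (j,i)\<bar>) \<le> (\<Sum>i\<in>{i. i < p \<and> real k \<le> \<bar>real j - real i\<bar>}. \<bar>\<Omega> $$ (j,i)\<bar>)"
        using I far[OF _ j] by (intro sum_mono2) (auto simp: abs_minus_commute)
      also have "\<dots> \<le> R" using row[of j] j by auto
      finally show "(\<Sum>i\<in>I. \<bar>\<Omega> $$ (j,i)\<bar>) \<le> R" .
    qed (auto intro: sum_nonneg)
    finally show ?thesis .
  qed
  then have "(\<Sum>j\<in>{..<p} - J. (\<Sum>i\<in>I. \<Omega> $$ (j,i) * x i)\<^sup>2)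
    \<le> (\<Sum>j\<in>{..<p} - J. R * (\<Sum>i\<in>I. \<bar>\<Omega> $$ (j,i)\<bar> * (x i)\<^sup>2))" by (intro sum_mono)
  also have "\<dots> = R * (\<Sum>i\<in>I. (x i)\<^sup>2 * (\<Sum>j\<in>{..<p} - J. \<bar>\<Omega> $$ (j,i)\<bar>))"
    by (subst sum_distrib_left[symmetric], subst sum.swap) (simp add: sum_distrib_left mult.commute)
  also have "\<dots> \<le> R * (\<Sum>i\<in>I. (x i)\<^sup>2 * R)"
  proof (intro mult_left_mono sum_mono)
    fix i assume i: "i \<in> I"
    then have ip: "i < p" using I by auto
    have "(\<Sum>j\<in>{..<p} - J. \<bar>\<Omega> $$ (j,i)\<bar>) = (\<Sum>j\<in>{..<p} - J. \<bar>\<Omega> $$ (i,j)\<bar>)"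
      using sym ip by (intro sum.cong) auto
    also have "\<dots> \<le> (\<Sum>j\<in>{j. j < p \<and> real k \<le> \<bar>real i - real j\<bar>}. \<bar>\<Omega> $$ (i,j)\<bar>)"
      using far[OF i] by (intro sum_mono2) auto
    also have "\<dots> \<le> R" by (rule row[OF ip])
    finally show "(\<Sum>j\<in>{..<p} - J. \<bar>\<Omega> $$ (j,i)\<bar>) \<le> R" .
  qed (use \<open>R \<ge> 0\<close> in auto)
  also have "\<dots> = R\<^sup>2 * (\<Sum>i\<in>I. (x i)\<^sup>2)" by (simp add: sum_distrib_right[symmetric] power2_eq_square)
  finally show ?thesis .
qed

lemma inner_window_subset: "inner_window p b m \<subseteq> outer_window p b m" "outer_window p b m \<subseteq> {..<p}"
  by (auto simp: inner_window_def outer_window_def window_def)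

lemma card_outer_window_le: "card (outer_window p b m) \<le> 3 * b"
proof -
  have "outer_window p b m \<subseteq> (\<lambda>t. nat (t - 1)) ` {m - int b..m + 2 * int b - 1}"
  proof
    fix i assume i: "i \<in> outer_window p b m"
    then have "i = nat (int i + 1 - 1)" "int i + 1 \<in> {m - int b..m + 2 * int b - 1}"
      by (auto simp: outer_window_def window_def)
    then show "i \<in> (\<lambda>t. nat (t - 1)) ` {m - int b..m + 2 * int b - 1}" by blast
  qed
  then have "card (outer_window p b m) \<le> card {m - int b..m + 2 * int b - 1}"
    by (rule order_trans[OF card_mono card_image_le, rotated]) auto
  then show ?thesis by simp
qed

text \<open>The inner block is cut out of the local inverse by ranks in \<open>J\<close> and read
  back by ranks in \<open>I\<close>. Ranking in \<open>J\<close> is increasing, so both numberings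
  of \<open>I\<close> agree.\<close>

lemma rank_in_image:
  assumes "finite J" "I \<subseteq> J" "i \<in> I"
  shows "card {a \<in> rank_in J ` I. a < rank_in J i} = rank_in I i"
proof -
  have mono: "rank_in J l < rank_in J i \<longleftrightarrow> l < i" if "l \<in> J" "i \<in> J" for l i
  proof -
    have less: "rank_in J l < rank_in J i" if "l < i" "l \<in> J" for l i
      unfolding rank_in_def using that \<open>finite J\<close> by (intro psubset_card_mono) auto
    show ?thesis using less[of l i] less[of i l] that by (metis less_asym' less_irrefl linorder_neqE_nat)
  qed
  have inj: "inj_on (rank_in J) J" by (rule inj_on_inverseI[of _ "pick J"]) (rule pick_rank_in)
  have "{a \<in> rank_in J ` I. a < rank_in J i} = rank_in J ` {l \<in> I. l < i}"
    using mono assms by auto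
  then show ?thesis
    unfolding rank_in_def[of I] using inj_on_subset[OF inj, of "{l \<in> I. l < i}"] assms
    by (simp add: card_image subset_iff)
qed

text \<open>Removes the double renumbering: from here on an embedded local block is the local
  inverse read at the ranks of \<open>i\<close> and \<open>j\<close> in \<open>J\<close>.\<close>

lemma embed_local_block_entry:
  fixes Z :: "real Matrix.mat"
  assumes Z: "dim_col Z = p" and G: "mat_inv (local_cov \<eta> b m Z) \<in> carrier_mat (card (outer_window p b m)) (card (outer_window p b m))"
    and ij: "i < p" "j < p"
  defines "I \<equiv> inner_window p b m" and "J \<equiv> outer_window p b m"
  shows "embed_block p I (local_block \<eta> b m Z) $$ (i,j)
    = (if i \<in> I \<and> j \<in> I then mat_inv (local_cov \<eta> b m Z) $$ (rank_in J i, rank_in J j) else 0)"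
proof (cases "i \<in> I \<and> j \<in> I")
  case True
  have fJ: "finite J" and IJ: "I \<subseteq> J"
    using inner_window_subset[of p b m] finite_subset unfolding I_def J_def by auto
  have r: "rank_in J l < card J" if "l \<in> I" for l using rank_in_less_card[OF fJ] that IJ by auto
  have "submatrix (mat_inv (local_cov \<eta> b m Z)) (rank_in J ` I) (rank_in J ` I) $$
     (card {a \<in> rank_in J ` I. a < rank_in J i}, card {a \<in> rank_in J ` I. a < rank_in J j})
    = mat_inv (local_cov \<eta> b m Z) $$ (rank_in J i, rank_in J j)"
    using G r True by (intro submatrix_index_card) (auto simp: J_def)
  then show ?thesis
    using True ij rank_in_image[OF fJ IJ] by (simp add: embed_block_def local_block_def Let_def Z I_def J_def)
next
  case False
  then show ?thesis using ij by (auto simp: embed_block_def)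
qed

text \<open>Window \<open>m\<close> contains both indices iff it starts no later than the smaller
  and ends no earlier than the larger, which leaves b - |i-j| consecutive values of
  \<open>m\<close>. The range from 2 - b to p contains all of them, so indices near the border are
  counted like the others.\<close>

lemma window_count:
  assumes "i < p" "j < p" "b \<ge> 1"
  shows "real (card {m \<in> {2 - int b..int p}. i \<in> inner_window p b m \<and> j \<in> inner_window p b m})
    = max 0 (real b - \<bar>real i - real j\<bar>)"
proof -
  have eq: "{m \<in> {2 - int b..int p}. i \<in> inner_window p b m \<and> j \<in> inner_window p b m}
    = {max (int i) (int j) + 2 - int b..min (int i) (int j) + 1}"
    using assms by (auto simp: inner_window_def window_def)
  have "card {m \<in> {2 - int b..int p}. i \<in> inner_window p b m \<and> j \<in> inner_window p b m}
    = nat (int b - \<bar>int i - int j\<bar>)"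
  proof -
    have "min (int i) (int j) + 1 - (max (int i) (int j) + 2 - int b) + 1 = int b - \<bar>int i - int j\<bar>"
      by (simp add: max_def min_def abs_if)
    then show ?thesis unfolding eq by simp
  qed
  moreover have "real (nat (int b - \<bar>int i - int j\<bar>)) = max 0 (real b - \<bar>real i - real j\<bar>)"
    by (simp add: max_def abs_if of_nat_nat)
  ultimately show ?thesis by simp
qed

text \<open>Summing a block over all windows counts the entry \<open>(i, j)\<close> exactly \<open>max 0 (b - |i - j|)\<close> times;
  the diagonal count \<open>b\<close> is what makes the local errors add up to \<open>b E\<close> only.\<close>

lemma window_sum_error:
  fixes \<Omega> :: "real Matrix.mat" and H :: "int \<Rightarrow> nat \<Rightarrow> nat \<Rightarrow> real"
  assumes "b \<ge> 1"
    and local: "\<And>m. m \<in> {2 - int b..int p} \<Longrightarrow>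
      \<bar>\<Sum>i\<in>inner_window p b m. \<Sum>j\<in>inner_window p b m. x i * (H m i j - \<Omega> $$ (i,j)) * x j\<bar>
        \<le> E * (\<Sum>i\<in>inner_window p b m. (x i)\<^sup>2)"
  shows "\<bar>(\<Sum>i<p. \<Sum>j<p. x i * (\<Sum>m\<in>{2 - int b..int p}. if i \<in> inner_window p b m \<and> j \<in> inner_window p b m then H m i j else 0) * x j)
    - (\<Sum>i<p. \<Sum>j<p. x i * (max 0 (real b - \<bar>real i - real j\<bar>) * \<Omega> $$ (i,j)) * x j)\<bar> \<le> real b * E * (\<Sum>i<p. (x i)\<^sup>2)"
proof -
  let ?M = "{2 - int b..int p}" and ?I = "inner_window p b"
  have Ip: "?I m \<subseteq> {..<p}" for m using inner_window_subset[of p b m] by auto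
  have dbl: "(\<Sum>i<p. \<Sum>j<p. if i \<in> ?I m \<and> j \<in> ?I m then f i j else 0) = (\<Sum>i\<in>?I m. \<Sum>j\<in>?I m. f i j)"
    for m and f :: "nat \<Rightarrow> nat \<Rightarrow> real"
  proof -
    have "(\<Sum>j<p. if i \<in> ?I m \<and> j \<in> ?I m then f i j else 0) = (if i \<in> ?I m then \<Sum>j\<in>?I m. f i j else 0)" for i
      using Ip[of m] by (auto intro!: sum.mono_neutral_cong_right)
    then show ?thesis using Ip[of m] by (auto intro!: sum.mono_neutral_cong_right)
  qed
  have swap: "(\<Sum>i<p. \<Sum>j<p. \<Sum>m\<in>?M. g m i j) = (\<Sum>m\<in>?M. \<Sum>i<p. \<Sum>j<p. g m i j)"
    for g :: "int \<Rightarrow> nat \<Rightarrow> nat \<Rightarrow> real"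
    by (subst sum.swap[of _ ?M "{..<p}"], subst sum.swap[of _ ?M "{..<p}"], rule refl)
  have "(\<Sum>i<p. \<Sum>j<p. x i * (\<Sum>m\<in>?M. if i \<in> ?I m \<and> j \<in> ?I m then H m i j else 0) * x j)
    = (\<Sum>i<p. \<Sum>j<p. \<Sum>m\<in>?M. if i \<in> ?I m \<and> j \<in> ?I m then x i * H m i j * x j else 0)"
    by (simp add: sum_distrib_left sum_distrib_right if_distrib[of "\<lambda>t. _ * t"] if_distrib[of "\<lambda>t. t * _"] cong: if_cong)
  also have "\<dots> = (\<Sum>m\<in>?M. \<Sum>i\<in>?I m. \<Sum>j\<in>?I m. x i * H m i j * x j)"
    unfolding swap dbl ..
  finally have 1: "(\<Sum>i<p. \<Sum>j<p. x i * (\<Sum>m\<in>?M. if i \<in> ?I m \<and> j \<in> ?I m then H m i j else 0) * x j)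
    = (\<Sum>m\<in>?M. \<Sum>i\<in>?I m. \<Sum>j\<in>?I m. x i * H m i j * x j)" .
  have cnt: "(\<Sum>m\<in>?M. if i \<in> ?I m \<and> j \<in> ?I m then c else 0) = max 0 (real b - \<bar>real i - real j\<bar>) * c"
    if "i < p" "j < p" for i j and c :: real
  proof -
    have "(\<Sum>m\<in>?M. if i \<in> ?I m \<and> j \<in> ?I m then c else 0) = (\<Sum>m\<in>{m\<in>?M. i \<in> ?I m \<and> j \<in> ?I m}. c)"
      by (intro sum.mono_neutral_cong_right) auto
    then show ?thesis using window_count[OF that \<open>b \<ge> 1\<close>] by simp
  qed
  have "(\<Sum>i<p. \<Sum>j<p. x i * (max 0 (real b - \<bar>real i - real j\<bar>) * \<Omega> $$ (i,j)) * x j)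
    = (\<Sum>i<p. \<Sum>j<p. \<Sum>m\<in>?M. if i \<in> ?I m \<and> j \<in> ?I m then x i * \<Omega> $$ (i,j) * x j else 0)"
    using cnt by (intro sum.cong refl) (simp add: mult_ac)
  also have "\<dots> = (\<Sum>m\<in>?M. \<Sum>i\<in>?I m. \<Sum>j\<in>?I m. x i * \<Omega> $$ (i,j) * x j)"
    unfolding swap dbl ..
  finally have 2: "(\<Sum>i<p. \<Sum>j<p. x i * (max 0 (real b - \<bar>real i - real j\<bar>) * \<Omega> $$ (i,j)) * x j)
    = (\<Sum>m\<in>?M. \<Sum>i\<in>?I m. \<Sum>j\<in>?I m. x i * \<Omega> $$ (i,j) * x j)" .
  have "(\<Sum>m\<in>?M. \<Sum>i\<in>?I m. \<Sum>j\<in>?I m. x i * H m i j * x j) - (\<Sum>m\<in>?M. \<Sum>i\<in>?I m. \<Sum>j\<in>?I m. x i * \<Omega> $$ (i,j) * x j)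
    = (\<Sum>m\<in>?M. \<Sum>i\<in>?I m. \<Sum>j\<in>?I m. x i * (H m i j - \<Omega> $$ (i,j)) * x j)"
    by (simp only: sum_subtractf[symmetric] right_diff_distrib left_diff_distrib)
  also have "\<bar>\<dots>\<bar> \<le> (\<Sum>m\<in>?M. E * (\<Sum>i\<in>?I m. (x i)\<^sup>2))"
    by (rule order_trans[OF sum_abs sum_mono]) (rule local)
  also have "\<dots> = E * (\<Sum>m\<in>?M. \<Sum>i<p. if i \<in> ?I m then (x i)\<^sup>2 else 0)"
  proof -
    have "(\<Sum>i\<in>?I m. (x i)\<^sup>2) = (\<Sum>i<p. if i \<in> ?I m then (x i)\<^sup>2 else 0)" for m
      using Ip[of m] by (intro sum.mono_neutral_cong_left) auto
    then show ?thesis by (simp add: sum_distrib_left)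
  qed
  also have "(\<Sum>m\<in>?M. \<Sum>i<p. if i \<in> ?I m then (x i)\<^sup>2 else 0) = (\<Sum>i<p. real b * (x i)\<^sup>2)"
  proof -
    have "(\<Sum>m\<in>?M. \<Sum>i<p. if i \<in> ?I m then (x i)\<^sup>2 else 0) = (\<Sum>i<p. \<Sum>m\<in>?M. if i \<in> ?I m \<and> i \<in> ?I m then (x i)\<^sup>2 else 0)"
      by (subst sum.swap) simp
    also have "\<dots> = (\<Sum>i<p. real b * (x i)\<^sup>2)"
    proof (rule sum.cong[OF refl])
      fix i assume "i \<in> {..<p}"
      then show "(\<Sum>m\<in>?M. if i \<in> ?I m \<and> i \<in> ?I m then (x i)\<^sup>2 else 0) = real b * (x i)\<^sup>2"
        using cnt[of i i "(x i)\<^sup>2"] by simp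
    qed
    finally show ?thesis .
  qed
  finally show ?thesis unfolding 1 2 by (simp add: sum_distrib_left mult_ac)
qed

text \<open>The weight is 1 up to \<open>k\<close>, falls linearly to 0 at \<open>2 * k\<close> and
  vanishes beyond, so it stays in [0, 1] throughout.\<close>

lemma taper_weight_error:
  fixes t :: real
  assumes "k \<ge> 1" "t \<ge> 0"
  shows "\<bar>(max 0 (real (2 * k) - t) - max 0 (real k - t)) / real k - 1\<bar> \<le> (if real k \<le> t then 1 else 0)"
proof (cases "real k \<le> t")
  case True
  then have "max 0 (real k - t) = 0" "0 \<le> max 0 (real (2 * k) - t)" "max 0 (real (2 * k) - t) \<le> real k"
    by auto
  then show ?thesis using True assms by (simp add: abs_le_iff field_simps del: of_nat_mult)
next
  case False
  then show ?thesis using assms by (simp add: field_simps)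
qed

text \<open>Only entries at distance at least \<open>k\<close> survive, and |x_i x_j| <= (x_i^2 +
  x_j^2)/2 together with symmetry reduces the form to their absolute row sums.\<close>

lemma taper_bias:
  fixes \<Omega> :: "real Matrix.mat"
  assumes sym: "\<And>i j. i < p \<Longrightarrow> j < p \<Longrightarrow> \<Omega> $$ (i,j) = \<Omega> $$ (j,i)"
    and row: "\<And>i. i < p \<Longrightarrow> (\<Sum>j\<in>{j. j < p \<and> real k \<le> \<bar>real i - real j\<bar>}. \<bar>\<Omega> $$ (i,j)\<bar>) \<le> R"
    and \<tau>: "\<And>i j. \<bar>\<tau> i j\<bar> \<le> (if real k \<le> \<bar>real i - real j\<bar> then 1 else 0)"
  shows "\<bar>\<Sum>i<p. \<Sum>j<p. x i * (\<tau> i j * \<Omega> $$ (i,j)) * x j\<bar> \<le> R * (\<Sum>i<p. (x i)\<^sup>2)"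
proof -
  define g where "g = (\<lambda>i j. if real k \<le> \<bar>real i - real j\<bar> then \<bar>\<Omega> $$ (i,j)\<bar> else 0)"
  have rg: "(\<Sum>j<p. g i j) \<le> R" if "i < p" for i
  proof -
    have "(\<Sum>j<p. g i j) = (\<Sum>j\<in>{j. j < p \<and> real k \<le> \<bar>real i - real j\<bar>}. \<bar>\<Omega> $$ (i,j)\<bar>)"
      unfolding g_def by (intro sum.mono_neutral_cong_right) auto
    then show ?thesis using row[OF that] by simp
  qed
  have "\<bar>\<Sum>i<p. \<Sum>j<p. x i * (\<tau> i j * \<Omega> $$ (i,j)) * x j\<bar> \<le> (\<Sum>i<p. \<Sum>j<p. \<bar>x i * (\<tau> i j * \<Omega> $$ (i,j)) * x j\<bar>)"
    by (intro order_trans[OF sum_abs] sum_mono sum_abs)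
  also have "\<dots> \<le> (\<Sum>i<p. \<Sum>j<p. g i j * ((x i)\<^sup>2 + (x j)\<^sup>2) / 2)"
  proof (intro sum_mono)
    fix i j
    have "\<bar>x i * (\<tau> i j * \<Omega> $$ (i,j)) * x j\<bar> = (\<bar>\<tau> i j\<bar> * \<bar>\<Omega> $$ (i,j)\<bar>) * (\<bar>x i\<bar> * \<bar>x j\<bar>)"
      by (simp add: abs_mult)
    also have "\<dots> \<le> g i j * (((x i)\<^sup>2 + (x j)\<^sup>2) / 2)"
    proof (rule mult_mono)
      show "\<bar>\<tau> i j\<bar> * \<bar>\<Omega> $$ (i,j)\<bar> \<le> g i j"
        using \<tau>[of i j] mult_right_mono[OF \<tau>[of i j], of "\<bar>\<Omega> $$ (i,j)\<bar>"] by (auto simp: g_def split: if_splits)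
      show "\<bar>x i\<bar> * \<bar>x j\<bar> \<le> ((x i)\<^sup>2 + (x j)\<^sup>2) / 2"
        using sum_squares_bound[of "\<bar>x i\<bar>" "\<bar>x j\<bar>"] by simp
    qed (auto simp: g_def)
    finally show "\<bar>x i * (\<tau> i j * \<Omega> $$ (i,j)) * x j\<bar> \<le> g i j * ((x i)\<^sup>2 + (x j)\<^sup>2) / 2" by simp
  qed
  also have "\<dots> = ((\<Sum>i<p. \<Sum>j<p. g i j * (x i)\<^sup>2) + (\<Sum>i<p. \<Sum>j<p. g i j * (x j)\<^sup>2)) / 2"
    unfolding sum.distrib[symmetric] sum_divide_distrib distrib_left ..
  also have "(\<Sum>i<p. \<Sum>j<p. g i j * (x j)\<^sup>2) = (\<Sum>i<p. \<Sum>j<p. g i j * (x i)\<^sup>2)"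
    by (subst sum.swap, intro sum.cong refl) (auto simp: g_def sym abs_minus_commute)
  also have "((\<Sum>i<p. \<Sum>j<p. g i j * (x i)\<^sup>2) + (\<Sum>i<p. \<Sum>j<p. g i j * (x i)\<^sup>2)) / 2 = (\<Sum>i<p. (\<Sum>j<p. g i j) * (x i)\<^sup>2)"
    by (simp add: sum_distrib_right)
  also have "\<dots> \<le> (\<Sum>i<p. R * (x i)\<^sup>2)" using rg by (intro sum_mono mult_right_mono) auto
  finally show ?thesis by (simp add: sum_distrib_left)
qed

lemma sample_cov_symmetric:
  assumes "Z \<in> carrier_mat n p"
  shows "sample_cov Z \<in> carrier_mat p p" "symmetric_mat (sample_cov Z)"
proof -
  show c: "sample_cov Z \<in> carrier_mat p p" using assms by (simp add: sample_cov_def mult_carrier_mat[of _ p n _ p])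
  have "transpose_mat (transpose_mat Z * Z) = transpose_mat Z * Z"
    using assms by (simp add: transpose_mult[of _ p n _ p])
  moreover have "transpose_mat (c \<cdot>\<^sub>m B) = c \<cdot>\<^sub>m transpose_mat B" for c :: real and B by (intro eq_matI) auto
  ultimately show "symmetric_mat (sample_cov Z)" by (simp add: symmetric_mat_def sample_cov_def)
qed

section \<open>The estimator for a fixed data matrix\<close>

context
  fixes \<eta> :: real and n p k :: nat and Z :: "real Matrix.mat"
  assumes eta: "\<eta> > 1" and Z: "Z \<in> carrier_mat n p"
begin

definition local_entry :: "nat \<Rightarrow> int \<Rightarrow> nat \<Rightarrow> nat \<Rightarrow> real" where
  "local_entry b m i j = mat_inv (local_cov \<eta> b m Z) $$ (rank_in (outer_window p b m) i, rank_in (outer_window p b m) j)"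

lemma dim_Z: "dim_col Z = p"
  using Z by simp

lemma local_cov_eq: "local_cov \<eta> b m Z = spectral_clip \<eta> (submatrix (sample_cov Z) (outer_window p b m) (outer_window p b m))"
  by (simp add: local_cov_def Let_def dim_Z)

lemma local_inverse_within:
  "spectrum_within (card (outer_window p b m)) \<eta> (mat_inv (local_cov \<eta> b m Z))"
proof -
  note S = sample_cov_symmetric[OF Z]
  note sub = submatrix_principal(1)[OF S(1) inner_window_subset(2)] symmetric_submatrix[OF S inner_window_subset(2)]
  have W: "spectrum_within (card (outer_window p b m)) \<eta> (local_cov \<eta> b m Z)"
    unfolding local_cov_eq by (rule spectrum_within_spectral_clip[OF sub eta])
  have "\<eta> > 0" using eta by simp
  show ?thesis
    using spectrum_within_inverse[OF W \<open>\<eta> > 0\<close>] mat_inv_inverse[OF W \<open>\<eta> > 0\<close>] by blast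
qed

lemma block_sum_carrier: "block_sum \<eta> b Z \<in> carrier_mat p p"
  by (simp add: block_sum_def dim_Z)

lemma block_sum_entry:
  assumes "i < p" "j < p"
  shows "block_sum \<eta> b Z $$ (i,j) = (\<Sum>m\<in>{2 - int b..int p}.
    if i \<in> inner_window p b m \<and> j \<in> inner_window p b m then local_entry b m i j else 0)"
  using assms unfolding block_sum_def local_entry_def
  by (simp add: dim_Z embed_local_block_entry[OF dim_Z spectrum_withinD(1)[OF local_inverse_within]])

lemma local_entry_sym:
  assumes "i \<in> inner_window p b m" "j \<in> inner_window p b m"
  shows "local_entry b m i j = local_entry b m j i"
proof -
  have fJ: "finite (outer_window p b m)" by (rule finite_subset[OF inner_window_subset(2)]) simp
  have "rank_in (outer_window p b m) i < card (outer_window p b m)" "rank_in (outer_window p b m) j < card (outer_window p b m)"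
    by (intro rank_in_less_card[OF fJ] subsetD[OF inner_window_subset(1)] assms)+
  then show ?thesis
    using spectrum_withinD(1,2)[OF local_inverse_within[of b m]]
    unfolding local_entry_def symmetric_mat_def by (metis carrier_matD index_transpose_mat(1))
qed

definition raw_estimator :: "real Matrix.mat" where
  "raw_estimator = (1 / real k) \<cdot>\<^sub>m (block_sum \<eta> (2 * k) Z - block_sum \<eta> k Z)"

lemma raw_estimator_symmetric: "raw_estimator \<in> carrier_mat p p" "symmetric_mat raw_estimator"
proof -
  show c: "raw_estimator \<in> carrier_mat p p"
    using block_sum_carrier by (simp add: raw_estimator_def minus_carrier_mat)
  have bs: "block_sum \<eta> b Z $$ (j,i) = block_sum \<eta> b Z $$ (i,j)" if "i < p" "j < p" for b i j
    unfolding block_sum_entry[OF that] block_sum_entry[OF that(2,1)]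
    by (intro sum.cong refl) (auto simp: local_entry_sym)
  show "symmetric_mat raw_estimator" unfolding symmetric_mat_def
  proof (rule eq_matI)
    fix i j assume "i < dim_row raw_estimator" "j < dim_col raw_estimator"
    then have ij: "i < p" "j < p" using c by auto
    then show "transpose_mat raw_estimator $$ (i,j) = raw_estimator $$ (i,j)"
      using c block_sum_carrier[of k] block_sum_carrier[of "2 * k"] bs[OF ij] by (simp add: raw_estimator_def)
  qed (use c in auto)
qed

lemma cropping_estimator_eq: "cropping_estimator \<eta> k Z = spectral_clip \<eta> raw_estimator"
  by (simp add: cropping_estimator_def raw_estimator_def)

lemma cropping_estimator_within: "spectrum_within p \<eta> (cropping_estimator \<eta> k Z)"
  unfolding cropping_estimator_eq by (rule spectrum_within_spectral_clip[OF raw_estimator_symmetric eta])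

lemma op_norm_estimator_le:
  assumes W: "spectrum_within p \<eta> \<Omega>" and "e \<ge> 0"
    and quad: "\<And>x. x \<in> carrier_vec p \<Longrightarrow>
      \<bar>scalar_prod x (cropping_estimator \<eta> k Z *\<^sub>v x) - scalar_prod x (\<Omega> *\<^sub>v x)\<bar> \<le> e * scalar_prod x x"
  shows "0 \<le> op_norm (cropping_estimator \<eta> k Z - \<Omega>)" "op_norm (cropping_estimator \<eta> k Z - \<Omega>) \<le> e"
proof -
  note C = spectrum_withinD(1,2)[OF cropping_estimator_within] and O = spectrum_withinD(1,2)[OF W]
  have c: "cropping_estimator \<eta> k Z - \<Omega> \<in> carrier_mat p p" using O by (simp add: minus_carrier_mat)
  have s: "symmetric_mat (cropping_estimator \<eta> k Z - \<Omega>)"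
    using C O by (simp add: symmetric_mat_def transpose_minus[of _ p p])
  have q: "\<bar>scalar_prod x ((cropping_estimator \<eta> k Z - \<Omega>) *\<^sub>v x)\<bar> \<le> e * scalar_prod x x" if x: "x \<in> carrier_vec p" for x
    using quad[OF x] C O x by (simp add: minus_mult_distrib_mat_vec[of _ p p] scalar_prod_minus_distrib[of _ p] mult_mat_vec_carrier[of _ p p])
  show "0 \<le> op_norm (cropping_estimator \<eta> k Z - \<Omega>)" "op_norm (cropping_estimator \<eta> k Z - \<Omega>) \<le> e"
    using op_norm_symmetric_le[OF c s q \<open>e \<ge> 0\<close>] by auto
qed

text \<open>Holds for every data matrix, since both spectra lie in [1/\<eta>, \<eta>]; besides the
  trivial bound it supplies the nonnegativity that permits squaring upper bounds of the
  loss.\<close>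

lemma cropping_estimator_bounded:
  assumes W: "spectrum_within p \<eta> \<Omega>"
  shows "0 \<le> op_norm (cropping_estimator \<eta> k Z - \<Omega>)" "op_norm (cropping_estimator \<eta> k Z - \<Omega>) \<le> 2 * \<eta>"
proof -
  have q: "\<bar>scalar_prod x (cropping_estimator \<eta> k Z *\<^sub>v x) - scalar_prod x (\<Omega> *\<^sub>v x)\<bar> \<le> 2 * \<eta> * scalar_prod x x"
    if x: "x \<in> carrier_vec p" for x
  proof -
    have "scalar_prod x x \<ge> 0" by (simp add: scalar_prod_def sum_nonneg)
    then have "scalar_prod x x / \<eta> \<ge> 0" "\<eta> * scalar_prod x x \<ge> 0" using eta by simp_all
    then show ?thesis
      using spectrum_withinD(3,4)[OF cropping_estimator_within x] spectrum_withinD(3,4)[OF W x] by linarith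
  qed
  have "2 * \<eta> \<ge> 0" using eta by simp
  show "0 \<le> op_norm (cropping_estimator \<eta> k Z - \<Omega>)" "op_norm (cropping_estimator \<eta> k Z - \<Omega>) \<le> 2 * \<eta>"
    using op_norm_estimator_le[OF W \<open>2 * \<eta> \<ge> 0\<close> q] by auto
qed

text \<open>Each window costs \<open>(2 * e + R) * \<eta>\<^sup>2\<close>, where 2e is the local
  deviation after clipping. Sizes 2k and k contribute 2k and k times this, which after division by k
  gives the factor 3; the single \<open>R\<close> is the tapering error, and the outer 2 comes from
  the final clipping.\<close>

lemma cropping_estimator_error:
  assumes O: "\<Omega> \<in> precision_class p \<alpha> \<eta> M" and "\<alpha> > 0" "M > 0"
    and Sg: "Sg \<in> carrier_mat p p" "Sg * \<Omega> = 1\<^sub>m p" and "k \<ge> 1" "e \<ge> 0"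
    and close: "\<And>b m v. b \<in> {k, 2 * k} \<Longrightarrow> m \<in> {2 - int b..int p} \<Longrightarrow> v \<in> carrier_vec (card (outer_window p b m)) \<Longrightarrow>
      \<bar>scalar_prod v (submatrix (sample_cov Z) (outer_window p b m) (outer_window p b m) *\<^sub>v v)
        - scalar_prod v (submatrix Sg (outer_window p b m) (outer_window p b m) *\<^sub>v v)\<bar> \<le> e * scalar_prod v v"
  defines "R \<equiv> bias_bound \<alpha> \<eta> M k"
  shows "op_norm (cropping_estimator \<eta> k Z - \<Omega>) \<le> 2 * (3 * ((2 * e + R) * \<eta>\<^sup>2) + R)"
proof -
  have "\<eta> > 0" using eta by simp
  have W: "spectrum_within p \<eta> \<Omega>" by (rule precision_class_spectrum_within[OF O])
  note Oc = spectrum_withinD(1,2)[OF W]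
  have sym: "\<Omega> $$ (i,j) = \<Omega> $$ (j,i)" if "i < p" "j < p" for i j
    using Oc that unfolding symmetric_mat_def by (metis index_transpose_mat(1) carrier_matD)
  have row: "(\<Sum>j\<in>{j. j < p \<and> real k \<le> \<bar>real i - real j\<bar>}. \<bar>\<Omega> $$ (i,j)\<bar>) \<le> R" if "i < p" for i
    unfolding R_def using \<open>k \<ge> 1\<close> that by (rule precision_class_row_sum[OF O \<open>\<alpha> > 0\<close> \<open>M > 0\<close> \<open>\<eta> > 0\<close>])
  have "R > 0" unfolding R_def bias_bound_def decay_const_def
    using \<open>\<alpha> > 0\<close> \<open>M > 0\<close> \<open>\<eta> > 0\<close> \<open>k \<ge> 1\<close> by (intro mult_pos_pos add_pos_pos) auto
  define E where "E = (2 * e + R) * \<eta>\<^sup>2"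
  have local: "\<bar>\<Sum>i\<in>inner_window p b m. \<Sum>j\<in>inner_window p b m. x i * (local_entry b m i j - \<Omega> $$ (i,j)) * x j\<bar>
      \<le> E * (\<Sum>i\<in>inner_window p b m. (x i)\<^sup>2)"
    if b: "b \<in> {k, 2 * k}" and m: "m \<in> {2 - int b..int p}" for b m and x :: "nat \<Rightarrow> real"
    unfolding local_entry_def local_cov_eq E_def
  proof (rule local_inverse_error[OF W eta Sg sample_cov_symmetric[OF Z] inner_window_subset(2,1) \<open>R > 0\<close> \<open>e \<ge> 0\<close> close[OF b m]])
    show "(\<Sum>j\<in>{..<p} - outer_window p b m. (\<Sum>i\<in>inner_window p b m. \<Omega> $$ (j,i) * x i)\<^sup>2)
      \<le> R\<^sup>2 * (\<Sum>i\<in>inner_window p b m. (x i)\<^sup>2)"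
    proof (rule off_block_bound[OF sym row])
      fix i j assume "i \<in> inner_window p b m" "j \<in> {..<p} - outer_window p b m"
      \<comment> \<open>Within the index range the outer window extends the inner one by
        \<open>b\<close> >= \<open>k\<close> indices on either side.\<close>
      then show "real k \<le> \<bar>real i - real j\<bar>"
        using b by (auto simp: inner_window_def outer_window_def window_def)
    qed (use \<open>R > 0\<close> in \<open>auto simp: inner_window_def window_def\<close>)
  qed
  have quad: "\<bar>scalar_prod x (raw_estimator *\<^sub>v x) - scalar_prod x (\<Omega> *\<^sub>v x)\<bar> \<le> (3 * E + R) * scalar_prod x x"
    if xc: "x \<in> carrier_vec p" for x
  proof -
    define y where "y = (\<lambda>i. x $ i)"
    have x: "x = Matrix.vec p y" using xc by (intro eq_vecI) (auto simp: y_def)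
    define N where "N = (\<Sum>i<p. (y i)\<^sup>2)"
    have xx: "scalar_prod x x = N" unfolding x scalar_prod_fun N_def by (simp add: power2_eq_square)
    define Q where "Q = (\<lambda>b. \<Sum>i<p. \<Sum>j<p. y i * block_sum \<eta> b Z $$ (i,j) * y j)"
    define P where "P = (\<lambda>b. \<Sum>i<p. \<Sum>j<p. y i * (max 0 (real b - \<bar>real i - real j\<bar>) * \<Omega> $$ (i,j)) * y j)"
    have QP: "\<bar>Q b - P b\<bar> \<le> real b * E * N" if b: "b \<in> {k, 2 * k}" for b
    proof -
      have "Q b = (\<Sum>i<p. \<Sum>j<p. y i * (\<Sum>m\<in>{2 - int b..int p}.
          if i \<in> inner_window p b m \<and> j \<in> inner_window p b m then local_entry b m i j else 0) * y j)"
        unfolding Q_def by (intro sum.cong refl) (simp add: block_sum_entry)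
      moreover have "b \<ge> 1" using b \<open>k \<ge> 1\<close> by auto
      ultimately show ?thesis unfolding P_def N_def using window_sum_error[OF _ local[OF b], where x = y] by simp
    qed
    have rx: "scalar_prod x (raw_estimator *\<^sub>v x) = (Q (2 * k) - Q k) / real k"
    proof -
      have "scalar_prod x (raw_estimator *\<^sub>v x) = (\<Sum>i<p. \<Sum>j<p. y i * raw_estimator $$ (i,j) * y j)"
        unfolding x by (rule bilinear_fun[OF raw_estimator_symmetric(1)])
      also have "\<dots> = (\<Sum>i<p. \<Sum>j<p. (y i * block_sum \<eta> (2 * k) Z $$ (i,j) * y j - y i * block_sum \<eta> k Z $$ (i,j) * y j) / real k)"
        using block_sum_carrier[of k] block_sum_carrier[of "2 * k"]
        by (intro sum.cong refl) (simp add: raw_estimator_def algebra_simps diff_divide_distrib)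
      finally show ?thesis by (simp add: Q_def sum_subtractf sum_divide_distrib diff_divide_distrib)
    qed
    define \<tau> where "\<tau> = (\<lambda>i j. (max 0 (real (2 * k) - \<bar>real i - real j\<bar>) - max 0 (real k - \<bar>real i - real j\<bar>)) / real k - 1)"
    have tb: "\<bar>\<tau> i j\<bar> \<le> (if real k \<le> \<bar>real i - real j\<bar> then 1 else 0)" for i j
      unfolding \<tau>_def by (rule taper_weight_error[OF \<open>k \<ge> 1\<close>]) simp
    have "(P (2 * k) - P k) / real k - scalar_prod x (\<Omega> *\<^sub>v x) = (\<Sum>i<p. \<Sum>j<p. y i * (\<tau> i j * \<Omega> $$ (i,j)) * y j)"
      unfolding x bilinear_fun[OF Oc(1)] P_def \<tau>_def
      by (simp only: sum_subtractf[symmetric] sum_divide_distrib)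
         (intro sum.cong refl, simp only: left_diff_distrib right_diff_distrib diff_divide_distrib times_divide_eq_right times_divide_eq_left mult_1_left)
    then have bias: "\<bar>(P (2 * k) - P k) / real k - scalar_prod x (\<Omega> *\<^sub>v x)\<bar> \<le> R * N"
      using taper_bias[where p = p and k = k and R = R and \<tau> = \<tau> and x = y, OF sym row tb] by (simp add: N_def)
    have "\<bar>(Q (2 * k) - Q k) / real k - (P (2 * k) - P k) / real k\<bar> = \<bar>(Q (2 * k) - P (2 * k)) - (Q k - P k)\<bar> / real k"
      by (simp add: abs_divide diff_divide_distrib[symmetric] algebra_simps)
    also have "\<dots> \<le> (real (2 * k) * E * N + real k * E * N) / real k"
      using QP[of k] QP[of "2 * k"] by (intro divide_right_mono) (auto simp del: of_nat_mult)
    also have "\<dots> = 3 * E * N" using \<open>k \<ge> 1\<close> by (simp add: field_simps)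
    finally show ?thesis unfolding rx xx using bias by (simp add: algebra_simps abs_le_iff)
  qed
  have "3 * E + R \<ge> 0" using \<open>R > 0\<close> \<open>e \<ge> 0\<close> by (simp add: E_def)
  have "op_norm (cropping_estimator \<eta> k Z - \<Omega>) \<le> 2 * (3 * E + R)"
  proof (rule op_norm_estimator_le[OF W])
    show "\<bar>scalar_prod x (cropping_estimator \<eta> k Z *\<^sub>v x) - scalar_prod x (\<Omega> *\<^sub>v x)\<bar> \<le> 2 * (3 * E + R) * scalar_prod x x"
      if "x \<in> carrier_vec p" for x
      unfolding cropping_estimator_eq
      by (rule spectral_clip_close[OF raw_estimator_symmetric W eta quad that])
  qed (use \<open>3 * E + R \<ge> 0\<close> in simp)
  then show ?thesis by (simp add: E_def)
qed

end

section \<open>The risk bound\<close>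

lemma sub_gaussian_lawsD:
  assumes "\<mu> \<in> sub_gaussian_laws p \<rho> \<Omega>"
  shows "prob_space \<mu>" "i < p \<Longrightarrow> (\<lambda>x. x i) \<in> borel_measurable \<mu>" "i < p \<Longrightarrow> mean_vec p \<mu> $ i = 0"
    "sub_gaussian p \<rho> \<mu>" "cov_mat p \<mu> * \<Omega> = 1\<^sub>m p" "cov_mat p \<mu> \<in> carrier_mat p p"
proof -
  have s: "sets \<mu> = sets (real_space p)" and m: "mean_vec p \<mu> = 0\<^sub>v p" and prec: "precision_mat p \<mu> \<Omega>"
    using assms by (auto simp: sub_gaussian_laws_def)
  show "prob_space \<mu>" "sub_gaussian p \<rho> \<mu>" using assms by (auto simp: sub_gaussian_laws_def)
  show "(\<lambda>x. x i) \<in> borel_measurable \<mu>" if "i < p"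
    using that unfolding measurable_cong_sets[OF s refl] real_space_def
    by (intro measurable_component_singleton) auto
  show "mean_vec p \<mu> $ i = 0" if "i < p" using m that by simp
  show c: "cov_mat p \<mu> \<in> carrier_mat p p" by (simp add: cov_mat_def)
  then show "cov_mat p \<mu> * \<Omega> = 1\<^sub>m p" using prec by (simp add: precision_mat_def inverts_mat_def)
qed

context
  fixes p :: nat and \<rho> :: real and \<Omega> :: "real Matrix.mat" and \<mu> :: "(nat \<Rightarrow> real) measure"
  assumes mu: "\<mu> \<in> sub_gaussian_laws p \<rho> \<Omega>" and rho: "\<rho> > 0"
begin

lemma linear_form_measurable: "(\<lambda>x. \<Sum>i<p. u i * x i) \<in> borel_measurable \<mu>"
  using sub_gaussian_lawsD(2)[OF mu] by (intro borel_measurable_sum borel_measurable_times) auto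

text \<open>The tail condition is stated for unit vectors, but grid vectors lie anywhere in the unit
  ball: dividing by the norm r <= 1 only enlarges the event, and for r = 0 the event is empty
  because t > 0.\<close>

lemma linear_form_tail:
  assumes u: "(\<Sum>i<p. (u i)\<^sup>2) \<le> 1" and "t > 0"
  shows "measure \<mu> {x \<in> space \<mu>. \<bar>\<Sum>i<p. u i * x i\<bar> > t} \<le> 2 * exp (- t\<^sup>2 / (2 * \<rho>))"
proof -
  interpret prob_space \<mu> by (rule sub_gaussian_lawsD(1)[OF mu])
  note [measurable] = linear_form_measurable
  define r where "r = sqrt (\<Sum>i<p. (u i)\<^sup>2)"
  have r2: "r * r = (\<Sum>i<p. (u i)\<^sup>2)" by (simp add: r_def sum_nonneg)
  have r01: "0 \<le> r" "r \<le> 1" using u by (auto simp: r_def sum_nonneg)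
  show ?thesis
  proof (cases "r = 0")
    case True
    then have "(\<Sum>i<p. (u i)\<^sup>2) = 0" using r2 by simp
    then have "\<forall>i<p. u i = 0" by (subst (asm) sum_nonneg_eq_0_iff) auto
    then have "{x \<in> space \<mu>. \<bar>\<Sum>i<p. u i * x i\<bar> > t} = {}" using \<open>t > 0\<close> by auto
    then show ?thesis by (simp only: measure_empty) simp
  next
    case False
    then have r0: "r > 0" using r01 by simp
    define w where "w = Matrix.vec p (\<lambda>i. u i / r)"
    have "scalar_prod w w = (\<Sum>i<p. (u i)\<^sup>2) / (r * r)"
      by (simp add: w_def scalar_prod_fun power2_eq_square sum_divide_distrib)
    also have "\<dots> = 1" unfolding r2[symmetric] using r0 by simp
    finally have "vec_norm2 w = 1" by (simp add: vec_norm2_def)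
    moreover have "w \<in> carrier_vec p" by (simp add: w_def)
    ultimately have "measure \<mu> {x \<in> space \<mu>. \<bar>scalar_prod w (Matrix.vec p x - mean_vec p \<mu>)\<bar> > t} \<le> 2 * exp (- t\<^sup>2 / (2 * \<rho>))"
      using sub_gaussian_lawsD(4)[OF mu] \<open>t > 0\<close> unfolding sub_gaussian_def by blast
    moreover have "scalar_prod w (Matrix.vec p x - mean_vec p \<mu>) = (\<Sum>i<p. u i * x i) / r" for x
    proof -
      have "Matrix.vec p x - mean_vec p \<mu> = Matrix.vec p x"
        using sub_gaussian_lawsD(3)[OF mu] by (intro eq_vecI) (auto simp: mean_vec_def)
      then show ?thesis by (simp add: w_def scalar_prod_fun sum_divide_distrib)
    qed
    ultimately have "measure \<mu> {x \<in> space \<mu>. \<bar>(\<Sum>i<p. u i * x i) / r\<bar> > t} \<le> 2 * exp (- t\<^sup>2 / (2 * \<rho>))" by simp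
    moreover have "measure \<mu> {x \<in> space \<mu>. \<bar>\<Sum>i<p. u i * x i\<bar> > t} \<le> measure \<mu> {x \<in> space \<mu>. \<bar>(\<Sum>i<p. u i * x i) / r\<bar> > t}"
    proof (rule finite_measure_mono)
      have "\<bar>s\<bar> \<le> \<bar>s / r\<bar>" for s
        using r0 r01 by (simp add: abs_divide le_divide_eq mult_left_le)
      then show "{x \<in> space \<mu>. \<bar>\<Sum>i<p. u i * x i\<bar> > t} \<subseteq> {x \<in> space \<mu>. \<bar>(\<Sum>i<p. u i * x i) / r\<bar> > t}"
        by (auto intro: less_le_trans)
    qed measurable
    ultimately show ?thesis by linarith
  qed
qed

text \<open>A Bochner integral of a non-integrable function is 0 by convention; integrability is
  what lets the covariance form become the mean of a square. Squared coordinates are squared linear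
  forms along basis vectors.\<close>

lemma integrable_coordinate_product:
  assumes "i < p" "j < p"
  shows "integrable \<mu> (\<lambda>x. x i * x j)"
proof -
  have sq: "integrable \<mu> (\<lambda>x. (x i)\<^sup>2)" if i: "i < p" for i
  proof -
    define u where "u = (\<lambda>l. if l = i then 1 else 0 :: real)"
    have u: "(\<Sum>l<p. u l * x l) = x i" for x :: "nat \<Rightarrow> real"
      using i by (simp add: u_def if_distrib[of "\<lambda>t. t * _"] cong: if_cong)
    have "(\<Sum>l<p. (u l)\<^sup>2) = (\<Sum>l<p. u l * u l)" by (simp add: power2_eq_square)
    also have "\<dots> = 1" unfolding u by (simp add: u_def)
    finally have "(\<Sum>l<p. (u l)\<^sup>2) \<le> 1" by simp
    from sub_gaussian_square_moments(3)[OF sub_gaussian_lawsD(1)[OF mu] linear_form_measurable rho linear_form_tail[OF this]]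
    show ?thesis unfolding u .
  qed
  note [measurable] = sub_gaussian_lawsD(2)[OF mu assms(1)] sub_gaussian_lawsD(2)[OF mu assms(2)]
  show ?thesis
  proof (rule Bochner_Integration.integrable_bound)
    show "integrable \<mu> (\<lambda>x. (x i)\<^sup>2 + (x j)\<^sup>2)" using sq assms by auto
    show "AE x in \<mu>. norm (x i * x j) \<le> norm ((x i)\<^sup>2 + (x j)\<^sup>2)"
    proof (rule AE_I2)
      fix x :: "nat \<Rightarrow> real"
      have "2 * (\<bar>x i\<bar> * \<bar>x j\<bar>) \<le> (x i)\<^sup>2 + (x j)\<^sup>2"
        using sum_squares_bound[of "\<bar>x i\<bar>" "\<bar>x j\<bar>"] by simp
      moreover have "0 \<le> \<bar>x i\<bar> * \<bar>x j\<bar>" by simp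
      ultimately have "\<bar>x i\<bar> * \<bar>x j\<bar> \<le> (x i)\<^sup>2 + (x j)\<^sup>2" by linarith
      then show "norm (x i * x j) \<le> norm ((x i)\<^sup>2 + (x j)\<^sup>2)" by (simp add: abs_mult)
    qed
  qed measurable
qed

lemma cov_mat_entry: "i < p \<Longrightarrow> j < p \<Longrightarrow> cov_mat p \<mu> $$ (i,j) = (\<integral>x. x i * x j \<partial>\<mu>)"
  using sub_gaussian_lawsD(3)[OF mu] by (simp add: cov_mat_def)

text \<open>Reduces a covariance block to the scalar variable sum of u_i x_i. With the analogous
  identity for the sample covariance, a block deviation is an empirical second moment minus its
  expectation.\<close>

lemma cov_mat_form:
  assumes J: "J \<subseteq> {..<p}" and u: "\<And>i. i \<notin> J \<Longrightarrow> u i = 0"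
  shows "scalar_prod (restr J u) (submatrix (cov_mat p \<mu>) J J *\<^sub>v restr J u) = (\<integral>x. (\<Sum>i<p. u i * x i)\<^sup>2 \<partial>\<mu>)"
proof -
  have fJ: "finite J" using J finite_subset by auto
  note c = sub_gaussian_lawsD(6)[OF mu]
  have "(\<Sum>i<p. u i * x i)\<^sup>2 = (\<Sum>i\<in>J. \<Sum>j\<in>J. u i * u j * (x i * x j))" for x
  proof -
    have eq: "(\<Sum>i<p. u i * x i) = (\<Sum>i\<in>J. u i * x i)" by (rule sum_supported(1)[OF J u])
    show ?thesis unfolding eq unfolding power2_eq_square sum_product by (simp add: mult_ac)
  qed
  then have "(\<integral>x. (\<Sum>i<p. u i * x i)\<^sup>2 \<partial>\<mu>) = (\<Sum>i\<in>J. \<Sum>j\<in>J. u i * u j * (\<integral>x. x i * x j \<partial>\<mu>))"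
    using J by (simp add: integrable_coordinate_product subset_iff)
  also have "\<dots> = (\<Sum>i\<in>J. \<Sum>j\<in>J. u i * cov_mat p \<mu> $$ (i,j) * u j)"
    using J by (intro sum.cong refl) (auto simp: cov_mat_entry subset_iff)
  finally show ?thesis unfolding bilinear_restr[OF fJ submatrix_principal(1)[OF c J]]
    by (simp add: submatrix_principal(2)[OF c J])
qed

end

lemma sample_cov_form:
  fixes x :: "nat \<Rightarrow> nat \<Rightarrow> real" and n :: nat
  assumes J: "J \<subseteq> {..<p}" and u: "\<And>i. i \<notin> J \<Longrightarrow> u i = 0"
  defines "Z \<equiv> Matrix.mat n p (\<lambda>(i, j). x i j)"
  shows "scalar_prod (restr J u) (submatrix (sample_cov Z) J J *\<^sub>v restr J u)
    = 1 / real n * (\<Sum>r<n. (\<Sum>i<p. u i * x r i)\<^sup>2)"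
proof -
  have fJ: "finite J" using J finite_subset by auto
  have Z: "Z \<in> carrier_mat n p" by (simp add: Z_def)
  note c = sample_cov_symmetric(1)[OF Z]
  have ent: "sample_cov Z $$ (i,j) = 1 / real n * (\<Sum>r<n. x r i * x r j)" if "i < p" "j < p" for i j
    using that by (simp add: sample_cov_def Z_def scalar_prod_def lessThan_atLeast0)
  have "scalar_prod (restr J u) (submatrix (sample_cov Z) J J *\<^sub>v restr J u)
    = (\<Sum>i\<in>J. \<Sum>j\<in>J. u i * sample_cov Z $$ (i,j) * u j)"
    unfolding bilinear_restr[OF fJ submatrix_principal(1)[OF c J]]
    by (simp add: submatrix_principal(2)[OF c J])
  also have "\<dots> = (\<Sum>i\<in>J. \<Sum>j\<in>J. \<Sum>r<n. 1 / real n * (u i * x r i * (u j * x r j)))"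
    using J by (intro sum.cong refl) (auto simp: ent subset_iff sum_distrib_left sum_distrib_right sum_divide_distrib mult_ac)
  also have "\<dots> = (\<Sum>r<n. \<Sum>i\<in>J. \<Sum>j\<in>J. 1 / real n * (u i * x r i * (u j * x r j)))"
    by (subst sum.swap[of _ "{..<n}" J], subst sum.swap[of _ "{..<n}" J]) (rule refl)
  also have "\<dots> = (\<Sum>r<n. 1 / real n * (\<Sum>i\<in>J. u i * x r i)\<^sup>2)"
    unfolding power2_eq_square sum_product unfolding sum_distrib_left ..
  also have "\<dots> = 1 / real n * (\<Sum>r<n. (\<Sum>i<p. u i * x r i)\<^sup>2)"
  proof -
    have "(\<Sum>i<p. u i * x r i) = (\<Sum>i\<in>J. u i * x r i)" for r by (rule sum_supported(1)[OF J u])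
    then show ?thesis by (simp only: sum_distrib_left)
  qed
  finally show ?thesis .
qed

section \<open>Deviations over all windows and grid directions\<close>

definition block_deviation :: "nat \<Rightarrow> nat \<Rightarrow> (nat \<Rightarrow> real) measure \<Rightarrow> nat set \<Rightarrow> (nat \<Rightarrow> int) \<Rightarrow> (nat \<Rightarrow> nat \<Rightarrow> real) \<Rightarrow> real" where
  "block_deviation n p \<mu> J z x =
     scalar_prod (grid_vec (card J) z) (submatrix (sample_cov (Matrix.mat n p (\<lambda>(i, j). x i j))) J J *\<^sub>v grid_vec (card J) z)
     - scalar_prod (grid_vec (card J) z) (submatrix (cov_mat p \<mu>) J J *\<^sub>v grid_vec (card J) z)"

lemma block_deviation_mgf:
  assumes mu: "\<mu> \<in> sub_gaussian_laws p \<rho> \<Omega>" and "\<rho> > 0" and J: "J \<subseteq> {..<p}" and z: "z \<in> grid (card J)"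
    and c: "0 \<le> c" "c \<le> 1 / (8 * \<rho>)" and n: "n \<ge> 1"
  shows "(\<lambda>x. block_deviation n p \<mu> J z x) \<in> borel_measurable (PiM {..<n} (\<lambda>_. \<mu>))"
    "(\<integral>\<^sup>+x. ennreal (exp (real n * c * \<bar>block_deviation n p \<mu> J z x\<bar>)) \<partial>PiM {..<n} (\<lambda>_. \<mu>))
      \<le> ennreal (2 * exp (real n * (mgf_const \<rho> * c\<^sup>2)))"
proof -
  have fJ: "finite J" using J finite_subset by auto
  obtain u where u: "grid_vec (card J) z = restr J u" "\<And>i. i \<notin> J \<Longrightarrow> u i = 0"
    using restr_surj[OF fJ grid_vec_carrier] by blast
  have "(\<Sum>i<p. (u i)\<^sup>2) = scalar_prod (grid_vec (card J) z) (grid_vec (card J) z)"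
    unfolding u(1) scalar_prod_restr[OF fJ] power2_eq_square by (rule sum_supported(1)[OF J u(2)])
  also have "\<dots> \<le> 1" by (rule grid_vec_norm_le[OF z])
  finally have u1: "(\<Sum>i<p. (u i)\<^sup>2) \<le> 1" .
  have W: "block_deviation n p \<mu> J z x = 1 / real n * (\<Sum>r<n. (\<Sum>i<p. u i * x r i)\<^sup>2) - (\<integral>x. (\<Sum>i<p. u i * x i)\<^sup>2 \<partial>\<mu>)" for x
    unfolding block_deviation_def u(1)
    by (intro arg_cong2[where f = "(-)"] sample_cov_form[OF J u(2)] cov_mat_form[OF mu \<open>\<rho> > 0\<close> J u(2)])
  note [measurable] = linear_form_measurable[OF mu \<open>\<rho> > 0\<close>, of u]
  show "(\<lambda>x. block_deviation n p \<mu> J z x) \<in> borel_measurable (PiM {..<n} (\<lambda>_. \<mu>))"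
    unfolding W by measurable
  show "(\<integral>\<^sup>+x. ennreal (exp (real n * c * \<bar>block_deviation n p \<mu> J z x\<bar>)) \<partial>PiM {..<n} (\<lambda>_. \<mu>))
      \<le> ennreal (2 * exp (real n * (mgf_const \<rho> * c\<^sup>2)))"
    unfolding W
    by (rule nn_integral_exp_empirical_deviation_le[OF sub_gaussian_lawsD(1)[OF mu] linear_form_measurable[OF mu \<open>\<rho> > 0\<close>]
        \<open>\<rho> > 0\<close> linear_form_tail[OF mu \<open>\<rho> > 0\<close> u1] c n])
qed

definition test_points :: "nat \<Rightarrow> nat \<Rightarrow> ((nat \<times> int) \<times> (nat \<Rightarrow> int)) set" where
  "test_points p k = (SIGMA bm : (SIGMA b : {k, 2 * k}. {2 - int b..int p}). grid (card (outer_window p (fst bm) (snd bm))))"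

lemma finite_test_points: "finite (test_points p k)"
  unfolding test_points_def by (intro finite_SigmaI finite_grid) auto

lemma test_points_nonempty:
  assumes "k \<ge> 1" "p \<ge> 1"
  shows "test_points p k \<noteq> {}"
proof -
  obtain z where "z \<in> grid (card (outer_window p k (int p)))" using grid_nonempty by blast
  then have "((k, int p), z) \<in> test_points p k" using assms by (auto simp: test_points_def)
  then show ?thesis by blast
qed

text \<open>An outer window has at most 3b <= 6k indices, so its grid has at most exp(18 * 6k) =
  exp(108 k) points. The at most 2 (p + 2k) windows cost a further factor p exp(3k), giving 111 =
  108 + 3.\<close>

lemma card_test_points_le:
  assumes "k \<ge> 1" "p \<ge> 1"
  shows "real (card (test_points p k)) \<le> exp (111 * (ln (real p) + real k))"
proof -
  let ?A = "SIGMA b : {k, 2 * k}. {2 - int b..int p}"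
  have "card (test_points p k) = (\<Sum>bm\<in>?A. card (grid (card (outer_window p (fst bm) (snd bm)))))"
    unfolding test_points_def using finite_grid by (intro card_SigmaI) auto
  then have "real (card (test_points p k)) = (\<Sum>bm\<in>?A. real (card (grid (card (outer_window p (fst bm) (snd bm))))))"
    by simp
  also have "\<dots> \<le> (\<Sum>bm\<in>?A. exp (108 * real k))"
  proof (rule sum_mono)
    fix bm assume "bm \<in> ?A"
    then have "card (outer_window p (fst bm) (snd bm)) \<le> 6 * k"
      using card_outer_window_le[of p "fst bm" "snd bm"] by auto
    then have "18 * real (card (outer_window p (fst bm) (snd bm))) \<le> 108 * real k" by simp
    then show "real (card (grid (card (outer_window p (fst bm) (snd bm))))) \<le> exp (108 * real k)"
      by (intro order_trans[OF card_grid_le]) simp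
  qed
  also have "\<dots> = real (card ?A) * exp (108 * real k)" by simp
  also have "\<dots> \<le> exp (ln (real p) + 3 * real k) * exp (108 * real k)"
  proof (rule mult_right_mono)
    have "card ?A = (\<Sum>b\<in>{k, 2 * k}. card {2 - int b..int p})" by (intro card_SigmaI) auto
    also have "\<dots> \<le> (\<Sum>b\<in>{k, 2 * k}. p + 2 * k)" by (intro sum_mono) auto
    also have "\<dots> \<le> 2 * (p + 2 * k)"
      using assms by simp
    finally have "real (card ?A) \<le> real (2 * (p + 2 * k))" by (rule of_nat_le_iff[THEN iffD2])
    also have "\<dots> = 2 * (real p + 2 * real k)" by simp
    also have "\<dots> \<le> exp (real k) * (real p * exp (2 * real k))"
    proof (rule mult_mono)
      show "2 \<le> exp (real k)" using exp_ge_add_one_self[of "real k"] assms by linarith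
      have "real p + 2 * real k \<le> real p * (1 + 2 * real k)"
        using mult_right_mono[of 1 "real p" "2 * real k"] assms by (simp add: algebra_simps)
      also have "\<dots> \<le> real p * exp (2 * real k)" by (intro mult_left_mono exp_ge_add_one_self) auto
      finally show "real p + 2 * real k \<le> real p * exp (2 * real k)" .
    qed auto
    also have "\<dots> = exp (ln (real p) + 3 * real k)"
    proof -
      have "exp (ln (real p) + 3 * real k) = exp (ln (real p)) * (exp (real k) * exp (2 * real k))"
        unfolding exp_add[symmetric] by (simp add: algebra_simps)
      then show ?thesis using assms by simp
    qed
    finally show "real (card ?A) \<le> exp (ln (real p) + 3 * real k)" .
  qed simp
  also have "\<dots> = exp (ln (real p) + 111 * real k)" by (simp add: exp_add[symmetric])
  also have "\<dots> \<le> exp (111 * (ln (real p) + real k))" using assms by simp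
  finally show ?thesis .
qed

text \<open>The square of a maximum is controlled by exponential moments: above the threshold \<open>s\<close>,
  \<open>(y - s)\<^sup>2\<close> is at most \<open>2 exp (\<theta> (y - s)) / \<theta>\<^sup>2\<close>.\<close>

lemma square_le_threshold_exp:
  fixes y s \<theta> :: real
  assumes "y \<ge> 0" "s \<ge> 0" "\<theta> > 0"
  shows "y\<^sup>2 \<le> 2 * s\<^sup>2 + 4 / \<theta>\<^sup>2 * exp (\<theta> * (y - s))"
proof (cases "y \<le> s")
  case True
  then have "y\<^sup>2 \<le> s\<^sup>2" using assms by (intro power_mono) auto
  moreover have "0 \<le> 4 / \<theta>\<^sup>2 * exp (\<theta> * (y - s))" by simp
  moreover have "0 \<le> s\<^sup>2" by simp
  ultimately show ?thesis by linarith
next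
  case False
  define d where "d = y - s"
  have d: "d > 0" "\<theta> * d \<ge> 0" using False assms by (auto simp: d_def)
  have "(\<theta> * d)\<^sup>2 / 2 \<le> exp (\<theta> * d)" using exp_lower_Taylor_quadratic[OF d(2)] d by linarith
  then have "2 * d\<^sup>2 \<le> 4 / \<theta>\<^sup>2 * exp (\<theta> * d)" using assms by (simp add: power_mult_distrib field_simps)
  moreover have "y\<^sup>2 \<le> 2 * s\<^sup>2 + 2 * d\<^sup>2"
    using sum_squares_bound[of s d] by (simp add: d_def power2_eq_square algebra_simps)
  ultimately show ?thesis by (simp add: d_def)
qed

definition max_deviation :: "nat \<Rightarrow> nat \<Rightarrow> nat \<Rightarrow> (nat \<Rightarrow> real) measure \<Rightarrow> (nat \<Rightarrow> nat \<Rightarrow> real) \<Rightarrow> real" where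
  "max_deviation n p k \<mu> x = Max ((\<lambda>((b, m), z). \<bar>block_deviation n p \<mu> (outer_window p b m) z x\<bar>) ` test_points p k)"

lemma max_deviation_ge:
  assumes "b \<in> {k, 2 * k}" "m \<in> {2 - int b..int p}" "z \<in> grid (card (outer_window p b m))"
  shows "\<bar>block_deviation n p \<mu> (outer_window p b m) z x\<bar> \<le> max_deviation n p k \<mu> x"
proof -
  have "((b, m), z) \<in> test_points p k" using assms by (auto simp: test_points_def)
  then show ?thesis unfolding max_deviation_def using finite_test_points by (intro Max_ge) force+
qed

text \<open>Equals 2 A^2 + 8/c0^2 with c0 = 1/(8\<rho>), A = (111 + V c0^2)/c0 and V =
  \<open>mgf_const \<rho>\<close>: the squared threshold and the tail above it, both in units of
  q/n.\<close>

definition variance_const :: "real \<Rightarrow> real" where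
  "variance_const \<rho> = 2 * ((111 + mgf_const \<rho> * (1 / (8 * \<rho>))\<^sup>2) * (8 * \<rho>))\<^sup>2 + 8 * (8 * \<rho>)\<^sup>2"

text \<open>Above a threshold of order sqrt(q/n) the squared maximum is replaced by a sum of
  exponential moments over all test points; q <= n keeps the parameter c0 sqrt(q/n) admissible. The
  function \<open>f\<close> is arbitrary, so the loss is used only through its pointwise
  majorant.\<close>

lemma nn_integral_max_deviation_le:
  assumes mu: "\<mu> \<in> sub_gaussian_laws p \<rho> \<Omega>" and "\<rho> > 0" and n: "n \<ge> 1" and p: "p \<ge> 1" and k: "k \<ge> 1"
    and small: "ln (real p) + real k \<le> real n"
    and f: "\<And>x. f x \<le> a * (max_deviation n p k \<mu> x)\<^sup>2 + b" and "a \<ge> 0" "b \<ge> 0"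
  shows "(\<integral>\<^sup>+x. ennreal (f x) \<partial>PiM {..<n} (\<lambda>_. \<mu>))
    \<le> ennreal (a * variance_const \<rho> * ((ln (real p) + real k) / real n) + b)"
proof -
  let ?P = "PiM {..<n} (\<lambda>_. \<mu>)" and ?T = "test_points p k"
  interpret P: prob_space ?P by (intro prob_space_PiM sub_gaussian_lawsD(1)[OF mu])
  define q where "q = ln (real p) + real k"
  have "ln (real p) \<ge> 0" "real k \<ge> 1" using p k by auto
  then have q1: "q \<ge> 1" unfolding q_def by linarith
  define c0 where "c0 = 1 / (8 * \<rho>)"
  have c0: "c0 > 0" using \<open>\<rho> > 0\<close> by (simp add: c0_def)
  define \<delta> where "\<delta> = q / real n"
  have \<delta>: "\<delta> > 0" "\<delta> \<le> 1" "real n * \<delta> = q" using q1 n small by (auto simp: \<delta>_def q_def divide_le_eq)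
  define c where "c = c0 * sqrt \<delta>"
  have sd: "0 < sqrt \<delta>" "sqrt \<delta> \<le> 1" "sqrt \<delta> * sqrt \<delta> = \<delta>" using \<delta> by auto
  have c: "0 < c" "c \<le> 1 / (8 * \<rho>)" using c0 sd mult_left_mono[OF sd(2), of c0] by (auto simp: c_def c0_def)
  have V0: "mgf_const \<rho> \<ge> 0" using exp_square_const_ge_1 by (simp add: mgf_const_def)
  \<comment> \<open>Chosen so that \<theta> s = (111 + V c0^2) q with V =
    \<open>mgf_const \<rho>\<close>: 111 q pays for the number of test points, the rest for the
    moment bound at \<open>c\<close>, and the three exponentials cancel exactly.\<close>
  define A where "A = (111 + mgf_const \<rho> * c0\<^sup>2) / c0"
  have A0: "A \<ge> 0" using c0 V0 by (simp add: A_def)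
  define s where "s = A * sqrt \<delta>"
  define \<theta> where "\<theta> = real n * c"
  have th: "\<theta> > 0" using n c by (simp add: \<theta>_def)
  have ths: "\<theta> * s = (111 + mgf_const \<rho> * c0\<^sup>2) * q"
  proof -
    have "\<theta> * s = (c0 * A) * (real n * (sqrt \<delta> * sqrt \<delta>))" by (simp add: \<theta>_def s_def c_def mult_ac)
    then show ?thesis using c0 \<delta>(3) sd(3) by (simp add: A_def)
  qed
  have nc2: "real n * (mgf_const \<rho> * c\<^sup>2) = mgf_const \<rho> * c0\<^sup>2 * q"
    using \<delta>(3) \<delta>(1) by (simp add: c_def power_mult_distrib mult_ac)
  define dev where "dev = (\<lambda>t x. \<bar>block_deviation n p \<mu> (outer_window p (fst (fst t)) (snd (fst t))) (snd t) x\<bar>)"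
  have Yeq: "max_deviation n p k \<mu> x = Max ((\<lambda>t. dev t x) ` ?T)" for x
    unfolding max_deviation_def dev_def by (simp add: case_prod_unfold)
  define g where "g = a * (4 / \<theta>\<^sup>2 * exp (- \<theta> * s))"
  have g0: "g \<ge> 0" using \<open>a \<ge> 0\<close> by (simp add: g_def)
  have pt: "f x \<le> (a * (2 * s\<^sup>2) + b) + (\<Sum>t\<in>?T. g * exp (\<theta> * dev t x))" for x
  proof -
    have "Max ((\<lambda>t. dev t x) ` ?T) \<in> (\<lambda>t. dev t x) ` ?T"
      using finite_test_points test_points_nonempty[OF k p] by (intro Max_in) auto
    then obtain t where t: "t \<in> ?T" "max_deviation n p k \<mu> x = dev t x" unfolding Yeq by auto
    have "(dev t x)\<^sup>2 \<le> 2 * s\<^sup>2 + 4 / \<theta>\<^sup>2 * exp (\<theta> * (dev t x - s))"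
      by (rule square_le_threshold_exp) (use A0 sd th in \<open>auto simp: dev_def s_def\<close>)
    also have "exp (\<theta> * (dev t x - s)) = exp (- \<theta> * s) * exp (\<theta> * dev t x)"
      by (simp add: exp_add[symmetric] algebra_simps)
    finally have "a * (dev t x)\<^sup>2 \<le> a * (2 * s\<^sup>2 + 4 / \<theta>\<^sup>2 * (exp (- \<theta> * s) * exp (\<theta> * dev t x)))"
      using \<open>a \<ge> 0\<close> by (intro mult_left_mono)
    also have "\<dots> = a * (2 * s\<^sup>2) + g * exp (\<theta> * dev t x)" by (simp add: g_def algebra_simps)
    also have "g * exp (\<theta> * dev t x) \<le> (\<Sum>t\<in>?T. g * exp (\<theta> * dev t x))"
      using t(1) finite_test_points g0 by (intro member_le_sum) auto
    finally show ?thesis using f[of x] t(2) by simp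
  qed
  have mgf: "(\<lambda>x. dev t x) \<in> borel_measurable ?P"
    "(\<integral>\<^sup>+x. ennreal (exp (\<theta> * dev t x)) \<partial>?P) \<le> ennreal (2 * exp (mgf_const \<rho> * c0\<^sup>2 * q))" if t: "t \<in> ?T" for t
  proof -
    have z: "snd t \<in> grid (card (outer_window p (fst (fst t)) (snd (fst t))))"
      using t by (auto simp: test_points_def)
    note m = block_deviation_mgf[OF mu \<open>\<rho> > 0\<close> inner_window_subset(2) z less_imp_le[OF c(1)] c(2) n]
    show "(\<lambda>x. dev t x) \<in> borel_measurable ?P" unfolding dev_def using m(1) by (rule borel_measurable_abs)
    show "(\<integral>\<^sup>+x. ennreal (exp (\<theta> * dev t x)) \<partial>?P) \<le> ennreal (2 * exp (mgf_const \<rho> * c0\<^sup>2 * q))"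
      using m(2) unfolding dev_def \<theta>_def nc2 .
  qed
  have s20: "a * (2 * s\<^sup>2) + b \<ge> 0" using \<open>a \<ge> 0\<close> \<open>b \<ge> 0\<close> by simp
  have "(\<integral>\<^sup>+x. ennreal (f x) \<partial>?P)
    \<le> (\<integral>\<^sup>+x. ennreal (a * (2 * s\<^sup>2) + b) + (\<Sum>t\<in>?T. ennreal g * ennreal (exp (\<theta> * dev t x))) \<partial>?P)"
  proof (rule nn_integral_mono)
    fix x
    have "ennreal (f x) \<le> ennreal ((a * (2 * s\<^sup>2) + b) + (\<Sum>t\<in>?T. g * exp (\<theta> * dev t x)))"
      by (rule ennreal_leI[OF pt])
    also have "\<dots> = ennreal (a * (2 * s\<^sup>2) + b) + (\<Sum>t\<in>?T. ennreal g * ennreal (exp (\<theta> * dev t x)))"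
      using s20 g0 by (simp add: ennreal_plus sum_nonneg sum_ennreal[symmetric] ennreal_mult del: sum_ennreal)
    finally show "ennreal (f x) \<le> ennreal (a * (2 * s\<^sup>2) + b) + (\<Sum>t\<in>?T. ennreal g * ennreal (exp (\<theta> * dev t x)))" .
  qed
  also have "\<dots> = ennreal (a * (2 * s\<^sup>2) + b) + (\<Sum>t\<in>?T. ennreal g * (\<integral>\<^sup>+x. ennreal (exp (\<theta> * dev t x)) \<partial>?P))"
    using mgf(1) by (simp add: nn_integral_add nn_integral_sum nn_integral_cmult P.emeasure_space_1)
  also have "\<dots> \<le> ennreal (a * (2 * s\<^sup>2) + b) + (\<Sum>t\<in>?T. ennreal g * ennreal (2 * exp (mgf_const \<rho> * c0\<^sup>2 * q)))"
    by (intro add_left_mono sum_mono mult_left_mono mgf(2)) auto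
  also have "\<dots> = ennreal (a * (2 * s\<^sup>2) + b) + ennreal (real (card ?T) * (g * (2 * exp (mgf_const \<rho> * c0\<^sup>2 * q))))"
    using g0 by (simp add: ennreal_mult ennreal_of_nat_eq_real_of_nat)
  also have "\<dots> = ennreal (a * (2 * s\<^sup>2) + b + real (card ?T) * (g * (2 * exp (mgf_const \<rho> * c0\<^sup>2 * q))))"
    using s20 g0 by (intro ennreal_plus[symmetric]) auto
  also have "\<dots> \<le> ennreal (a * variance_const \<rho> * \<delta> + b)"
  proof (rule ennreal_leI)
    have "real (card ?T) * (g * (2 * exp (mgf_const \<rho> * c0\<^sup>2 * q)))
      \<le> exp (111 * q) * (g * (2 * exp (mgf_const \<rho> * c0\<^sup>2 * q)))"
      unfolding q_def using g0 by (intro mult_right_mono card_test_points_le k p) auto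
    also have "\<dots> = a * (8 / \<theta>\<^sup>2) * (exp (111 * q) * exp (- \<theta> * s) * exp (mgf_const \<rho> * c0\<^sup>2 * q))"
      by (simp add: g_def)
    also have "exp (111 * q) * exp (- \<theta> * s) * exp (mgf_const \<rho> * c0\<^sup>2 * q) = 1"
      using ths by (simp add: exp_add[symmetric] algebra_simps)
    also have "a * (8 / \<theta>\<^sup>2) * 1 \<le> a * (8 / c0\<^sup>2 * \<delta>)"
    proof -
      have "\<theta>\<^sup>2 = real n * c0\<^sup>2 * (real n * \<delta>)" using \<delta>(1) by (simp add: \<theta>_def c_def power_mult_distrib power2_eq_square)
      then have th2: "\<theta>\<^sup>2 = real n * c0\<^sup>2 * q" using \<delta>(3) by simp
      have "8 / \<theta>\<^sup>2 = 8 / c0\<^sup>2 * (1 / (real n * q))" unfolding th2 by simp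
      also have "\<dots> \<le> 8 / c0\<^sup>2 * \<delta>"
      proof (rule mult_left_mono)
        \<comment> \<open>Here q >= 1, a consequence of k >= 1, turns 1/(n q) into the required
          q/n.\<close>
        have "1 / q \<le> q" using q1 order_trans[of "1 / q" 1 q] by simp
        then have "1 / q / real n \<le> q / real n" by (intro divide_right_mono) auto
        then show "1 / (real n * q) \<le> \<delta>" by (simp add: \<delta>_def mult.commute)
      qed simp
      finally have "8 / \<theta>\<^sup>2 \<le> 8 / c0\<^sup>2 * \<delta>" .
      from mult_left_mono[OF this \<open>a \<ge> 0\<close>] show ?thesis by simp
    qed
    finally have "real (card ?T) * (g * (2 * exp (mgf_const \<rho> * c0\<^sup>2 * q))) \<le> a * (8 / c0\<^sup>2 * \<delta>)" .
    moreover have "s\<^sup>2 = A\<^sup>2 * \<delta>" using \<delta>(1) by (simp add: s_def power_mult_distrib)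
    moreover have "variance_const \<rho> = 2 * A\<^sup>2 + 8 / c0\<^sup>2"
      by (simp add: variance_const_def A_def c0_def power_divide)
    ultimately show "a * (2 * s\<^sup>2) + b + real (card ?T) * (g * (2 * exp (mgf_const \<rho> * c0\<^sup>2 * q))) \<le> a * variance_const \<rho> * \<delta> + b"
      by (simp add: algebra_simps)
  qed
  finally show ?thesis by (simp add: \<delta>_def q_def)
qed

text \<open>The grid costs a factor 2, so the local hypothesis holds with e = 2Y for the maximal
  deviation Y. The constant 24 = 2 * 3 * 2 * 2 collects the final clipping, the two block sizes, the
  local clipping and the grid.\<close>

lemma cropping_estimator_loss_le:
  assumes O: "\<Omega> \<in> precision_class p \<alpha> \<eta> M" and "\<alpha> > 0" "M > 0" "\<eta> > 1"
    and mu: "\<mu> \<in> sub_gaussian_laws p \<rho> \<Omega>" and "\<rho> > 0" and "k \<ge> 1" "p \<ge> 1"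
  shows "op_norm (cropping_estimator \<eta> k (Matrix.mat n p (\<lambda>(i, j). x i j)) - \<Omega>)
    \<le> 24 * \<eta>\<^sup>2 * max_deviation n p k \<mu> x + (6 * \<eta>\<^sup>2 + 2) * bias_bound \<alpha> \<eta> M k"
proof -
  define Z where "Z = Matrix.mat n p (\<lambda>(i, j). x i j)"
  have Z: "Z \<in> carrier_mat n p" by (simp add: Z_def)
  define Y where "Y = max_deviation n p k \<mu> x"
  have Y0: "Y \<ge> 0"
  proof -
    obtain z where "z \<in> grid (card (outer_window p k (int p)))" using grid_nonempty by blast
    then have "\<bar>block_deviation n p \<mu> (outer_window p k (int p)) z x\<bar> \<le> Y"
      unfolding Y_def using \<open>k \<ge> 1\<close> \<open>p \<ge> 1\<close> by (intro max_deviation_ge) auto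
    then show ?thesis by linarith
  qed
  note c = sub_gaussian_lawsD(6)[OF mu]
  have csym: "symmetric_mat (cov_mat p \<mu>)"
    unfolding symmetric_mat_def by (intro eq_matI) (auto simp: cov_mat_def mult.commute)
  note S = sample_cov_symmetric[OF Z]
  have "op_norm (cropping_estimator \<eta> k Z - \<Omega>) \<le> 2 * (3 * ((2 * (2 * Y) + bias_bound \<alpha> \<eta> M k) * \<eta>\<^sup>2) + bias_bound \<alpha> \<eta> M k)"
  proof (rule cropping_estimator_error[OF \<open>\<eta> > 1\<close> Z O \<open>\<alpha> > 0\<close> \<open>M > 0\<close> c sub_gaussian_lawsD(5)[OF mu] \<open>k \<ge> 1\<close>])
    show "2 * Y \<ge> 0" using Y0 by simp
    fix b m and v :: "real Matrix.vec"
    assume b: "b \<in> {k, 2 * k}" and m: "m \<in> {2 - int b..int p}"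
      and v: "v \<in> carrier_vec (card (outer_window p b m))"
    let ?J = "outer_window p b m"
    let ?d = "card ?J"
    note J = inner_window_subset(2)[of p b m]
    note sS = submatrix_principal(1)[OF S(1) J] symmetric_submatrix[OF S J]
      and sC = submatrix_principal(1)[OF c J] symmetric_submatrix[OF c csym J]
    let ?D = "submatrix (sample_cov Z) ?J ?J - submatrix (cov_mat p \<mu>) ?J ?J"
    have D: "?D \<in> carrier_mat ?d ?d" using sC by (simp add: minus_carrier_mat)
    have Ds: "symmetric_mat ?D" using sS sC by (simp add: symmetric_mat_def transpose_minus[of _ ?d ?d])
    have form: "scalar_prod w (?D *\<^sub>v w) = scalar_prod w (submatrix (sample_cov Z) ?J ?J *\<^sub>v w) - scalar_prod w (submatrix (cov_mat p \<mu>) ?J ?J *\<^sub>v w)"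
      if w: "w \<in> carrier_vec ?d" for w
      using sS(1) sC(1) w by (simp add: minus_mult_distrib_mat_vec[of _ ?d ?d] scalar_prod_minus_distrib[of _ ?d] mult_mat_vec_carrier[of _ ?d ?d])
    have "\<bar>scalar_prod v (?D *\<^sub>v v)\<bar> \<le> 2 * Y * scalar_prod v v"
    proof (rule quadratic_form_le_grid[OF D Ds _ v])
      fix z assume "z \<in> grid ?d"
      from max_deviation_ge[OF b m this, of n \<mu> x]
      show "\<bar>scalar_prod (grid_vec ?d z) (?D *\<^sub>v grid_vec ?d z)\<bar> \<le> Y"
        unfolding form[OF grid_vec_carrier] unfolding block_deviation_def Y_def Z_def .
    qed
    then show "\<bar>scalar_prod v (submatrix (sample_cov Z) ?J ?J *\<^sub>v v) - scalar_prod v (submatrix (cov_mat p \<mu>) ?J ?J *\<^sub>v v)\<bar>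
      \<le> 2 * Y * scalar_prod v v" unfolding form[OF v] .
  qed
  also have "\<dots> = 24 * \<eta>\<^sup>2 * Y + (6 * \<eta>\<^sup>2 + 2) * bias_bound \<alpha> \<eta> M k" by (simp add: algebra_simps)
  finally show ?thesis unfolding Z_def Y_def .
qed

text \<open>\<open>C\<close> adds up the constants of the two regimes and is fixed before n, p, k
  and the law. For q > n the ratio q/n exceeds 1 and absorbs the trivial bound 4 \<eta>^2; otherwise
  (u + v)^2 <= 2 u^2 + 2 v^2 separates deviation from bias.\<close>

lemma op_risk_le:
  assumes "\<alpha> > 0" "M > 0" "\<eta> > 1" "\<rho> > 0"
  obtains C where "C > 0"
    "\<And>n p k \<Omega> \<mu>. n \<ge> 1 \<Longrightarrow> p \<ge> 1 \<Longrightarrow> k \<ge> 1 \<Longrightarrow> \<Omega> \<in> precision_class p \<alpha> \<eta> M \<Longrightarrow> \<mu> \<in> sub_gaussian_laws p \<rho> \<Omega> \<Longrightarrow>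
      op_risk n p \<eta> k \<Omega> \<mu> \<le> ennreal (C * real k powr (- 2 * \<alpha>) + C * ((ln (real p) + real k) / real n))"
proof
  define a where "a = 2 * (24 * \<eta>\<^sup>2)\<^sup>2"
  define r where "r = decay_const \<alpha> \<eta> M * (2 * (1 + 1 / \<alpha>))"
  define b where "b = 2 * (6 * \<eta>\<^sup>2 + 2)\<^sup>2 * r\<^sup>2"
  define C where "C = (4 * \<eta>\<^sup>2) + (a * variance_const \<rho>) + b"
  have nn: "a \<ge> 0" "b \<ge> 0" "4 * \<eta>\<^sup>2 > 0" "a * variance_const \<rho> \<ge> 0"
    using assms by (auto simp: a_def b_def variance_const_def)
  show "C > 0" using nn unfolding C_def by linarith
  fix n p k :: nat and \<Omega> \<mu>
  assume n: "n \<ge> 1" and p: "p \<ge> 1" and k: "k \<ge> 1" and O: "\<Omega> \<in> precision_class p \<alpha> \<eta> M"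
    and mu: "\<mu> \<in> sub_gaussian_laws p \<rho> \<Omega>"
  define q where "q = (ln (real p) + real k) / real n"
  have q0: "q \<ge> 0" using p by (simp add: q_def)
  let ?Z = "\<lambda>x. Matrix.mat n p (\<lambda>(i, j). x i j)"
  let ?loss = "\<lambda>x. op_norm (cropping_estimator \<eta> k (?Z x) - \<Omega>)"
  have Z: "?Z x \<in> carrier_mat n p" for x :: "nat \<Rightarrow> nat \<Rightarrow> real" by simp
  note W = precision_class_spectrum_within[OF O]
  note bd = cropping_estimator_bounded[OF \<open>\<eta> > 1\<close> Z W]
  interpret P: prob_space "PiM {..<n} (\<lambda>_. \<mu>)" by (intro prob_space_PiM sub_gaussian_lawsD(1)[OF mu])
  have kp: "0 \<le> real k powr (- 2 * \<alpha>)" by simp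
  show "op_risk n p \<eta> k \<Omega> \<mu> \<le> ennreal (C * real k powr (- 2 * \<alpha>) + C * ((ln (real p) + real k) / real n))"
  proof (cases "ln (real p) + real k \<le> real n")
    case False
    then have q1: "q \<ge> 1" using n by (simp add: q_def)
    have "op_risk n p \<eta> k \<Omega> \<mu> \<le> (\<integral>\<^sup>+x. ennreal (4 * \<eta>\<^sup>2) \<partial>PiM {..<n} (\<lambda>_. \<mu>))"
      unfolding op_risk_def
    proof (intro nn_integral_mono ennreal_leI)
      fix x
      have "(?loss x)\<^sup>2 \<le> (2 * \<eta>)\<^sup>2" using bd[of k x] by (intro power_mono) auto
      then show "(?loss x)\<^sup>2 \<le> 4 * \<eta>\<^sup>2" by (simp add: power_mult_distrib)
    qed
    also have "\<dots> = ennreal (4 * \<eta>\<^sup>2)" by (simp add: P.emeasure_space_1)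
    also have "\<dots> \<le> ennreal (C * real k powr (- 2 * \<alpha>) + C * q)"
    proof (rule ennreal_leI)
      have "4 * \<eta>\<^sup>2 \<le> C * 1" using nn by (simp add: C_def)
      also have "\<dots> \<le> C * q" using q1 \<open>C > 0\<close> by (intro mult_left_mono) auto
      finally show "4 * \<eta>\<^sup>2 \<le> C * real k powr (- 2 * \<alpha>) + C * q" using \<open>C > 0\<close> kp by (simp add: add_increasing)
    qed
    finally show ?thesis by (simp add: q_def)
  next
    case True
    have bb: "(bias_bound \<alpha> \<eta> M k)\<^sup>2 = r\<^sup>2 * real k powr (- 2 * \<alpha>)"
    proof -
      have "(real k powr (- \<alpha>))\<^sup>2 = real k powr (- 2 * \<alpha>)"
        using k by (simp add: power2_eq_square powr_add[symmetric])
      then show ?thesis by (simp add: bias_bound_def r_def power_mult_distrib)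
    qed
    have "op_risk n p \<eta> k \<Omega> \<mu> \<le> ennreal (a * variance_const \<rho> * ((ln (real p) + real k) / real n) + b * real k powr (- 2 * \<alpha>))"
      unfolding op_risk_def
    proof (rule nn_integral_max_deviation_le[OF mu \<open>\<rho> > 0\<close> n p k True _ nn(1)])
      fix x
      let ?u = "24 * \<eta>\<^sup>2 * max_deviation n p k \<mu> x" and ?v = "(6 * \<eta>\<^sup>2 + 2) * bias_bound \<alpha> \<eta> M k"
      have "(?loss x)\<^sup>2 \<le> (?u + ?v)\<^sup>2"
        using bd[of k x] cropping_estimator_loss_le[OF O \<open>\<alpha> > 0\<close> \<open>M > 0\<close> \<open>\<eta> > 1\<close> mu \<open>\<rho> > 0\<close> k p] by (intro power_mono) auto
      also have "\<dots> \<le> 2 * ?u\<^sup>2 + 2 * ?v\<^sup>2"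
        using sum_squares_bound[of ?u ?v] by (simp add: power2_sum)
      also have "2 * ?u\<^sup>2 = a * (max_deviation n p k \<mu> x)\<^sup>2" by (simp add: a_def power_mult_distrib)
      also have "2 * ?v\<^sup>2 = b * real k powr (- 2 * \<alpha>)"
        unfolding power_mult_distrib bb by (simp add: b_def)
      finally show "(?loss x)\<^sup>2 \<le> a * (max_deviation n p k \<mu> x)\<^sup>2 + b * real k powr (- 2 * \<alpha>)" .
    qed (use nn in simp)
    also have "\<dots> \<le> ennreal (C * real k powr (- 2 * \<alpha>) + C * q)"
    proof (rule ennreal_leI)
      have "a * variance_const \<rho> * q \<le> C * q" using nn q0 by (intro mult_right_mono) (auto simp: C_def)
      moreover have "b * real k powr (- 2 * \<alpha>) \<le> C * real k powr (- 2 * \<alpha>)"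
        using nn kp by (intro mult_right_mono) (auto simp: C_def)
      ultimately show "a * variance_const \<rho> * ((ln (real p) + real k) / real n) + b * real k powr (- 2 * \<alpha>)
        \<le> C * real k powr (- 2 * \<alpha>) + C * q" by (simp add: q_def)
    qed
    finally show ?thesis by (simp add: q_def)
  qed
qed

text \<open>The power t = n^(1/(2\<alpha>+1)) balances t^(-2\<alpha>) with t/n. Rounding up
  preserves the bias bound, and k <= t + 1 <= 2t costs a factor 2 in the variance.\<close>

lemma optimal_bandwidth:
  fixes n k :: nat
  assumes "\<alpha> > 0" "n \<ge> 1" and k: "int k = \<lceil>real n powr (1 / (2 * \<alpha> + 1))\<rceil>"
  shows "k \<ge> 1" "real k powr (- 2 * \<alpha>) \<le> real n powr (- (2 * \<alpha>) / (2 * \<alpha> + 1))"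
    "real k / real n \<le> 2 * real n powr (- (2 * \<alpha>) / (2 * \<alpha> + 1))"
proof -
  define t where "t = real n powr (1 / (2 * \<alpha> + 1))"
  have t: "t \<ge> 1" using assms by (simp add: t_def ge_one_powr_ge_zero)
  have k1: "t \<le> real k" and k2: "real k \<le> t + 1"
    using k unfolding t_def[symmetric] by linarith+
  show "k \<ge> 1" using t k1 by linarith
  have "real k powr (- 2 * \<alpha>) \<le> t powr (- 2 * \<alpha>)" using k1 t assms by (intro powr_mono2') auto
  also have "\<dots> = real n powr (- (2 * \<alpha>) / (2 * \<alpha> + 1))" by (simp add: t_def powr_powr)
  finally show "real k powr (- 2 * \<alpha>) \<le> real n powr (- (2 * \<alpha>) / (2 * \<alpha> + 1))" .
  have "t / real n = real n powr (1 / (2 * \<alpha> + 1) - 1)"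
    using assms by (simp add: t_def powr_diff)
  also have "1 / (2 * \<alpha> + 1) - 1 = - (2 * \<alpha>) / (2 * \<alpha> + 1)" using assms by (simp add: field_simps)
  finally have tn: "t / real n = real n powr (- (2 * \<alpha>) / (2 * \<alpha> + 1))" .
  have "real k / real n \<le> 2 * t / real n" using k2 t by (intro divide_right_mono) auto
  then show "real k / real n \<le> 2 * real n powr (- (2 * \<alpha>) / (2 * \<alpha> + 1))" using tn by simp
qed

theorem theorem5:
  fixes \<alpha> M \<eta> \<rho> :: real
  assumes "\<alpha> > 0" and "M > 0" and "\<eta> > 1" and "\<rho> > 0"
  shows "\<exists>C>0. \<forall>n p :: nat. n \<ge> 1 \<longrightarrow> \<lceil>real n powr (1 / (2 * \<alpha> + 1))\<rceil> \<le> int p \<longrightarrow>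
    (\<forall>k\<ge>1. max_risk \<alpha> M \<eta> \<rho> n p k
        \<le> ennreal (C * real k powr (- 2 * \<alpha>) + C * ((ln (real p) + real k) / real n))) \<and>
    (\<forall>k. int k = \<lceil>real n powr (1 / (2 * \<alpha> + 1))\<rceil> \<longrightarrow>
      max_risk \<alpha> M \<eta> \<rho> n p k
        \<le> ennreal (C * real n powr (- (2 * \<alpha>) / (2 * \<alpha> + 1)) + C * (ln (real p) / real n)))"
proof -
  obtain C where C: "C > 0"
    "\<And>n p k \<Omega> \<mu>. n \<ge> 1 \<Longrightarrow> p \<ge> 1 \<Longrightarrow> k \<ge> 1 \<Longrightarrow> \<Omega> \<in> precision_class p \<alpha> \<eta> M \<Longrightarrow> \<mu> \<in> sub_gaussian_laws p \<rho> \<Omega> \<Longrightarrow>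
      op_risk n p \<eta> k \<Omega> \<mu> \<le> ennreal (C * real k powr (- 2 * \<alpha>) + C * ((ln (real p) + real k) / real n))"
    using op_risk_le[OF assms] by blast
  show ?thesis
  \<comment> \<open>At the optimal bandwidth the bias contributes the rate once and k/n contributes
    it twice; the factor 3 covers both and only weakens the bound for general
    \<open>k\<close>.\<close>
  proof (rule exI[of _ "3 * C"], intro conjI allI impI)
    show "3 * C > 0" using C(1) by simp
    fix n p :: nat
    assume n: "n \<ge> 1" and np: "\<lceil>real n powr (1 / (2 * \<alpha> + 1))\<rceil> \<le> int p"
    have "real n powr (1 / (2 * \<alpha> + 1)) \<ge> 1" using n assms by (simp add: ge_one_powr_ge_zero)
    \<comment> \<open>The lower bound on \<open>p\<close> excludes p = 0, so that ln p is
      nonnegative.\<close>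
    then have p: "p \<ge> 1" using np by linarith
    have risk: "max_risk \<alpha> M \<eta> \<rho> n p k \<le> ennreal (C * real k powr (- 2 * \<alpha>) + C * ((ln (real p) + real k) / real n))"
      if "k \<ge> 1" for k
      unfolding max_risk_def by (intro SUP_least C(2) n p that)
    show "max_risk \<alpha> M \<eta> \<rho> n p k \<le> ennreal (3 * C * real k powr (- 2 * \<alpha>) + 3 * C * ((ln (real p) + real k) / real n))"
      if k: "k \<ge> 1" for k
    proof (rule order_trans[OF risk[OF k] ennreal_leI])
      have "0 \<le> (ln (real p) + real k) / real n" using p by simp
      then show "C * real k powr (- 2 * \<alpha>) + C * ((ln (real p) + real k) / real n)
        \<le> 3 * C * real k powr (- 2 * \<alpha>) + 3 * C * ((ln (real p) + real k) / real n)"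
        using C(1) by (intro add_mono mult_right_mono) auto
    qed
    show "max_risk \<alpha> M \<eta> \<rho> n p k
        \<le> ennreal (3 * C * real n powr (- (2 * \<alpha>) / (2 * \<alpha> + 1)) + 3 * C * (ln (real p) / real n))"
      if k: "int k = \<lceil>real n powr (1 / (2 * \<alpha> + 1))\<rceil>" for k
    proof -
      note bw = optimal_bandwidth[OF assms(1) n k]
      let ?r = "real n powr (- (2 * \<alpha>) / (2 * \<alpha> + 1))"
      have "C * real k powr (- 2 * \<alpha>) + C * ((ln (real p) + real k) / real n)
        = C * (real k powr (- 2 * \<alpha>) + real k / real n + ln (real p) / real n)"
        by (simp add: add_divide_distrib algebra_simps)
      also have "\<dots> \<le> C * (3 * ?r + 3 * (ln (real p) / real n))"
      proof (rule mult_left_mono)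
        have "0 \<le> ln (real p) / real n" using p by simp
        then show "real k powr (- 2 * \<alpha>) + real k / real n + ln (real p) / real n \<le> 3 * ?r + 3 * (ln (real p) / real n)"
          using bw(2,3) by linarith
      qed (use C(1) in simp)
      also have "\<dots> = 3 * C * ?r + 3 * C * (ln (real p) / real n)" by (simp add: algebra_simps)
      finally show ?thesis by (intro order_trans[OF risk[OF bw(1)] ennreal_leI])
    qed
  qed
qed

end
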